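(* Let $n\ge 2$ be an integer and let $f=(f_1,f_{2,1},\ldots,f_{2,n}): (\Delta,g_\Delta)\to (\Delta,g_\Delta)\times(\mathbb B^n,g_{\mathbb B^n})$ be a holomorphic isometry such that $f_1$ is non-constant. Let $R:\mathbb P^1\to \mathbb P^1$ be the rational function such that $R(f_1(w))=w$ for all $w\in\Delta$. Then the following hold. (1) If $\deg(R)=m+1\le n$ for some positive integer $m$, then $f$ is congruent to a map $\widetilde f: (\Delta,g_\Delta)\to (\Delta,g_\Delta)\times(\mathbb B^n,g_{\mathbb B^n})$ defined by $\widetilde f(w)=(F(w),{\bf 0})$ for some holomorphic isometry $F:(\Delta,g_\Delta)\to (\Delta,g_\Delta)\times(\mathbb B^{m},g_{\mathbb B^{m}})$ such that: if $m\ge 2$, $F$ is not congruent to $(\widetilde F,{\bf 0})$ for any holomorphic isometry $\widetilde F:(\Delta,g_\Delta)\to (\Delta,g_\Delta)\times(\mathbb B^{m'},g_{\mathbb B^{m'}})$ with $m'\le m-1$; and if $m=1$, $F$ is not congruent to $(\widetilde F,0)$ for any holomorphic isometry $\widetilde F:(\Delta,g_\Delta)\to (\Delta,g_\Delta)$. (2) If $\deg(R)=1$, then $f$ is congruent to a map $\widetilde f: (\Delta,g_\Delta)\to (\Delta,g_\Delta)\times(\mathbb B^n,g_{\mathbb B^n})$ defined by $\widetilde f(w)=(F(w),{\bf 0})$ for some holomorphic isometry $F:(\Delta,g_\Delta)\to (\Delta,g_\Delta)$.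
   Context: $\mathbb B^n=\{z\in\mathbb C^n:\sum_{j}|z_j|^2<1\}$ is the complex unit ball and $\Delta=\mathbb B^1$. The metric $g_{\mathbb B^n}$ is the Kähler metric with Kähler form $-\sqrt{-1}\,\partial\overline\partial\log(1-\sum_{j=1}^n|z_j|^2)$. A holomorphic map $f=(f_1,f_2):\Delta\to\Delta\times\mathbb B^n$, $f_2=(f_{2,1},\ldots,f_{2,n})$, is a holomorphic isometry $(\Delta,g_\Delta)\to(\Delta,g_\Delta)\times(\mathbb B^n,g_{\mathbb B^n})$ if $g_\Delta=f_1^*g_\Delta+f_2^*g_{\mathbb B^n}$. Two holomorphic isometries $F_1,F_2$ from $D$ to $\Omega$ (with $D=\Delta$ and $\Omega=\Delta\times \mathbb B^n$) are congruent if $F_1=\Psi\circ F_2\circ\phi$ for some $\phi\in\mathrm{Aut}(D)$, $\Psi\in\mathrm{Aut}(\Omega)$ (biholomorphic automorphisms). When $f_1$ is non-constant there is a unique rational function $R:\mathbb P^1\to\mathbb P^1$ with $R(f_1(w))=w$ on $\Delta$; $\deg(R)$ is its degree as a self-map of $\mathbb P^1$. The symbol ${\bf 0}$ denotes zero entries filling the remaining coordinates of the ball factor; $\mathbb B^{m'}$ is understood with $m'\ge 1$. *)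

theory Defs
  imports
    "HOL-Complex_Analysis.Complex_Analysis"
    "HOL-Computational_Algebra.Computational_Algebra"
    "HOL-Computational_Algebra.Field_as_Ring"
begin

text \<open>
  Several dimensions occur, and are quantified over, in one statement.  A vector of
  \<open>\<complex>\<^sup>n\<close> is therefore a sequence \<open>v :: nat \<Rightarrow> complex\<close> with coordinates \<open>v 0, \<dots>, v (n - 1)\<close>
  and \<open>v j = 0\<close> for all \<open>j \<ge> n\<close>; the normalisation beyond \<open>n\<close> makes equality of vectors,
  and hence bijectivity of maps between domains, mean the right thing.
\<close>

definition cvec :: "nat \<Rightarrow> (nat \<Rightarrow> complex) set" where
  "cvec n = {v. \<forall>j\<ge>n. v j = 0}"

definition complex_ball :: "nat \<Rightarrow> (nat \<Rightarrow> complex) set" where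
  "complex_ball n = {z \<in> cvec n. (\<Sum>j<n. (cmod (z j))\<^sup>2) < 1}"

abbreviation disc :: "complex set" (\<open>\<Delta>\<close>) where
  "\<Delta> \<equiv> ball 0 1"

definition disc_ball :: "nat \<Rightarrow> (complex \<times> (nat \<Rightarrow> complex)) set" where
  "disc_ball n = \<Delta> \<times> complex_ball n"

text \<open>The vector \<open>(v 0, \<dots>, v (m - 1), 0, 0, \<dots>)\<close>.\<close>

definition pad_zeros :: "nat \<Rightarrow> (nat \<Rightarrow> complex) \<Rightarrow> (nat \<Rightarrow> complex)" where
  "pad_zeros m v = (\<lambda>j. if j < m then v j else 0)"


subsection \<open>Kaehler metrics\<close>

text \<open>The Wirtinger derivatives \<open>\<partial>/\<partial>z\<^sub>j\<close> and \<open>\<partial>/\<partial>\<close>conj \<open>z\<^sub>j\<close>.\<close>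

definition partial_re :: "nat \<Rightarrow> ((nat \<Rightarrow> complex) \<Rightarrow> complex) \<Rightarrow> (nat \<Rightarrow> complex) \<Rightarrow> complex" where
  "partial_re j h z = vector_derivative (\<lambda>t::real. h (z(j := z j + of_real t))) (at 0)"

definition partial_im :: "nat \<Rightarrow> ((nat \<Rightarrow> complex) \<Rightarrow> complex) \<Rightarrow> (nat \<Rightarrow> complex) \<Rightarrow> complex" where
  "partial_im j h z = vector_derivative (\<lambda>t::real. h (z(j := z j + \<i> * of_real t))) (at 0)"

definition wirtinger :: "nat \<Rightarrow> ((nat \<Rightarrow> complex) \<Rightarrow> complex) \<Rightarrow> (nat \<Rightarrow> complex) \<Rightarrow> complex" where
  "wirtinger j h z = (partial_re j h z - \<i> * partial_im j h z) / 2"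

definition wirtinger_bar :: "nat \<Rightarrow> ((nat \<Rightarrow> complex) \<Rightarrow> complex) \<Rightarrow> (nat \<Rightarrow> complex) \<Rightarrow> complex" where
  "wirtinger_bar j h z = (partial_re j h z + \<i> * partial_im j h z) / 2"

definition ball_potential :: "nat \<Rightarrow> (nat \<Rightarrow> complex) \<Rightarrow> complex" where
  "ball_potential n z = - of_real (ln (1 - (\<Sum>j<n. (cmod (z j))\<^sup>2)))"

text \<open>
  The Kaehler form \<open>\<i> \<partial>\<partial>bar \<phi> = \<i> \<Sum>\<^sub>j\<^sub>k \<phi>\<^sub>j\<^sub>k dz\<^sub>j \<and> conj dz\<^sub>k\<close>, where
  \<open>\<phi>\<^sub>j\<^sub>k = \<partial>\<^sup>2\<phi>/\<partial>z\<^sub>j \<partial>\<close>conj \<open>z\<^sub>k\<close>, belongs to the metric with Hermitian form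
  \<open>(u, v) \<mapsto> \<Sum>\<^sub>j\<^sub>k \<phi>\<^sub>j\<^sub>k u\<^sub>j\<close> conj \<open>v\<^sub>k\<close> on holomorphic tangent vectors.
\<close>

definition ball_metric ::
  "nat \<Rightarrow> (nat \<Rightarrow> complex) \<Rightarrow> (nat \<Rightarrow> complex) \<Rightarrow> (nat \<Rightarrow> complex) \<Rightarrow> complex" where
  "ball_metric n z u v =
     (\<Sum>j<n. \<Sum>k<n. wirtinger j (wirtinger_bar k (ball_potential n)) z * u j * cnj (v k))"

definition disc_metric :: "complex \<Rightarrow> complex \<Rightarrow> complex \<Rightarrow> complex" where
  "disc_metric w u v =
     ball_metric 1 (pad_zeros 1 (\<lambda>_. w)) (pad_zeros 1 (\<lambda>_. u)) (pad_zeros 1 (\<lambda>_. v))"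


subsection \<open>Holomorphic isometries\<close>

text \<open>Holomorphic isometries \<open>(\<Delta>, g) \<rightarrow> (\<Delta>, g)\<close>.\<close>

definition disc_isometry :: "(complex \<Rightarrow> complex) \<Rightarrow> bool" where
  "disc_isometry F \<longleftrightarrow>
     F holomorphic_on \<Delta> \<and> F ` \<Delta> \<subseteq> \<Delta> \<and>
     (\<forall>w\<in>\<Delta>. \<forall>u v. disc_metric w u v = disc_metric (F w) (deriv F w * u) (deriv F w * v))"

text \<open>Holomorphic isometries from the disc to the product of the disc and the \<open>n\<close>-ball.\<close>

definition holo_isometry :: "nat \<Rightarrow> (complex \<Rightarrow> complex \<times> (nat \<Rightarrow> complex)) \<Rightarrow> bool" where
  "holo_isometry n f \<longleftrightarrow>
     (\<lambda>w. fst (f w)) holomorphic_on \<Delta> \<and>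
     (\<forall>j<n. (\<lambda>w. snd (f w) j) holomorphic_on \<Delta>) \<and>
     f ` \<Delta> \<subseteq> disc_ball n \<and>
     (\<forall>w\<in>\<Delta>. \<forall>u v.
        disc_metric w u v =
          disc_metric (fst (f w)) (deriv (\<lambda>w. fst (f w)) w * u) (deriv (\<lambda>w. fst (f w)) w * v) +
          ball_metric n (snd (f w))
            (\<lambda>j. deriv (\<lambda>w. snd (f w) j) w * u) (\<lambda>j. deriv (\<lambda>w. snd (f w) j) w * v))"


subsection \<open>Automorphisms and congruence\<close>

definition prod_dist ::
  "nat \<Rightarrow> complex \<times> (nat \<Rightarrow> complex) \<Rightarrow> complex \<times> (nat \<Rightarrow> complex) \<Rightarrow> real" where
  "prod_dist n p q = sqrt ((cmod (fst q - fst p))\<^sup>2 + (\<Sum>j<n. (cmod (snd q j - snd p j))\<^sup>2))"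

text \<open>
  Holomorphy of a scalar function on an open subset \<open>U\<close> of \<open>\<complex> \<times> \<complex>\<^sup>n\<close>: at every point there
  is a complex-linear first-order approximation.
\<close>

definition holomorphic_prod ::
  "nat \<Rightarrow> (complex \<times> (nat \<Rightarrow> complex) \<Rightarrow> complex) \<Rightarrow> (complex \<times> (nat \<Rightarrow> complex)) set \<Rightarrow> bool" where
  "holomorphic_prod n h U \<longleftrightarrow>
     (\<forall>p\<in>U. \<exists>a b. \<forall>\<epsilon>>0. \<exists>\<delta>>0. \<forall>q\<in>U. prod_dist n p q < \<delta> \<longrightarrow>
        cmod (h q - h p - (a * (fst q - fst p) + (\<Sum>j<n. b j * (snd q j - snd p j))))
          \<le> \<epsilon> * prod_dist n p q)"

definition holomorphic_map ::
  "nat \<Rightarrow> (complex \<times> (nat \<Rightarrow> complex) \<Rightarrow> complex \<times> (nat \<Rightarrow> complex)) \<Rightarrow>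
   (complex \<times> (nat \<Rightarrow> complex)) set \<Rightarrow> bool" where
  "holomorphic_map n \<Psi> U \<longleftrightarrow>
     holomorphic_prod n (\<lambda>p. fst (\<Psi> p)) U \<and>
     (\<forall>j<n. holomorphic_prod n (\<lambda>p. snd (\<Psi> p) j) U)"

definition disc_aut :: "(complex \<Rightarrow> complex) set" where
  "disc_aut = {\<phi>. bij_betw \<phi> \<Delta> \<Delta> \<and> \<phi> holomorphic_on \<Delta> \<and> inv_into \<Delta> \<phi> holomorphic_on \<Delta>}"

definition disc_ball_aut ::
  "nat \<Rightarrow> (complex \<times> (nat \<Rightarrow> complex) \<Rightarrow> complex \<times> (nat \<Rightarrow> complex)) set" where
  "disc_ball_aut n =
     {\<Psi>. bij_betw \<Psi> (disc_ball n) (disc_ball n) \<and>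
         holomorphic_map n \<Psi> (disc_ball n) \<and>
         holomorphic_map n (inv_into (disc_ball n) \<Psi>) (disc_ball n)}"

text \<open>Congruence of maps from the disc to the product of the disc and the \<open>n\<close>-ball.\<close>

definition congruent_maps ::
  "nat \<Rightarrow> (complex \<Rightarrow> complex \<times> (nat \<Rightarrow> complex)) \<Rightarrow>
   (complex \<Rightarrow> complex \<times> (nat \<Rightarrow> complex)) \<Rightarrow> bool" where
  "congruent_maps n F\<^sub>1 F\<^sub>2 \<longleftrightarrow>
     (\<exists>\<phi>\<in>disc_aut. \<exists>\<Psi>\<in>disc_ball_aut n. \<forall>w\<in>\<Delta>. F\<^sub>1 w = \<Psi> (F\<^sub>2 (\<phi> w)))"


subsection \<open>Rational functions\<close>

text \<open>
  \<open>quot_of_fract\<close> yields a numerator and denominator in lowest terms.  So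
  \<open>rational_value R z w\<close> says that \<open>z\<close> is not a pole of \<open>R\<close> and that \<open>R(z) = w\<close>, and
  \<open>rational_degree R\<close> is the degree of \<open>R\<close> as a self-map of the Riemann sphere.
\<close>

definition rational_value :: "complex poly fract \<Rightarrow> complex \<Rightarrow> complex \<Rightarrow> bool" where
  "rational_value R z w \<longleftrightarrow>
     poly (snd (quot_of_fract R)) z \<noteq> 0 \<and>
     poly (fst (quot_of_fract R)) z / poly (snd (quot_of_fract R)) z = w"

definition rational_degree :: "complex poly fract \<Rightarrow> nat" where
  "rational_degree R = max (degree (fst (quot_of_fract R))) (degree (snd (quot_of_fract R)))"

end

theory Submission
  imports Defs
begin

text \<open>
  After composing with automorphisms, \<open>f(0) = 0\<close>. Polarizing the equality of metrics and integrating
  twice gives \<open>1 - w \<omega>\<^sup>* = (1 - f\<^sub>1(w) f\<^sub>1(\<omega>)\<^sup>*) (1 - \<langle>f\<^sub>2(w), f\<^sub>2(\<omega>)\<rangle>)\<close> near the origin. Substitute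
  \<open>w = R(z)\<close>, where \<open>R = P/Q\<close> is in lowest terms and \<open>P = z p\<close>. The vectors \<open>v\<^sub>a\<close> of Taylor coefficients of
  \<open>Q(z) f\<^sub>2(R(z)) / z\<close> have a Gram matrix \<open>K\<close> with \<open>K - S K S\<^sup>* = p p\<^sup>* - q q\<^sup>*\<close>, where \<open>S\<close> is the shift and
  \<open>q = Q\<close>. Far down its diagonals \<open>K\<close> is constant and banded; since the \<open>v\<^sub>a\<close> lie in a finite-dimensional
  space, only finitely many are nonzero, and comparing degrees leaves exactly \<open>v\<^sub>0, \<dots>, v\<^sub>m\<^sub>-\<^sub>1\<close> with
  \<open>m = deg R - 1\<close>. So \<open>f\<^sub>2\<close> lies in an \<open>m\<close>-dimensional subspace, which a unitary map moves to
  \<open>\<complex>\<^sup>m\<close>. A null vector of \<open>K\<close> generates a sequence annihilated by \<open>p\<close> and \<open>q\<close>, hence by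
  \<open>1\<close>, so \<open>v\<^sub>0, \<dots>, v\<^sub>m\<^sub>-\<^sub>1\<close> are linearly independent, and then so are the \<open>m + 1\<close> components of \<open>F\<close>.
  If \<open>F\<close> were congruent to a map into a smaller ball, Cartan's theorem on automorphisms fixing the
  origin would put its image into a hyperplane.
\<close>

section \<open>Displacement kernels\<close>

text \<open>Under \<open>w = R(z)\<close> the first component becomes the coordinate z itself. With
  g = Q (f_2 o R), clearing denominators gives (1 - z conj(\<xi>)) <g(z), g(\<xi>)> = P(z)
  conj(P(\<xi>)) - z conj(\<xi>) Q(z) conj(Q(\<xi>)). Both g and P vanish at 0, so z conj(\<xi>) can
  be divided out; this produces p and q and lowers the expected dimension from deg R to deg R - 1.
  Only deg q \<le> m + 1 is known at the outset, and the excess coefficient is excluded by the Gram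
  matrix itself. The obstacle in the minimality claim is that a congruence may use any automorphism
  of the product. It need not be assumed to split into factors, and for m = 1 it can exchange the
  two discs. A hyperplane z_k = 0 of the ball factor may therefore land on one that involves the
  first component, which is why independence is proved for all m + 1 components and not only for
  those of f_2.\<close>

definition cip :: "nat \<Rightarrow> (nat \<Rightarrow> complex) \<Rightarrow> (nat \<Rightarrow> complex) \<Rightarrow> complex" where
  "cip n x y = (\<Sum>j<n. x j * cnj (y j))"

lemma cip_commute: "cip n y x = cnj (cip n x y)"
  by (simp add: cip_def mult.commute)

lemma cip_self: "cip n x x = of_real (\<Sum>j<n. (cmod (x j))\<^sup>2)"
  by (simp add: cip_def complex_norm_square [symmetric] del: of_real_power)

lemma Re_cip_self: "Re (cip n x x) = (\<Sum>j<n. (cmod (x j))\<^sup>2)"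
  by (simp add: cip_self)

lemma cip_self_eq_0: "cip n x x = 0 \<Longrightarrow> j < n \<Longrightarrow> x j = 0"
  by (simp only: cip_self of_real_eq_0_iff) (simp add: sum_nonneg_eq_0_iff)

lemma cip_zero_left: "(\<And>j. j < n \<Longrightarrow> x j = 0) \<Longrightarrow> cip n x y = 0"
  by (simp add: cip_def)

lemma bessel:
  fixes N :: nat
  assumes orth: "\<And>k l. k < N \<Longrightarrow> l < N \<Longrightarrow> k \<noteq> l \<Longrightarrow> cip n (u k) (u l) = 0"
    and norm: "\<And>k. k < N \<Longrightarrow> cip n (u k) (u k) = of_real c" and "c > 0"
  shows "(\<Sum>k<N. (cmod (cip n x (u k)))\<^sup>2) \<le> c * (\<Sum>j<n. (cmod (x j))\<^sup>2)"
proof -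
  define a where "a k = cip n x (u k) / c" for k
  define y where "y j = x j - (\<Sum>k<N. a k * u k j)" for j
  have y_left: "cip n y z = cip n x z - (\<Sum>k<N. a k * cip n (u k) z)" for z
    unfolding cip_def y_def
    by (simp add: left_diff_distrib sum_subtractf sum_distrib_left sum_distrib_right mult.assoc)
       (rule sum.swap)
  have yu: "cip n y (u l) = 0" if "l < N" for l
  proof -
    have "(\<Sum>k<N. a k * cip n (u k) (u l)) = (\<Sum>k<N. if l = k then a l * c else 0)"
      using that orth norm by (intro sum.cong) auto
    then show ?thesis using that \<open>c > 0\<close> by (simp add: a_def y_left)
  qed
  have "cip n y y = cip n x y - (\<Sum>k<N. a k * cip n (u k) y)" by (rule y_left)
  also have "\<dots> = cnj (cip n y x)" using yu cip_commute [of n y] by simp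
  also have "cip n y x = cip n x x - (\<Sum>k<N. a k * cip n (u k) x)" by (rule y_left)
  also have "(\<Sum>k<N. a k * cip n (u k) x) = (\<Sum>k<N. of_real ((cmod (cip n x (u k)))\<^sup>2 / c))"
  proof (intro sum.cong refl)
    fix k
    show "a k * cip n (u k) x = of_real ((cmod (cip n x (u k)))\<^sup>2 / c)"
      using cip_commute [of n "u k" x] complex_norm_square [of "cip n x (u k)"]
      by (simp add: a_def)
  qed
  also have "\<dots> = of_real ((\<Sum>k<N. (cmod (cip n x (u k)))\<^sup>2) / c)"
    by (simp add: sum_divide_distrib)
  finally have "Re (cip n y y) = Re (cip n x x) - (\<Sum>k<N. (cmod (cip n x (u k)))\<^sup>2) / c"
    by (metis Re_complex_of_real minus_complex.sel(1) complex_cnj(1) cnj.sel(1))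
  moreover have "Re (cip n y y) \<ge> 0" unfolding Re_cip_self by (simp add: sum_nonneg)
  ultimately have "(\<Sum>k<N. (cmod (cip n x (u k)))\<^sup>2) / c \<le> (\<Sum>j<n. (cmod (x j))\<^sup>2)"
    by (simp add: Re_cip_self)
  then show ?thesis using \<open>c > 0\<close> by (simp add: pos_divide_le_eq mult.commute)
qed

text \<open>Bessel's inequality for a unit coordinate vector bounds the sum of the squared
  \<open>j\<close>-th entries of the family by \<open>c\<close>. Summing over \<open>j\<close> gives
  \<open>N * c \<le> n * c\<close>.\<close>

lemma orthogonal_family_bound:
  assumes orth: "\<And>k l. k < N \<Longrightarrow> l < N \<Longrightarrow> k \<noteq> l \<Longrightarrow> cip n (u k) (u l) = 0"
    and norm: "\<And>k. k < N \<Longrightarrow> cip n (u k) (u k) = of_real c" and "c > 0"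
  shows "N \<le> n"
proof -
  have "(\<Sum>k<N. (cmod (u k j))\<^sup>2) \<le> c" if "j < n" for j
  proof -
    define e where "e = (\<lambda>i. if i = j then 1 else (0::complex))"
    have "cip n e y = cnj (y j)" for y
      using that by (simp add: cip_def e_def if_distrib [of "\<lambda>t. t * _"] cong: if_cong)
    moreover have "(\<Sum>i<n. (cmod (e i))\<^sup>2) = 1"
      using that by (simp add: e_def if_distrib [of cmod] if_distrib [of "\<lambda>t. t ^ 2"] cong: if_cong)
    ultimately show ?thesis using bessel [of N n u c e, OF orth norm \<open>c > 0\<close>] by simp
  qed
  then have "(\<Sum>j<n. \<Sum>k<N. (cmod (u k j))\<^sup>2) \<le> (\<Sum>j<n. c)" by (intro sum_mono) simp
  also have "(\<Sum>j<n. \<Sum>k<N. (cmod (u k j))\<^sup>2) = (\<Sum>k<N. \<Sum>j<n. (cmod (u k j))\<^sup>2)" by (rule sum.swap)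
  also have "\<dots> = (\<Sum>k<N. c)"
    using norm by (intro sum.cong) (auto simp flip: Re_cip_self)
  finally show ?thesis using \<open>c > 0\<close> by simp
qed

text \<open>A Hermitian kernel \<open>K\<close> with \<open>K - S K S\<^sup>* = p p\<^sup>* - q q\<^sup>*\<close>, where \<open>S\<close> is the shift.\<close>

locale displacement =
  fixes n m :: nat and v :: "nat \<Rightarrow> nat \<Rightarrow> complex" and p q :: "complex poly"
  assumes row0: "\<And>b. cip n (v 0) (v b) = coeff p 0 * cnj (coeff p b) - coeff q 0 * cnj (coeff q b)"
    and step: "\<And>a b. cip n (v (Suc a)) (v (Suc b)) = cip n (v a) (v b)
        + coeff p (Suc a) * cnj (coeff p (Suc b)) - coeff q (Suc a) * cnj (coeff q (Suc b))"
    and deg_p: "degree p \<le> m" and deg_q: "degree q \<le> Suc m"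
    and max_deg: "degree p = m \<or> degree q = Suc m"
    and q0: "coeff q 0 \<noteq> 0" and cop: "coprime p q"
begin

text \<open>The squared norm of \<open>v 0\<close> is |p_0|^2 - |q_0|^2, so nonnegativity gives
  |p_0| \<ge> |q_0| > 0.\<close>

lemma p0: "coeff p 0 \<noteq> 0"
proof
  assume "coeff p 0 = 0"
  then have "Re (cip n (v 0) (v 0)) = - ((cmod (coeff q 0))\<^sup>2)"
    by (simp add: row0 complex_mult_cnj cmod_power2)
  moreover have "Re (cip n (v 0) (v 0)) \<ge> 0" unfolding Re_cip_self by (simp add: sum_nonneg)
  ultimately show False using q0 by simp
qed

lemma column0: "cip n (v a) (v 0) = coeff p a * cnj (coeff p 0) - coeff q a * cnj (coeff q 0)"
  by (subst cip_commute) (simp add: row0 mult.commute)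

lemma diagonal_shift:
  assumes "a > Suc m"
  shows "cip n (v (a + k)) (v (b + k)) = cip n (v a) (v b)"
  using assms deg_p deg_q
  by (induction k) (auto simp: step coeff_eq_0)

text \<open>Column 0 of the Gram matrix ends at index \<open>m + 1\<close>, the degree bound for
  both polynomials; the zeros below are carried along the diagonals.\<close>

lemma orthogonal_far:
  assumes "a > Suc m + b" shows "cip n (v a) (v b) = 0"
proof -
  have "cip n (v (a - b + b)) (v (0 + b)) = cip n (v (a - b)) (v 0)"
    using assms by (intro diagonal_shift) auto
  also have "\<dots> = 0" using assms deg_p deg_q by (simp add: column0 coeff_eq_0)
  finally show ?thesis using assms by simp
qed

text \<open>Far out on the diagonal all \<open>v a\<close> have the same norm, and those with indices far apart are
  orthogonal; a finite-dimensional space has no room for them unless they vanish.\<close>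

lemma eventually_zero:
  assumes "a > Suc m" "j < n" shows "v a j = 0"
proof -
  define c where "c = (\<Sum>j<n. (cmod (v a j))\<^sup>2)"
  have c: "cip n (v (a + k)) (v (a + k)) = of_real c" for k
    using diagonal_shift [OF assms(1), of k a] by (simp add: c_def cip_self)
  have "c \<ge> 0" unfolding c_def by (simp add: sum_nonneg)
  have "c = 0"
  proof (rule ccontr)
    assume "c \<noteq> 0"
    \<comment> \<open>One vector more than the dimension allows: indices spaced by
      \<open>m + 2\<close> are more than \<open>m + 1\<close> apart, hence belong to orthogonal
      vectors.\<close>
    have "Suc n \<le> n"
    proof (rule orthogonal_family_bound [of _ _ "\<lambda>k. v (a + k * (m + 2))" c])
      show "c > 0" using \<open>c \<ge> 0\<close> \<open>c \<noteq> 0\<close> by simp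
      fix k l :: nat
      show "cip n (v (a + k * (m + 2))) (v (a + k * (m + 2))) = of_real c" by (rule c)
      assume "k \<noteq> l"
      have *: "cip n (v (a + k * (m + 2))) (v (a + l * (m + 2))) = 0" if "l < k" for k l
      proof -
        have "Suc l * (m + 2) \<le> k * (m + 2)" using that by (intro mult_le_mono1) simp
        then show ?thesis by (intro orthogonal_far) simp
      qed
      show "cip n (v (a + k * (m + 2))) (v (a + l * (m + 2))) = 0"
        using * [of k l] * [of l k] cip_commute [of n "v (a + l * (m + 2))" "v (a + k * (m + 2))"]
          \<open>k \<noteq> l\<close> by (cases "k < l") auto
    qed
    then show False by simp
  qed
  then show ?thesis using c [of 0] assms(2) cip_self_eq_0 by auto
qed

text \<open>The subdiagonal at distance \<open>m + 1\<close> is constant, since every displacement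
  term on it contains a coefficient of index above \<open>m + 1\<close>. It ends in zeros, and its
  top entry is \<open>- coeff q (Suc m) * cnj (coeff q 0)\<close>.\<close>

lemma coeff_q_top: "coeff q (Suc m) = 0"
proof -
  have *: "cip n (v (Suc m + k)) (v k) = cip n (v (Suc m)) (v 0)" for k
    using deg_p deg_q by (induction k) (auto simp: step coeff_eq_0)
  have "cip n (v (Suc m)) (v 0) = 0"
    using * [of 1] by (metis cip_zero_left eventually_zero add_Suc_right less_add_one plus_1_eq_Suc add.commute)
  then show ?thesis using deg_p p0 q0 by (auto simp: column0 coeff_eq_0)
qed

lemma degree_q: "degree q \<le> m"
  using coeff_q_top deg_q by (metis le_antisym leading_coeff_0_iff not_less_eq_eq degree_0 le0)

text \<open>Now that both degrees are at most \<open>m\<close>, the main diagonal is constant from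
  index \<open>m\<close> on, so \<open>v a\<close> has the same norm as a vector already known to
  vanish.\<close>

lemma v_zero: assumes "a \<ge> m" "j < n" shows "v a j = 0"
proof -
  have *: "cip n (v (a + k)) (v (a + k)) = cip n (v a) (v a)" for k
    using deg_p degree_q assms(1) by (induction k) (auto simp: step coeff_eq_0)
  have "cip n (v a) (v a) = 0"
    using * [of 2] eventually_zero [of "a + 2"] assms(1) by (simp add: cip_zero_left)
  then show ?thesis using assms(2) cip_self_eq_0 by auto
qed

text \<open>Since \<open>v m\<close> vanishes, entry (m, 0) reads p_m conj(p_0) = q_m conj(q_0). The
  coefficients of index \<open>m\<close> thus vanish together, which \<open>max_deg\<close>
  forbids.\<close>

lemma coeff_q_m: "coeff q m \<noteq> 0"
proof
  assume *: "coeff q m = 0"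
  have "cip n (v m) (v 0) = 0" using v_zero by (simp add: cip_zero_left)
  then have "coeff p m = 0" using * p0 by (simp add: column0)
  then show False using max_deg degree_q p0 by (auto dest: leading_coeff_0_iff [THEN iffD1])
qed

lemma coeff_p_m: "coeff p m \<noteq> 0"
proof
  assume *: "coeff p m = 0"
  have "cip n (v m) (v 0) = 0" using v_zero by (simp add: cip_zero_left)
  then show False using * q0 coeff_q_m by (simp add: column0)
qed


text \<open>This is why the kernel of the Gram matrix is closed under shifting. The entry
  \<open>x m\<close> is free because \<open>v m\<close> vanishes, and is chosen so that
  \<open>x\<close> annihilates the coefficients of \<open>p\<close>. Pairing with column 0 then
  leaves only the \<open>q\<close> term, whose factor \<open>coeff q 0\<close> is nonzero, so
  \<open>x\<close> annihilates \<open>q\<close> as well. In column \<open>Suc b\<close> the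
  displacement equation is left with the shifted vector alone.\<close>

lemma null_vector_shift:
  assumes null: "\<And>b. (\<Sum>a<m. x a * cip n (v a) (v b)) = 0"
    and xm: "x m = - (\<Sum>a<m. x a * coeff p a) / coeff p m"
  shows "(\<Sum>a\<le>m. x a * coeff p a) = 0" "(\<Sum>a\<le>m. x a * coeff q a) = 0"
    "(\<Sum>a<m. x (Suc a) * cip n (v a) (v b)) = 0"
proof -
  have *: "(\<Sum>a\<le>m. g a) = g m + (\<Sum>a<m. g a)" for g :: "nat \<Rightarrow> complex"
    by (simp add: lessThan_Suc_atMost [symmetric])
  show p: "(\<Sum>a\<le>m. x a * coeff p a) = 0"
    unfolding * using xm coeff_p_m by (simp add: field_simps)
  have null': "(\<Sum>a\<le>m. x a * cip n (v a) (v b)) = 0" for b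
    unfolding * using null [of b] v_zero by (simp add: cip_zero_left)
  have "(\<Sum>a\<le>m. x a * cip n (v a) (v 0)) =
      (\<Sum>a\<le>m. x a * coeff p a) * cnj (coeff p 0) - (\<Sum>a\<le>m. x a * coeff q a) * cnj (coeff q 0)"
    by (simp add: column0 right_diff_distrib sum_subtractf sum_distrib_right mult.assoc)
  then show q: "(\<Sum>a\<le>m. x a * coeff q a) = 0"
    using null' [of 0] p q0 by simp
  have "(\<Sum>a\<le>m. x a * cip n (v a) (v (Suc b))) =
      (\<Sum>a<m. x (Suc a) * cip n (v a) (v b))
      + (\<Sum>a\<le>m. x a * coeff p a) * cnj (coeff p (Suc b))
      - (\<Sum>a\<le>m. x a * coeff q a) * cnj (coeff q (Suc b))"
    by (simp add: lessThan_Suc_atMost [symmetric] row0 step sum.lessThan_Suc_shift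
        algebra_simps sum.distrib sum_subtractf sum_distrib_left del: sum.lessThan_Suc)
  then show "(\<Sum>a<m. x (Suc a) * cip n (v a) (v b)) = 0"
    using null' [of "Suc b"] p q by simp
qed

text \<open>A null vector of \<open>K\<close> extends to a sequence annihilated by the ideal generated by \<open>p\<close> and
  \<open>q\<close>, that is, by every polynomial.\<close>

lemma null_vector_zero:
  assumes null: "\<And>b. (\<Sum>a<m. x a * cip n (v a) (v b)) = 0" and "a < m"
  shows "x a = 0"
proof -
  \<comment> \<open>\<open>nxt\<close> slides a window of length \<open>m\<close> one place along
    the sequence and computes the new last entry from the recurrence given by \<open>p\<close>;
    \<open>X\<close> is the infinite sequence whose windows are the \<open>Y k\<close>.\<close>
  define nxt where "nxt y = (\<lambda>a. if Suc a < m then y (Suc a)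
    else - (\<Sum>a<m. y a * coeff p a) / coeff p m)" for y :: "nat \<Rightarrow> complex"
  define Y where "Y k = (nxt ^^ k) x" for k
  define X where "X k = Y k 0" for k
  have Y_Suc: "Y (Suc k) = nxt (Y k)" for k by (simp add: Y_def)
  have YX: "Y k a = X (k + a)" if "a < m" for k a
    using that
  proof (induction a arbitrary: k)
    case (Suc a)
    then have "Y k (Suc a) = Y (Suc k) a" by (simp add: Y_Suc nxt_def)
    then show ?case using Suc by simp
  qed (simp add: X_def)
  have Xm: "X (k + m) = - (\<Sum>a<m. X (k + a) * coeff p a) / coeff p m" for k
  proof -
    have "X (k + m) = Y (Suc k) (m - 1)" using YX [of "m - 1" "Suc k"] \<open>a < m\<close> by simp
    also have "\<dots> = - (\<Sum>a<m. Y k a * coeff p a) / coeff p m"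
      using \<open>a < m\<close> by (simp add: Y_Suc nxt_def)
    finally show ?thesis by (simp add: YX)
  qed
  have inv: "(\<Sum>a<m. X (k + a) * cip n (v a) (v b)) = 0" for k b
  proof (induction k arbitrary: b)
    case 0
    have "(\<Sum>a<m. X (0 + a) * cip n (v a) (v b)) = (\<Sum>a<m. x a * cip n (v a) (v b))"
      using YX [of _ 0] by (intro sum.cong) (auto simp: Y_def)
    then show ?case by (simp only: null)
  next
    case (Suc k)
    show ?case using null_vector_shift(3) [of "\<lambda>a. X (k + a)" b, OF Suc Xm] by simp
  qed
  \<comment> \<open>\<open>L k g\<close> applies \<open>g\<close> to \<open>X\<close> as a
    recurrence operator at position \<open>k\<close>. Multiplication by the variable raises
    \<open>k\<close> by one, so vanishing at all \<open>k\<close> is inherited by every multiple of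
    \<open>g\<close>.\<close>
  define L where "L k g = (\<Sum>i\<le>degree g. coeff g i * X (k + i))" for k g
  have L_eq: "L k g = (\<Sum>i\<le>N. coeff g i * X (k + i))" if "degree g \<le> N" for k g N
    unfolding L_def using that by (intro sum.mono_neutral_left) (auto simp: coeff_eq_0)
  have L_add: "L k (g + h) = L k g + L k h" for k g h
    using degree_add_le_max [of g h]
    by (simp add: L_eq [of _ "max (degree g) (degree h)"] sum.distrib distrib_right)
  have L_smult: "L k (smult c g) = c * L k g" for k c g
    by (simp add: L_eq [of _ "degree g"] degree_smult_le sum_distrib_left mult.assoc)
  have L_pCons: "L k (pCons 0 g) = L (Suc k) g" for k g
    by (subst L_eq [of _ "Suc (degree g)"])
       (auto simp: degree_pCons_le L_def sum.atMost_Suc_shift simp del: sum.atMost_Suc)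
  have Lp: "L k p = 0" for k
    using null_vector_shift(1) [of "\<lambda>a. X (k + a)", OF inv Xm] deg_p
    by (simp add: L_eq [of _ m] mult.commute)
  have Lq: "L k q = 0" for k
    using null_vector_shift(2) [of "\<lambda>a. X (k + a)", OF inv Xm] degree_q
    by (simp add: L_eq [of _ m] mult.commute)
  have ideal: "L k (u * g) = 0" if "\<And>k. L k g = 0" for k u g
  proof (induction u arbitrary: k)
    case 0
    show ?case by (simp add: L_def)
  qed (simp add: L_add L_smult L_pCons that)
  obtain r s where "r * p + s * q = 1"
    using cop bezout_coefficients_fst_snd [of p q] by (metis coprime_iff_gcd_eq_1)
  then have "L k 1 = 0" for k
    using L_add [of k "r * p" "s * q"] ideal [OF Lp] ideal [OF Lq] by simp
  then have "X a = 0" by (simp add: L_def)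
  then show ?thesis using YX [OF \<open>a < m\<close>, of 0] by (simp add: Y_def)
qed

end

text \<open>Gaussian elimination on the last coordinate: a vector \<open>v b\<close> with nonzero
  entry there is the pivot, \<open>\<sigma>\<close> enumerates the other indices, and the induction
  hypothesis applies to the cleared vectors \<open>w\<close>. The coefficient \<open>- c\<close> of
  the pivot collects the multiples of \<open>v b\<close> that were subtracted.\<close>

lemma linear_dependence:
  fixes v :: "nat \<Rightarrow> nat \<Rightarrow> 'a::field"
  assumes "k < m"
  shows "\<exists>x. (\<exists>a<m. x a \<noteq> 0) \<and> (\<forall>j<k. (\<Sum>a<m. x a * v a j) = 0)"
  using assms
proof (induction k arbitrary: m v)
  case 0
  then show ?case by (intro exI [of _ "\<lambda>_. 1"]) auto
next
  case (Suc k)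
  then obtain m' where m: "m = Suc m'" by (cases m) auto
  show ?case
  proof (cases "\<exists>b<m. v b k \<noteq> 0")
    case False
    with Suc.IH [of m v] Suc.prems show ?thesis by (auto simp: less_Suc_eq)
  next
    case True
    then obtain b where b: "b < m" "v b k \<noteq> 0" by blast
    define \<sigma> where "\<sigma> a = (if a < b then a else Suc a)" for a
    define w where "w a j = v (\<sigma> a) j - v (\<sigma> a) k / v b k * v b j" for a j
    obtain y where y: "\<exists>a<m'. y a \<noteq> 0" "\<And>j. j < k \<Longrightarrow> (\<Sum>a<m'. y a * w a j) = 0"
      using Suc.IH [of m' w] Suc.prems m by auto
    define c where "c = (\<Sum>a<m'. y a * v (\<sigma> a) k / v b k)"
    define x where "x a = (if a = b then - c else y (if a < b then a else a - 1))" for a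
    have split: "(\<Sum>a<m. g a) = g b + (\<Sum>a<m'. g (\<sigma> a))" for g :: "nat \<Rightarrow> 'a"
    proof -
      have "bij_betw \<sigma> {..<m'} ({..<m} - {b})"
        using b(1) m by (intro bij_betwI [of _ _ _ "\<lambda>a. if a < b then a else a - 1"]) (auto simp: \<sigma>_def split: if_splits)
      then have "(\<Sum>a<m'. g (\<sigma> a)) = sum g ({..<m} - {b})" by (rule sum.reindex_bij_betw)
      then show ?thesis using b(1) by (simp add: sum.remove)
    qed
    have x\<sigma>: "x (\<sigma> a) = y a" and xb: "x b = - c" for a by (auto simp: x_def \<sigma>_def)
    have w: "(\<Sum>a<m. x a * v a j) = (\<Sum>a<m'. y a * w a j)" for j
      unfolding split x\<sigma> xb w_def c_def
      by (simp add: right_diff_distrib sum_subtractf sum_distrib_right mult.assoc)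
    have "(\<Sum>a<m'. y a * w a k) = 0" using b(2) by (simp add: w_def)
    then have "\<forall>j<Suc k. (\<Sum>a<m. x a * v a j) = 0"
      unfolding w using y(2) by (auto simp: less_Suc_eq)
    moreover obtain a where "a < m'" "y a \<noteq> 0" using y(1) by blast
    then have "\<sigma> a < m" "x (\<sigma> a) \<noteq> 0" using m by (simp_all add: x\<sigma>) (simp add: \<sigma>_def)
    ultimately show ?thesis by blast
  qed
qed

text \<open>Dropping a coordinate \<open>j0\<close> with \<open>\<beta> j0\<close> nonzero leaves
  \<open>m - 1\<close> coordinates for \<open>m\<close> vectors, hence a relation; the functional
  \<open>\<beta>\<close> then forces it in coordinate \<open>j0\<close> too. This turns a relation
  between coordinates into one between vectors.\<close>

lemma linear_dependence_hyperplane: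
  fixes v :: "nat \<Rightarrow> nat \<Rightarrow> 'a::field"
  assumes "j0 < m" "\<beta> j0 \<noteq> 0" and ann: "\<And>a. a < m \<Longrightarrow> (\<Sum>j<m. \<beta> j * v a j) = 0"
  shows "\<exists>x. (\<exists>a<m. x a \<noteq> 0) \<and> (\<forall>j<m. (\<Sum>a<m. x a * v a j) = 0)"
proof -
  define \<sigma> where "\<sigma> j = (if j < j0 then j else Suc j)" for j
  obtain x where x: "\<exists>a<m. x a \<noteq> 0" "\<And>j. j < m - 1 \<Longrightarrow> (\<Sum>a<m. x a * v a (\<sigma> j)) = 0"
    using linear_dependence [of "m - 1" m "\<lambda>a j. v a (\<sigma> j)"] assms(1) by auto
  have *: "(\<Sum>a<m. x a * v a j) = 0" if "j < m" "j \<noteq> j0" for j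
  proof (cases "j < j0")
    case True
    with x(2) [of j] assms(1) show ?thesis by (simp add: \<sigma>_def)
  next
    case False
    with that obtain i where "j = Suc i" "j0 \<le> i" by (cases j) auto
    with x(2) [of i] that show ?thesis by (simp add: \<sigma>_def)
  qed
  have "0 = (\<Sum>a<m. x a * (\<Sum>j<m. \<beta> j * v a j))" using ann by simp
  also have "\<dots> = (\<Sum>j<m. \<beta> j * (\<Sum>a<m. x a * v a j))"
    by (simp add: sum_distrib_left mult.left_commute) (rule sum.swap)
  also have "\<dots> = \<beta> j0 * (\<Sum>a<m. x a * v a j0)"
    using assms(1) * by (subst sum.remove [of _ j0]) auto
  finally show ?thesis using * x(1) assms(2) by (metis mult_eq_0_iff)
qed

section \<open>The metric of the ball\<close>

lemma norm_sq_fun_upd: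
  "k < (n::nat) \<Longrightarrow> (\<Sum>j<n. (cmod ((z(k := c)) j))\<^sup>2) = (\<Sum>j<n. (cmod (z j))\<^sup>2) + ((cmod c)\<^sup>2 - (cmod (z k))\<^sup>2)"
  by (subst (1 2) sum.remove [of _ k]) auto

lemma complex_ball_iff: "z \<in> complex_ball n \<longleftrightarrow> z \<in> cvec n \<and> (\<Sum>j<n. (cmod (z j))\<^sup>2) < 1"
  by (simp add: complex_ball_def)

lemma cmod_line:
  "((cmod (z + c * of_real t))\<^sup>2) = (cmod z)\<^sup>2 + 2 * Re (cnj z * c) * t + (cmod c)\<^sup>2 * t\<^sup>2"
  unfolding cmod_power2 by (simp add: power2_eq_square algebra_simps)

lemma DERIV_norm_sq_line:
  fixes n :: nat
  assumes "k < n"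
  shows "((\<lambda>t. 1 - (\<Sum>j<n. (cmod ((z(k := z k + c * of_real t)) j))\<^sup>2))
      has_real_derivative - 2 * Re (cnj (z k) * c)) (at 0)"
  unfolding norm_sq_fun_upd [OF assms] cmod_line
  by (auto intro!: derivative_eq_intros)

lemma eventually_line_in_ball:
  assumes "z \<in> complex_ball n" "k < n"
  shows "\<forall>\<^sub>F t in at 0. z(k := z k + c * of_real t) \<in> complex_ball n"
proof -
  have "isCont (\<lambda>t. 1 - (\<Sum>j<n. (cmod ((z(k := z k + c * of_real t)) j))\<^sup>2)) 0"
    using DERIV_norm_sq_line [OF assms(2)] DERIV_isCont by blast
  then have "\<forall>\<^sub>F t in at 0. 1 - (\<Sum>j<n. (cmod ((z(k := z k + c * of_real t)) j))\<^sup>2) > 0"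
    using assms(1) by (intro order_tendstoD(1) [OF isContD]) (simp_all add: complex_ball_iff)
  then show ?thesis
    using assms by (auto simp: complex_ball_iff cvec_def elim!: eventually_mono)
qed

text \<open>The direction \<open>c\<close> is general so that \<open>c = 1\<close> gives
  \<open>partial_re\<close> and \<open>c = \<i>\<close> gives \<open>partial_im\<close>.\<close>

lemma potential_line:
  assumes z: "z \<in> complex_ball n" and k: "k < n"
  shows "((\<lambda>t. ball_potential n (z(k := z k + c * of_real t))) has_vector_derivative
      of_real (2 * Re (cnj (z k) * c) / (1 - (\<Sum>j<n. (cmod (z j))\<^sup>2)))) (at 0)"
proof -
  have "((\<lambda>t. - ln (1 - (\<Sum>j<n. (cmod ((z(k := z k + c * of_real t)) j))\<^sup>2))) has_real_derivative
      2 * Re (cnj (z k) * c) / (1 - (\<Sum>j<n. (cmod (z j))\<^sup>2))) (at 0)"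
    by (rule DERIV_cong [OF DERIV_minus [OF DERIV_chain2 [OF DERIV_ln_divide DERIV_norm_sq_line [OF k]]]])
      (use z in \<open>simp_all add: complex_ball_iff minus_divide_left\<close>)
  then show ?thesis
    unfolding ball_potential_def of_real_minus [symmetric] by (rule has_vector_derivative_of_real)
qed

lemma wirtinger_bar_potential:
  assumes z: "z \<in> complex_ball n" and k: "k < n"
  shows "wirtinger_bar k (ball_potential n) z = z k / of_real (1 - (\<Sum>j<n. (cmod (z j))\<^sup>2))"
proof -
  define s where "s = 1 - (\<Sum>j<n. (cmod (z j))\<^sup>2)"
  have "partial_re k (ball_potential n) z = of_real (2 * Re (z k)) / of_real s"
    using potential_line [OF assms, of 1] unfolding partial_re_def s_def [symmetric]
    by (intro vector_derivative_at) simp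
  moreover have "partial_im k (ball_potential n) z = of_real (2 * Im (z k)) / of_real s"
    using potential_line [OF assms, of \<i>] unfolding partial_im_def s_def [symmetric]
    by (intro vector_derivative_at) simp
  moreover have "z k = (of_real (2 * Re (z k)) + \<i> * of_real (2 * Im (z k))) / 2"
    by (simp add: complex_eq_iff)
  moreover have "(x / c + \<i> * (y / c)) / 2 = (x + \<i> * y) / 2 / c" for x y c :: complex
    by (simp add: add_divide_distrib mult.commute)
  ultimately have "wirtinger_bar k (ball_potential n) z = z k / of_real s"
    unfolding wirtinger_bar_def by metis
  then show ?thesis by (simp only: s_def)
qed

lemma has_vector_derivative_inverse:
  fixes f :: "real \<Rightarrow> 'a::real_normed_field"
  assumes "(f has_vector_derivative f') (at t)" "f t \<noteq> 0"
  shows "((\<lambda>t. inverse (f t)) has_vector_derivative - f' / (f t)\<^sup>2) (at t)"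
  using field_vector_diff_chain_at [OF assms(1) DERIV_inverse [OF assms(2)]]
  by (simp add: o_def divide_inverse power2_eq_square)

lemma wirtinger_bar_line:
  assumes z: "z \<in> complex_ball n" and k: "k < n" and l: "l < n"
  defines "s \<equiv> complex_of_real (1 - (\<Sum>j<n. (cmod (z j))\<^sup>2))"
  shows "((\<lambda>t. wirtinger_bar k (ball_potential n) (z(l := z l + c * of_real t))) has_vector_derivative
      (if k = l then c else 0) / s + z k * of_real (2 * Re (cnj (z l) * c)) / s\<^sup>2) (at 0)"
proof -
  let ?s = "\<lambda>t. 1 - (\<Sum>j<n. (cmod ((z(l := z l + c * of_real t)) j))\<^sup>2)"
  have s0: "s \<noteq> 0" using z unfolding s_def of_real_eq_0_iff complex_ball_iff by linarith
  have s1: "complex_of_real (?s 0) = s" by (simp add: s_def)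
  have 1: "((\<lambda>t. complex_of_real (?s t)) has_vector_derivative of_real (- 2 * Re (cnj (z l) * c))) (at 0)"
    by (intro has_vector_derivative_of_real DERIV_norm_sq_line [OF l])
  have 1: "((\<lambda>t. inverse (complex_of_real (?s t))) has_vector_derivative
      of_real (2 * Re (cnj (z l) * c)) / s\<^sup>2) (at 0)"
  proof -
    have "- complex_of_real (- 2 * r) = of_real (2 * r)" for r by simp
    then show ?thesis using has_vector_derivative_inverse [OF 1] s0 unfolding s1 by metis
  qed
  have 2: "((\<lambda>t. (z(l := z l + c * of_real t)) k) has_vector_derivative (if k = l then c else 0)) (at 0)"
    by (auto intro!: derivative_eq_intros simp: has_vector_derivative_def scaleR_conv_of_real mult.commute)
  have "((\<lambda>t. (z(l := z l + c * of_real t)) k * inverse (complex_of_real (?s t))) has_vector_derivative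
      z k * (of_real (2 * Re (cnj (z l) * c)) / s\<^sup>2) + (if k = l then c else 0) * inverse s) (at 0)"
    using has_vector_derivative_mult [OF 2 1] s1 by simp
  then have 3: "((\<lambda>t. (z(l := z l + c * of_real t)) k * inverse (complex_of_real (?s t))) has_vector_derivative
      (if k = l then c else 0) / s + z k * of_real (2 * Re (cnj (z l) * c)) / s\<^sup>2) (at 0)"
    by (simp only: divide_inverse mult.assoc add.commute)
  \<comment> \<open>The closed formula for \<open>wirtinger_bar\<close> is available only inside the
    ball; a derivative at 0 sees only small \<open>t\<close>, for which the point stays
    inside.\<close>
  obtain d where d: "d > 0" "\<And>t. t \<noteq> 0 \<Longrightarrow> dist t 0 < d \<Longrightarrow> z(l := z l + c * of_real t) \<in> complex_ball n"
    using eventually_line_in_ball [OF z l, of c] unfolding eventually_at by blast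
  show ?thesis
  proof (rule has_vector_derivative_transform_within [OF 3 d(1)])
    fix t :: real
    assume "dist t 0 < d"
    then have "z(l := z l + c * of_real t) \<in> complex_ball n"
      using d(2) [of t] z by (cases "t = 0") auto
    from wirtinger_bar_potential [OF this k]
    show "(z(l := z l + c * of_real t)) k * inverse (complex_of_real (?s t)) =
        wirtinger_bar k (ball_potential n) (z(l := z l + c * of_real t))"
      by (simp add: divide_inverse)
  qed simp
qed

lemma wirtinger_potential:
  assumes z: "z \<in> complex_ball n" and k: "k < n" and l: "l < n"
  shows "wirtinger l (wirtinger_bar k (ball_potential n)) z =
    (if k = l then 1 else 0) / (1 - cip n z z) + z k * cnj (z l) / (1 - cip n z z)\<^sup>2"
proof -
  define s where "s = 1 - cip n z z"
  have s: "complex_of_real (1 - (\<Sum>j<n. (cmod (z j))\<^sup>2)) = s"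
    by (simp add: s_def cip_self)
  have s0: "s \<noteq> 0" using z unfolding s [symmetric] of_real_eq_0_iff complex_ball_iff by linarith
  have "partial_re l (wirtinger_bar k (ball_potential n)) z =
      (if k = l then 1 else 0) / s + z k * of_real (2 * Re (z l)) / s\<^sup>2"
    using wirtinger_bar_line [OF assms, of 1] unfolding partial_re_def s
    by (intro vector_derivative_at) simp
  moreover have "partial_im l (wirtinger_bar k (ball_potential n)) z =
      (if k = l then \<i> else 0) / s + z k * of_real (2 * Im (z l)) / s\<^sup>2"
    using wirtinger_bar_line [OF assms, of \<i>] unfolding partial_im_def s
    by (intro vector_derivative_at) simp
  moreover have "cnj (z l) = of_real (2 * Re (z l)) / 2 - \<i> * of_real (2 * Im (z l)) / 2"
    by (simp add: complex_eq_iff)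
  moreover have "(p / s + x * a / s\<^sup>2 - \<i> * (\<i> * p / s + x * b / s\<^sup>2)) / 2
      = p / s + x * (a / 2 - \<i> * b / 2) / s\<^sup>2" for p x a b
  proof -
    have "\<i> * (\<i> * p / s + x * b / s\<^sup>2) = - (p / s) + \<i> * (x * b / s\<^sup>2)"
      by (simp add: distrib_left flip: mult.assoc)
    then show ?thesis by (simp add: diff_divide_distrib add_divide_distrib right_diff_distrib mult_ac)
  qed
  moreover have "(if k = l then \<i> else 0) = \<i> * (if k = l then 1 else 0)" by simp
  ultimately show ?thesis
    unfolding wirtinger_def s_def [symmetric] by (simp only:)
qed

text \<open>The matrix of the metric is a multiple of the identity plus a rank-one matrix, so the
  double sum collapses to inner products.\<close>

lemma ball_metric_eq:
  assumes z: "z \<in> complex_ball n"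
  shows "ball_metric n z u v =
    cip n u v / (1 - cip n z z) + cip n u z * cnj (cip n v z) / (1 - cip n z z)\<^sup>2"
proof -
  define s where "s = 1 - cip n z z"
  have "ball_metric n z u v =
      (\<Sum>j<n. \<Sum>k<n. (if k = j then u j * cnj (v k) / s else 0) + (u j * cnj (z j)) * (cnj (v k) * z k) / s\<^sup>2)"
    unfolding ball_metric_def s_def
    by (intro sum.cong refl) (simp add: wirtinger_potential [OF z] algebra_simps)
  also have "\<dots> = cip n u v / s + cip n u z * cnj (cip n v z) / s\<^sup>2"
    by (simp add: sum.distrib cip_def sum_product flip: sum_divide_distrib)
  finally show ?thesis by (simp add: s_def)
qed

section \<open>Holomorphic functions on the disc times the ball\<close>

lemma prod_dist_nonneg [simp]: "prod_dist n p q \<ge> 0"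
  by (simp add: prod_dist_def sum_nonneg)

lemma prod_dist_sq:
  "(prod_dist n p q)\<^sup>2 = (cmod (fst q - fst p))\<^sup>2 + (\<Sum>j<n. (cmod (snd q j - snd p j))\<^sup>2)"
  by (simp add: prod_dist_def sum_nonneg)

lemma cmod_fst_le_prod_dist: "cmod (fst q - fst p) \<le> prod_dist n p q"
  unfolding prod_dist_def by (intro real_le_rsqrt) (simp add: sum_nonneg)

lemma cmod_snd_le_prod_dist: "j < n \<Longrightarrow> cmod (snd q j - snd p j) \<le> prod_dist n p q"
  unfolding prod_dist_def
  by (intro real_le_rsqrt)
     (auto intro!: add_increasing member_le_sum [of j "{..<n}" "\<lambda>j. (cmod (snd q j - snd p j))\<^sup>2"])

lemma prod_dist_le: "prod_dist n p q \<le> cmod (fst q - fst p) + (\<Sum>j<n. cmod (snd q j - snd p j))"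
proof -
  let ?L = "L2_set (\<lambda>j. cmod (snd q j - snd p j)) {..<n}"
  have "prod_dist n p q = sqrt ((cmod (fst q - fst p))\<^sup>2 + ?L\<^sup>2)"
    by (simp add: prod_dist_def L2_set_def sum_nonneg)
  also have "\<dots> \<le> cmod (fst q - fst p) + ?L" by (rule sqrt_sum_squares_le_sum) (simp_all add: L2_set_nonneg)
  also have "?L \<le> (\<Sum>j<n. cmod (snd q j - snd p j))" by (rule L2_set_le_sum) simp
  finally show ?thesis by simp
qed

lemma tendsto_prod_distI:
  assumes "((\<lambda>x. cmod (fst (g x) - fst p) + (\<Sum>j<n. cmod (snd (g x) j - snd p j))) \<longlongrightarrow> 0) F"
  shows "((\<lambda>x. prod_dist n p (g x)) \<longlongrightarrow> 0) F"
proof (rule tendsto_0_le [OF assms, where K = 1], rule always_eventually, rule allI)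
  fix x
  show "norm (prod_dist n p (g x)) \<le>
      norm (cmod (fst (g x) - fst p) + (\<Sum>j<n. cmod (snd (g x) j - snd p j))) * 1"
    using prod_dist_le [of n p "g x"] by simp
qed

text \<open>Turns the epsilon-delta clauses of \<open>holomorphic_prod\<close> into convergence
  along a filter, so that the rules for limits apply. Points at distance 0 from \<open>p\<close>,
  including \<open>p\<close>, are not removed, which suits functions that are continuous at
  \<open>p\<close>.\<close>

definition nhds_prod ::
  "nat \<Rightarrow> (complex \<times> (nat \<Rightarrow> complex)) set \<Rightarrow> complex \<times> (nat \<Rightarrow> complex) \<Rightarrow> (complex \<times> (nat \<Rightarrow> complex)) filter"
  where "nhds_prod n U p = inf (principal U) (filtercomap (prod_dist n p) (nhds 0))"

lemma eventually_nhds_prod: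
  "eventually P (nhds_prod n U p) \<longleftrightarrow> (\<exists>\<delta>>0. \<forall>q\<in>U. prod_dist n p q < \<delta> \<longrightarrow> P q)"
proof
  assume "eventually P (nhds_prod n U p)"
  then have "eventually (\<lambda>q. q \<in> U \<longrightarrow> P q) (filtercomap (prod_dist n p) (nhds 0))"
    by (simp add: nhds_prod_def eventually_inf_principal inf.commute [of "principal U"])
  then obtain Q where Q: "eventually Q (nhds 0)" "\<And>q. Q (prod_dist n p q) \<Longrightarrow> q \<in> U \<Longrightarrow> P q"
    unfolding eventually_filtercomap by blast
  then show "\<exists>\<delta>>0. \<forall>q\<in>U. prod_dist n p q < \<delta> \<longrightarrow> P q"
    unfolding eventually_nhds_metric by (auto simp: dist_real_def)
next
  assume "\<exists>\<delta>>0. \<forall>q\<in>U. prod_dist n p q < \<delta> \<longrightarrow> P q"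
  then obtain d where d: "d > 0" "\<And>q. q \<in> U \<Longrightarrow> prod_dist n p q < d \<Longrightarrow> P q" by blast
  have "eventually (\<lambda>x. x < d) (nhds (0::real))"
    using d(1) by (intro order_tendstoD(2) [OF filterlim_ident]) 
  then have "eventually (\<lambda>q. q \<in> U \<longrightarrow> P q) (filtercomap (prod_dist n p) (nhds 0))"
    unfolding eventually_filtercomap using d(2) by blast
  then show "eventually P (nhds_prod n U p)"
    by (simp add: nhds_prod_def eventually_inf_principal inf.commute [of "principal U"])
qed

lemma eventually_nhds_prod_in: "eventually (\<lambda>q. q \<in> U) (nhds_prod n U p)"
  unfolding eventually_nhds_prod by (auto intro: exI [of _ 1])

lemma tendsto_prod_dist: "(prod_dist n p \<longlongrightarrow> 0) (nhds_prod n U p)"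
  unfolding nhds_prod_def
  by (rule filterlim_mono [OF filterlim_filtercomap order_refl]) simp

lemma tendsto_fst_nhds_prod: "(fst \<longlongrightarrow> fst p) (nhds_prod n U p)"
  by (rule LIM_zero_cancel, rule tendsto_0_le [OF tendsto_prod_dist, where K = 1])
     (auto simp: cmod_fst_le_prod_dist)

lemma tendsto_snd_nhds_prod: "j < n \<Longrightarrow> ((\<lambda>q. snd q j) \<longlongrightarrow> snd p j) (nhds_prod n U p)"
  by (rule LIM_zero_cancel, rule tendsto_0_le [OF tendsto_prod_dist, where K = 1])
     (auto simp: cmod_snd_le_prod_dist)

definition has_prod_deriv where
  "has_prod_deriv n U h p a b \<longleftrightarrow>
     (\<forall>\<epsilon>>0. \<exists>\<delta>>0. \<forall>q\<in>U. prod_dist n p q < \<delta> \<longrightarrow>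
        cmod (h q - h p - (a * (fst q - fst p) + (\<Sum>j<n. b j * (snd q j - snd p j))))
          \<le> \<epsilon> * prod_dist n p q)"

lemma holomorphic_prod_iff:
  "holomorphic_prod n h U \<longleftrightarrow> (\<forall>p\<in>U. \<exists>a b. has_prod_deriv n U h p a b)"
  by (simp add: holomorphic_prod_def has_prod_deriv_def)

text \<open>Caratheodory's form of differentiability reduces the rules of differentiation to
  algebra and limits.\<close>

definition has_slopes where
  "has_slopes n U h p A a B b \<longleftrightarrow>
     (\<forall>q\<in>U. h q - h p = A q * (fst q - fst p) + (\<Sum>j<n. B j q * (snd q j - snd p j))) \<and>
     (A \<longlongrightarrow> a) (nhds_prod n U p) \<and> (\<forall>j<n. (B j \<longlongrightarrow> b j) (nhds_prod n U p))"

lemma has_slopesD: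
  assumes "has_slopes n U h p A a B b"
  shows "\<And>q. q \<in> U \<Longrightarrow> h q - h p = A q * (fst q - fst p) + (\<Sum>j<n. B j q * (snd q j - snd p j))"
    "(A \<longlongrightarrow> a) (nhds_prod n U p)" "\<And>j. j < n \<Longrightarrow> (B j \<longlongrightarrow> b j) (nhds_prod n U p)"
  using assms unfolding has_slopes_def by blast+

lemma has_prod_derivI:
  assumes eq: "\<And>q. q \<in> U \<Longrightarrow> h q - h p = A q * (fst q - fst p) + (\<Sum>j<n. B j q * (snd q j - snd p j))"
    and A: "(A \<longlongrightarrow> a) (nhds_prod n U p)" and B: "\<And>j. j < n \<Longrightarrow> (B j \<longlongrightarrow> b j) (nhds_prod n U p)"
  shows "has_prod_deriv n U h p a b"
  unfolding has_prod_deriv_def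
proof (intro allI impI)
  fix \<epsilon> :: real
  assume "\<epsilon> > 0"
  let ?R = "\<lambda>q. cmod (A q - a) + (\<Sum>j<n. cmod (B j q - b j))"
  have "(?R \<longlongrightarrow> cmod (a - a) + (\<Sum>j<n. cmod (b j - b j))) (nhds_prod n U p)"
    by (intro tendsto_intros A B) simp
  then have "(?R \<longlongrightarrow> 0) (nhds_prod n U p)" by simp
  then have "eventually (\<lambda>q. ?R q < \<epsilon>) (nhds_prod n U p)"
    using \<open>\<epsilon> > 0\<close> by (rule order_tendstoD(2))
  then obtain d where d: "d > 0" "\<And>q. q \<in> U \<Longrightarrow> prod_dist n p q < d \<Longrightarrow> ?R q < \<epsilon>"
    unfolding eventually_nhds_prod by blast
  have "cmod (h q - h p - (a * (fst q - fst p) + (\<Sum>j<n. b j * (snd q j - snd p j))))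
          \<le> \<epsilon> * prod_dist n p q" if q: "q \<in> U" "prod_dist n p q < d" for q
  proof -
    have "h q - h p - (a * (fst q - fst p) + (\<Sum>j<n. b j * (snd q j - snd p j))) =
        (A q - a) * (fst q - fst p) + (\<Sum>j<n. (B j q - b j) * (snd q j - snd p j))"
      unfolding eq [OF q(1)] by (simp add: left_diff_distrib sum_subtractf)
    also have "cmod \<dots> \<le> cmod ((A q - a) * (fst q - fst p)) + cmod (\<Sum>j<n. (B j q - b j) * (snd q j - snd p j))"
      by (rule norm_triangle_ineq)
    also have "\<dots> \<le> cmod (A q - a) * prod_dist n p q + (\<Sum>j<n. cmod (B j q - b j) * prod_dist n p q)"
      by (intro add_mono order_trans [OF norm_sum] sum_mono)
         (auto simp: norm_mult intro!: mult_left_mono cmod_fst_le_prod_dist cmod_snd_le_prod_dist)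
    also have "\<dots> = ?R q * prod_dist n p q" by (simp add: distrib_right sum_distrib_right)
    also have "\<dots> \<le> \<epsilon> * prod_dist n p q"
      using d(2) [OF q] by (intro mult_right_mono) auto
    finally show ?thesis .
  qed
  then show "\<exists>\<delta>>0. \<forall>q\<in>U. prod_dist n p q < \<delta> \<longrightarrow>
        cmod (h q - h p - (a * (fst q - fst p) + (\<Sum>j<n. b j * (snd q j - snd p j))))
          \<le> \<epsilon> * prod_dist n p q" using d(1) by blast
qed

lemma has_prod_derivE:
  assumes "has_prod_deriv n U h p a b"
  obtains A B where "has_slopes n U h p A a B b"
proof -
  define r where "r q = h q - h p - (a * (fst q - fst p) + (\<Sum>j<n. b j * (snd q j - snd p j)))" for q
  have r: "\<exists>\<delta>>0. \<forall>q\<in>U. prod_dist n p q < \<delta> \<longrightarrow> cmod (r q) \<le> \<epsilon> * prod_dist n p q" if "\<epsilon> > 0" for \<epsilon>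
    using assms that unfolding has_prod_deriv_def r_def by blast
  have r_eq: "r q = 0" if q: "q \<in> U" "prod_dist n p q = 0" for q
    using r [of 1] q by auto
  \<comment> \<open>The remainder \<open>r\<close> is spread over the coordinates in proportion to
    the conjugated increments, whose products with the increments add up to the squared distance.
    The added slopes are at most |r| divided by the distance, hence tend to 0. At distance 0 both
    \<open>r\<close> and the quotients are 0.\<close>
  define A where "A q = a + r q * cnj (fst q - fst p) / (prod_dist n p q)\<^sup>2" for q
  define B where "B j q = b j + r q * cnj (snd q j - snd p j) / (prod_dist n p q)\<^sup>2" for j q
  show ?thesis
  proof (rule that, unfold has_slopes_def, intro conjI ballI allI impI)
    fix q
    assume q: "q \<in> U"
    define c where "c = complex_of_real ((prod_dist n p q)\<^sup>2)"
    have c: "c = (fst q - fst p) * cnj (fst q - fst p) + (\<Sum>j<n. (snd q j - snd p j) * cnj (snd q j - snd p j))"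
      unfolding c_def prod_dist_sq of_real_add of_real_sum complex_norm_square ..
    have "A q * (fst q - fst p) + (\<Sum>j<n. B j q * (snd q j - snd p j)) =
        a * (fst q - fst p) + (\<Sum>j<n. b j * (snd q j - snd p j)) + r q / c * c"
      unfolding A_def B_def of_real_power [symmetric] c_def [symmetric]
      by (subst (3) c) (simp add: distrib_right sum.distrib sum_distrib_left distrib_left mult_ac)
    also have "r q / c * c = r q"
      using r_eq [OF q] by (cases "prod_dist n p q = 0") (auto simp: c_def)
    finally show "h q - h p = A q * (fst q - fst p) + (\<Sum>j<n. B j q * (snd q j - snd p j))"
      by (simp add: r_def)
  next
    have *: "((\<lambda>q. r q * cnj (g q) / (prod_dist n p q)\<^sup>2) \<longlongrightarrow> 0) (nhds_prod n U p)"
      if g: "\<And>q. cmod (g q) \<le> prod_dist n p q" for g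
    proof (rule tendstoI)
      fix \<epsilon> :: real
      assume "\<epsilon> > 0"
      then obtain d where d: "d > 0" "\<And>q. q \<in> U \<Longrightarrow> prod_dist n p q < d \<Longrightarrow> cmod (r q) \<le> \<epsilon> / 2 * prod_dist n p q"
        using r [of "\<epsilon> / 2"] by auto
      have "dist (r q * cnj (g q) / (prod_dist n p q)\<^sup>2) 0 < \<epsilon>" if "q \<in> U" "prod_dist n p q < d" for q
      proof (cases "prod_dist n p q = 0")
        case False
        have "cmod (r q) * cmod (g q) \<le> (\<epsilon> / 2 * prod_dist n p q) * prod_dist n p q"
          using d(2) [OF that] g \<open>\<epsilon> > 0\<close> by (intro mult_mono) auto
        then have "cmod (r q) * cmod (g q) / (prod_dist n p q)\<^sup>2 \<le> \<epsilon> / 2"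
          using False by (simp add: divide_le_eq power2_eq_square)
        then have "cmod (r q) * cmod (g q) / (prod_dist n p q)\<^sup>2 < \<epsilon>" using \<open>\<epsilon> > 0\<close> by linarith
        then show ?thesis by (simp add: norm_mult norm_divide norm_power)
      qed (use \<open>\<epsilon> > 0\<close> in simp)
      then show "eventually (\<lambda>q. dist (r q * cnj (g q) / (prod_dist n p q)\<^sup>2) 0 < \<epsilon>) (nhds_prod n U p)"
        unfolding eventually_nhds_prod using d(1) by blast
    qed
    show "(A \<longlongrightarrow> a) (nhds_prod n U p)"
      using tendsto_add [OF tendsto_const [of a] * [OF cmod_fst_le_prod_dist]] by (simp add: A_def [abs_def])
    show "(B j \<longlongrightarrow> b j) (nhds_prod n U p)" if "j < n" for j
      using tendsto_add [OF tendsto_const [of "b j"] * [OF cmod_snd_le_prod_dist [OF that]]]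
      by (simp add: B_def [abs_def])
  qed
qed

lemma has_prod_deriv_tendsto:
  assumes "has_prod_deriv n U h p a b" shows "(h \<longlongrightarrow> h p) (nhds_prod n U p)"
proof -
  obtain A B where "has_slopes n U h p A a B b"
    by (rule has_prod_derivE [OF assms])
  note AB = has_slopesD [OF this]
  have "((\<lambda>q. h p + (A q * (fst q - fst p) + (\<Sum>j<n. B j q * (snd q j - snd p j)))) \<longlongrightarrow>
      h p + (a * (fst p - fst p) + (\<Sum>j<n. b j * (snd p j - snd p j)))) (nhds_prod n U p)"
    by (intro tendsto_intros AB tendsto_fst_nhds_prod tendsto_snd_nhds_prod) auto
  moreover have "\<forall>\<^sub>F q in nhds_prod n U p. h p + (A q * (fst q - fst p) + (\<Sum>j<n. B j q * (snd q j - snd p j))) = h q"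
    using eventually_nhds_prod_in by (rule eventually_mono) (use AB(1) in \<open>metis add.commute diff_add_cancel\<close>)
  ultimately show ?thesis by (simp add: tendsto_cong)
qed

lemma has_prod_deriv_const: "has_prod_deriv n U (\<lambda>_. c) p 0 (\<lambda>_. 0)"
  by (rule has_prod_derivI [where A = "\<lambda>_. 0" and B = "\<lambda>_ _. 0"]) auto

lemma has_prod_deriv_fst: "has_prod_deriv n U fst p 1 (\<lambda>_. 0)"
  by (rule has_prod_derivI [where A = "\<lambda>_. 1" and B = "\<lambda>_ _. 0"]) auto

lemma has_prod_deriv_snd:
  "k < n \<Longrightarrow> has_prod_deriv n U (\<lambda>q. snd q k) p 0 (\<lambda>j. if j = k then 1 else 0)"
  by (rule has_prod_derivI [where A = "\<lambda>_. 0" and B = "\<lambda>j _. if j = k then 1 else 0"])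
     (auto simp: if_distrib [of "\<lambda>t. t * _"] cong: if_cong)

lemma has_prod_deriv_add:
  assumes "has_prod_deriv n U h p a b" "has_prod_deriv n U k p a' b'"
  shows "has_prod_deriv n U (\<lambda>q. h q + k q) p (a + a') (\<lambda>j. b j + b' j)"
proof -
  obtain A B where "has_slopes n U h p A a B b"
    by (rule has_prod_derivE [OF assms(1)])
  note AB = has_slopesD [OF this]
  obtain C D where "has_slopes n U k p C a' D b'"
    by (rule has_prod_derivE [OF assms(2)])
  note CD = has_slopesD [OF this]
  show ?thesis
  proof (rule has_prod_derivI)
    fix q assume "q \<in> U"
    then show "h q + k q - (h p + k p) =
        (A q + C q) * (fst q - fst p) + (\<Sum>j<n. (B j q + D j q) * (snd q j - snd p j))"
      using AB(1) [of q] CD(1) [of q] by (simp add: distrib_right sum.distrib) (simp add: algebra_simps)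
  qed (auto intro!: tendsto_add AB CD)
qed

lemma has_prod_deriv_mult:
  assumes "has_prod_deriv n U h p a b" "has_prod_deriv n U k p a' b'"
  shows "has_prod_deriv n U (\<lambda>q. h q * k q) p (a * k p + h p * a') (\<lambda>j. b j * k p + h p * b' j)"
proof -
  obtain A B where "has_slopes n U h p A a B b"
    by (rule has_prod_derivE [OF assms(1)])
  note AB = has_slopesD [OF this]
  obtain C D where "has_slopes n U k p C a' D b'"
    by (rule has_prod_derivE [OF assms(2)])
  note CD = has_slopesD [OF this]
  note k = has_prod_deriv_tendsto [OF assms(2)]
  show ?thesis
  proof (rule has_prod_derivI)
    fix q assume q: "q \<in> U"
    have "h q * k q - h p * k p = (h q - h p) * k q + h p * (k q - k p)" by (simp add: algebra_simps)
    also have "\<dots> = (A q * k q + h p * C q) * (fst q - fst p) +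
        (\<Sum>j<n. (B j q * k q + h p * D j q) * (snd q j - snd p j))"
      unfolding AB(1) [OF q] CD(1) [OF q]
      by (simp add: distrib_right distrib_left sum.distrib sum_distrib_left sum_distrib_right mult_ac)
    finally show "h q * k q - h p * k p = (A q * k q + h p * C q) * (fst q - fst p) +
        (\<Sum>j<n. (B j q * k q + h p * D j q) * (snd q j - snd p j))" .
  qed (auto intro!: tendsto_intros AB CD k)
qed

lemma has_prod_deriv_inverse:
  assumes "has_prod_deriv n U h p a b" and nz: "\<And>q. q \<in> U \<Longrightarrow> h q \<noteq> 0" and "p \<in> U"
  shows "has_prod_deriv n U (\<lambda>q. inverse (h q)) p
    (- inverse (h p) * inverse (h p) * a) (\<lambda>j. - inverse (h p) * inverse (h p) * b j)"
proof -
  obtain A B where "has_slopes n U h p A a B b"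
    by (rule has_prod_derivE [OF assms(1)])
  note AB = has_slopesD [OF this]
  note h = has_prod_deriv_tendsto [OF assms(1)]
  show ?thesis
  proof (rule has_prod_derivI)
    fix q assume q: "q \<in> U"
    have "inverse (h q) - inverse (h p) = - inverse (h p) * inverse (h q) * (h q - h p)"
      using nz [OF q] nz [OF \<open>p \<in> U\<close>] by (simp add: field_simps)
    then show "inverse (h q) - inverse (h p) = (- inverse (h p) * inverse (h q) * A q) * (fst q - fst p) +
        (\<Sum>j<n. (- inverse (h p) * inverse (h q) * B j q) * (snd q j - snd p j))"
      unfolding AB(1) [OF q] by (simp add: distrib_left sum_distrib_left mult.assoc sum_negf)
  qed (auto intro!: tendsto_intros AB h nz \<open>p \<in> U\<close>)
qed

lemma has_prod_deriv_compose:
  assumes h: "has_prod_deriv n U h (\<Psi> p) a b"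
    and f: "has_prod_deriv n U (\<lambda>q. fst (\<Psi> q)) p a0 b0"
    and s: "\<And>j. j < n \<Longrightarrow> has_prod_deriv n U (\<lambda>q. snd (\<Psi> q) j) p (c j) (d j)"
    and U: "\<And>q. q \<in> U \<Longrightarrow> \<Psi> q \<in> U"
  shows "has_prod_deriv n U (\<lambda>q. h (\<Psi> q)) p (a * a0 + (\<Sum>j<n. b j * c j))
    (\<lambda>i. a * b0 i + (\<Sum>j<n. b j * d j i))"
proof -
  obtain A B where "has_slopes n U h (\<Psi> p) A a B b"
    by (rule has_prod_derivE [OF h])
  note AB = has_slopesD [OF this]
  obtain A0 B0 where "has_slopes n U (\<lambda>q. fst (\<Psi> q)) p A0 a0 B0 b0"
    by (rule has_prod_derivE [OF f])
  note AB0 = has_slopesD [OF this]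
  have "\<exists>C D. has_slopes n U (\<lambda>q. snd (\<Psi> q) k) p C (c k) D (d k)" if "k < n" for k
    by (rule has_prod_derivE [OF s [OF that]]) blast
  then obtain C D where "\<And>k. k < n \<Longrightarrow> has_slopes n U (\<lambda>q. snd (\<Psi> q) k) p (C k) (c k) (D k) (d k)"
    by metis
  note CD = has_slopesD [OF this]
  have "((\<lambda>q. cmod (fst (\<Psi> q) - fst (\<Psi> p)) + (\<Sum>j<n. cmod (snd (\<Psi> q) j - snd (\<Psi> p) j))) \<longlongrightarrow>
      cmod (fst (\<Psi> p) - fst (\<Psi> p)) + (\<Sum>j<n. cmod (snd (\<Psi> p) j - snd (\<Psi> p) j))) (nhds_prod n U p)"
    by (intro tendsto_intros has_prod_deriv_tendsto [OF f] has_prod_deriv_tendsto [OF s]) auto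
  then have "((\<lambda>q. prod_dist n (\<Psi> p) (\<Psi> q)) \<longlongrightarrow> 0) (nhds_prod n U p)"
    by (intro tendsto_prod_distI) simp
  then have lim: "filterlim \<Psi> (nhds_prod n U (\<Psi> p)) (nhds_prod n U p)"
    unfolding nhds_prod_def [of n U "\<Psi> p"] filterlim_inf filterlim_principal filterlim_filtercomap_iff
    using eventually_nhds_prod_in [of U n p] U by (auto simp: o_def elim!: eventually_mono)
  note A = filterlim_compose [OF AB(2) lim] and B = filterlim_compose [OF AB(3) lim]
  show ?thesis
  proof (rule has_prod_derivI)
    fix q assume q: "q \<in> U"
    have "h (\<Psi> q) - h (\<Psi> p) = A (\<Psi> q) * (A0 q * (fst q - fst p) + (\<Sum>j<n. B0 j q * (snd q j - snd p j))) +
      (\<Sum>k<n. B k (\<Psi> q) * (C k q * (fst q - fst p) + (\<Sum>j<n. D k j q * (snd q j - snd p j))))"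
      unfolding AB(1) [OF U [OF q]] AB0(1) [OF q] using CD(1) [OF _ q] by simp
    also have "(\<Sum>k<n. B k (\<Psi> q) * (C k q * (fst q - fst p) + (\<Sum>j<n. D k j q * (snd q j - snd p j)))) =
      (\<Sum>k<n. B k (\<Psi> q) * C k q) * (fst q - fst p) +
      (\<Sum>j<n. (\<Sum>k<n. B k (\<Psi> q) * D k j q) * (snd q j - snd p j))"
      unfolding distrib_left sum.distrib sum_distrib_left sum_distrib_right
      by (subst sum.swap) (simp add: mult.assoc)
    finally show "h (\<Psi> q) - h (\<Psi> p) =
      (A (\<Psi> q) * A0 q + (\<Sum>k<n. B k (\<Psi> q) * C k q)) * (fst q - fst p) +
      (\<Sum>j<n. (A (\<Psi> q) * B0 j q + (\<Sum>k<n. B k (\<Psi> q) * D k j q)) * (snd q j - snd p j))"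
      by (simp add: distrib_left distrib_right sum.distrib sum_distrib_left mult.assoc)
  qed (auto intro!: tendsto_intros A B AB0 CD)
qed

text \<open>Restriction to a complex curve makes Schwarz' lemma and the identity theorem in one
  variable applicable.\<close>

lemma has_prod_deriv_curve:
  assumes h: "has_prod_deriv n U h (g t) a b"
    and f: "((\<lambda>t. fst (g t)) has_field_derivative c) (at t within S)"
    and s: "\<And>j. j < n \<Longrightarrow> ((\<lambda>t. snd (g t) j) has_field_derivative d j) (at t within S)"
    and U: "\<And>t. t \<in> S \<Longrightarrow> g t \<in> U"
  shows "((\<lambda>t. h (g t)) has_field_derivative (a * c + (\<Sum>j<n. b j * d j))) (at t within S)"
proof -
  obtain A B where "has_slopes n U h (g t) A a B b"
    by (rule has_prod_derivE [OF h])
  note AB = has_slopesD [OF this]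
  have cont: "((\<lambda>x. fst (g x)) \<longlongrightarrow> fst (g t)) (at t within S)"
    "\<And>j. j < n \<Longrightarrow> ((\<lambda>x. snd (g x) j) \<longlongrightarrow> snd (g t) j) (at t within S)"
    using DERIV_continuous [OF f] DERIV_continuous [OF s] by (auto simp: continuous_within)
  have "((\<lambda>q. cmod (fst (g q) - fst (g t)) + (\<Sum>j<n. cmod (snd (g q) j - snd (g t) j))) \<longlongrightarrow>
      cmod (fst (g t) - fst (g t)) + (\<Sum>j<n. cmod (snd (g t) j - snd (g t) j))) (at t within S)"
    by (intro tendsto_intros cont) auto
  then have "((\<lambda>q. prod_dist n (g t) (g q)) \<longlongrightarrow> 0) (at t within S)"
    by (intro tendsto_prod_distI) simp
  moreover have "eventually (\<lambda>x. x \<in> S) (at t within S)" by (simp add: eventually_at_filter)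
  ultimately have lim: "filterlim g (nhds_prod n U (g t)) (at t within S)"
    unfolding nhds_prod_def filterlim_inf filterlim_principal filterlim_filtercomap_iff
    using U by (auto simp: o_def elim!: eventually_mono)
  note A = filterlim_compose [OF AB(2) lim] and B = filterlim_compose [OF AB(3) lim]
  have "((\<lambda>x. A (g x) * ((fst (g x) - fst (g t)) / (x - t)) +
      (\<Sum>j<n. B j (g x) * ((snd (g x) j - snd (g t) j) / (x - t)))) \<longlongrightarrow> a * c + (\<Sum>j<n. b j * d j)) (at t within S)"
    using f s by (intro tendsto_intros A B) (auto simp: has_field_derivative_iff)
  moreover have "eventually (\<lambda>x. A (g x) * ((fst (g x) - fst (g t)) / (x - t)) +
      (\<Sum>j<n. B j (g x) * ((snd (g x) j - snd (g t) j) / (x - t))) = (h (g x) - h (g t)) / (x - t)) (at t within S)"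
    using \<open>eventually (\<lambda>x. x \<in> S) (at t within S)\<close>
    by (rule eventually_mono) (simp add: AB(1) [OF U] add_divide_distrib sum_divide_distrib)
  ultimately show ?thesis
    unfolding has_field_derivative_iff by (rule Lim_transform_eventually)
qed

section \<open>Automorphisms\<close>

lemma holomorphic_prod_const: "holomorphic_prod n (\<lambda>_. c) U"
  unfolding holomorphic_prod_iff using has_prod_deriv_const by blast

lemma holomorphic_prod_fst: "holomorphic_prod n fst U"
  unfolding holomorphic_prod_iff using has_prod_deriv_fst by blast

lemma holomorphic_prod_snd: "k < n \<Longrightarrow> holomorphic_prod n (\<lambda>q. snd q k) U"
  unfolding holomorphic_prod_iff using has_prod_deriv_snd by blast

lemma holomorphic_prod_add:
  "holomorphic_prod n h U \<Longrightarrow> holomorphic_prod n k U \<Longrightarrow> holomorphic_prod n (\<lambda>q. h q + k q) U"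
  unfolding holomorphic_prod_iff using has_prod_deriv_add by meson

lemma holomorphic_prod_mult:
  "holomorphic_prod n h U \<Longrightarrow> holomorphic_prod n k U \<Longrightarrow> holomorphic_prod n (\<lambda>q. h q * k q) U"
  unfolding holomorphic_prod_iff using has_prod_deriv_mult by meson

lemma holomorphic_prod_minus: "holomorphic_prod n h U \<Longrightarrow> holomorphic_prod n (\<lambda>q. - h q) U"
  using holomorphic_prod_mult [OF holomorphic_prod_const [of n "-1"]] by simp

lemma holomorphic_prod_diff:
  "holomorphic_prod n h U \<Longrightarrow> holomorphic_prod n k U \<Longrightarrow> holomorphic_prod n (\<lambda>q. h q - k q) U"
  using holomorphic_prod_add [OF _ holomorphic_prod_minus] by simp

lemma holomorphic_prod_divide:
  assumes "holomorphic_prod n h U" "holomorphic_prod n k U" "\<And>q. q \<in> U \<Longrightarrow> k q \<noteq> 0"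
  shows "holomorphic_prod n (\<lambda>q. h q / k q) U"
proof -
  have "holomorphic_prod n (\<lambda>q. inverse (k q)) U"
    using assms(2,3) has_prod_deriv_inverse unfolding holomorphic_prod_iff by meson
  from holomorphic_prod_mult [OF assms(1) this] show ?thesis by (simp add: divide_inverse)
qed

lemma holomorphic_prod_sum:
  assumes "\<And>i. i \<in> I \<Longrightarrow> holomorphic_prod n (h i) U"
  shows "holomorphic_prod n (\<lambda>q. \<Sum>i\<in>I. h i q) U"
  using assms
  by (induction I rule: infinite_finite_induct)
     (auto intro: holomorphic_prod_const holomorphic_prod_add)

lemma holomorphic_prod_cong:
  assumes "\<And>q. q \<in> U \<Longrightarrow> h q = k q" shows "holomorphic_prod n h U \<longleftrightarrow> holomorphic_prod n k U"
  using assms by (simp add: holomorphic_prod_def cong: ball_cong)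

lemma holomorphic_prod_compose:
  assumes "holomorphic_prod n h U" "holomorphic_map n \<Psi> U" "\<And>q. q \<in> U \<Longrightarrow> \<Psi> q \<in> U"
  shows "holomorphic_prod n (\<lambda>q. h (\<Psi> q)) U"
  unfolding holomorphic_prod_iff
proof
  fix p assume p: "p \<in> U"
  obtain a b where h: "has_prod_deriv n U h (\<Psi> p) a b"
    using assms(1,3) p unfolding holomorphic_prod_iff by blast
  obtain a0 b0 where f: "has_prod_deriv n U (\<lambda>q. fst (\<Psi> q)) p a0 b0"
    using assms(2) p unfolding holomorphic_map_def holomorphic_prod_iff by blast
  have "\<forall>j. \<exists>c d. j < n \<longrightarrow> has_prod_deriv n U (\<lambda>q. snd (\<Psi> q) j) p c d"
    using assms(2) p unfolding holomorphic_map_def holomorphic_prod_iff by blast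
  then obtain c d where s: "\<And>j. j < n \<Longrightarrow> has_prod_deriv n U (\<lambda>q. snd (\<Psi> q) j) p (c j) (d j)"
    by metis
  show "\<exists>a b. has_prod_deriv n U (\<lambda>q. h (\<Psi> q)) p a b"
    using has_prod_deriv_compose [OF h f s assms(3)] by blast
qed

lemma holomorphic_map_compose:
  assumes "holomorphic_map n \<Phi> U" "holomorphic_map n \<Psi> U" "\<And>q. q \<in> U \<Longrightarrow> \<Psi> q \<in> U"
  shows "holomorphic_map n (\<lambda>q. \<Phi> (\<Psi> q)) U"
  using assms holomorphic_prod_compose [OF _ assms(2,3)] by (auto simp: holomorphic_map_def)

lemma holomorphic_map_cong:
  assumes "\<And>q. q \<in> U \<Longrightarrow> \<Phi> q = \<Psi> q" shows "holomorphic_map n \<Phi> U \<longleftrightarrow> holomorphic_map n \<Psi> U"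
  unfolding holomorphic_map_def using assms by (simp cong: holomorphic_prod_cong)

section \<open>The automorphisms as a group\<close>

lemma disc_ball_aut_maps: "\<Psi> \<in> disc_ball_aut n \<Longrightarrow> p \<in> disc_ball n \<Longrightarrow> \<Psi> p \<in> disc_ball n"
  by (auto simp: disc_ball_aut_def bij_betw_def)

lemma disc_ball_autI:
  assumes maps: "\<And>p. p \<in> disc_ball n \<Longrightarrow> \<Psi> p \<in> disc_ball n" "\<And>p. p \<in> disc_ball n \<Longrightarrow> \<Phi> p \<in> disc_ball n"
    and inv: "\<And>p. p \<in> disc_ball n \<Longrightarrow> \<Phi> (\<Psi> p) = p" "\<And>p. p \<in> disc_ball n \<Longrightarrow> \<Psi> (\<Phi> p) = p"
    and hol: "holomorphic_map n \<Psi> (disc_ball n)" "holomorphic_map n \<Phi> (disc_ball n)"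
  shows "\<Psi> \<in> disc_ball_aut n"
proof -
  have bij: "bij_betw \<Psi> (disc_ball n) (disc_ball n)"
    by (rule bij_betw_byWitness [of _ \<Phi>]) (use maps inv in auto)
  have "inv_into (disc_ball n) \<Psi> p = \<Phi> p" if "p \<in> disc_ball n" for p
    using that bij inv maps by (metis bij_betw_inv_into_left)
  then show ?thesis
    using bij hol by (simp add: disc_ball_aut_def cong: holomorphic_map_cong)
qed

lemma disc_ball_autE:
  assumes "\<Psi> \<in> disc_ball_aut n"
  obtains \<Phi> where "\<Phi> \<in> disc_ball_aut n" "\<And>p. p \<in> disc_ball n \<Longrightarrow> \<Phi> (\<Psi> p) = p"
    "\<And>p. p \<in> disc_ball n \<Longrightarrow> \<Psi> (\<Phi> p) = p"
proof
  let ?\<Phi> = "inv_into (disc_ball n) \<Psi>"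
  have bij: "bij_betw \<Psi> (disc_ball n) (disc_ball n)" using assms by (simp add: disc_ball_aut_def)
  show 1: "?\<Phi> (\<Psi> p) = p" if "p \<in> disc_ball n" for p by (rule bij_betw_inv_into_left [OF bij that])
  show 2: "\<Psi> (?\<Phi> p) = p" if "p \<in> disc_ball n" for p by (rule bij_betw_inv_into_right [OF bij that])
  show "?\<Phi> \<in> disc_ball_aut n"
  proof (rule disc_ball_autI [of _ _ \<Psi>])
    show "?\<Phi> p \<in> disc_ball n" if "p \<in> disc_ball n" for p
      using bij_betw_inv_into [OF bij] that by (auto simp: bij_betw_def)
  qed (use assms 1 2 in \<open>auto simp: disc_ball_aut_maps\<close>, auto simp: disc_ball_aut_def)
qed

lemma disc_ball_aut_compose:
  assumes "\<Psi> \<in> disc_ball_aut n" "\<Psi>' \<in> disc_ball_aut n"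
  shows "(\<lambda>p. \<Psi> (\<Psi>' p)) \<in> disc_ball_aut n"
proof -
  obtain \<Phi> where \<Phi>: "\<Phi> \<in> disc_ball_aut n" "\<And>p. p \<in> disc_ball n \<Longrightarrow> \<Phi> (\<Psi> p) = p"
    "\<And>p. p \<in> disc_ball n \<Longrightarrow> \<Psi> (\<Phi> p) = p" using disc_ball_autE [OF assms(1)] by blast
  obtain \<Phi>' where \<Phi>': "\<Phi>' \<in> disc_ball_aut n" "\<And>p. p \<in> disc_ball n \<Longrightarrow> \<Phi>' (\<Psi>' p) = p"
    "\<And>p. p \<in> disc_ball n \<Longrightarrow> \<Psi>' (\<Phi>' p) = p" using disc_ball_autE [OF assms(2)] by blast
  have hol: "holomorphic_map n \<Theta> (disc_ball n)" if "\<Theta> \<in> disc_ball_aut n" for \<Theta>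
    using that by (simp add: disc_ball_aut_def)
  show ?thesis
    by (rule disc_ball_autI [of _ _ "\<lambda>p. \<Phi>' (\<Phi> p)"])
       (simp_all add: disc_ball_aut_maps assms \<Phi> \<Phi>' hol holomorphic_map_compose)
qed

lemma id_disc_ball_aut: "(\<lambda>p. p) \<in> disc_ball_aut n"
  by (rule disc_ball_autI [of _ _ "\<lambda>p. p"])
     (auto simp: holomorphic_map_def holomorphic_prod_fst [unfolded fst_def] holomorphic_prod_fst holomorphic_prod_snd)

lemma id_disc_aut: "(\<lambda>z. z) \<in> disc_aut"
proof -
  have "inv_into \<Delta> (\<lambda>z. z) z = z" if "z \<in> \<Delta>" for z
    using that inv_into_f_f [of "\<lambda>z. z" \<Delta> z] by (simp add: inj_on_def)
  then have "inv_into \<Delta> (\<lambda>z. z) holomorphic_on \<Delta> \<longleftrightarrow> (\<lambda>z. z) holomorphic_on \<Delta>"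
    by (intro holomorphic_cong) auto
  then show ?thesis by (auto simp: disc_aut_def bij_betw_def holomorphic_on_ident)
qed

subsection \<open>Isometries\<close>

text \<open>Squared length of the tangent vector \<open>d\<close> at \<open>z\<close> for the metric
  of the disc; \<open>ball_sq\<close> is its counterpart on the ball.\<close>

definition disc_sq :: "complex \<Rightarrow> complex \<Rightarrow> complex" where
  "disc_sq z d = d * cnj d / (1 - z * cnj z)\<^sup>2"

definition ball_sq :: "nat \<Rightarrow> (nat \<Rightarrow> complex) \<Rightarrow> (nat \<Rightarrow> complex) \<Rightarrow> complex" where
  "ball_sq n z d = cip n d d / (1 - cip n z z) + cip n d z * cnj (cip n d z) / (1 - cip n z z)\<^sup>2"

lemma cip_scale_left: "cip n (\<lambda>j. x j * c) y = c * cip n x y"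
  by (simp add: cip_def sum_distrib_left mult_ac)

lemma cip_scale_right: "cip n x (\<lambda>j. y j * c) = cnj c * cip n x y"
  by (simp add: cip_def sum_distrib_left mult_ac)

lemma of_real_one_minus_norm_sq: "complex_of_real (1 - (cmod x)\<^sup>2) = 1 - x * cnj x"
  by (simp only: of_real_diff complex_norm_square of_real_1)

lemma one_minus_norm_sq_neq_0:
  assumes "cmod z < 1" shows "1 - z * cnj z \<noteq> 0"
proof -
  have "(cmod z)\<^sup>2 < 1" using assms by (simp add: power_less_one_iff)
  then have "complex_of_real (1 - (cmod z)\<^sup>2) \<noteq> 0" unfolding of_real_eq_0_iff by linarith
  then show ?thesis by (simp only: of_real_one_minus_norm_sq not_False_eq_True)
qed

lemma one_minus_cip_neq_0:
  assumes "z \<in> complex_ball n" shows "1 - cip n z z \<noteq> 0"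
proof -
  have "complex_of_real (1 - (\<Sum>j<n. (cmod (z j))\<^sup>2)) \<noteq> 0"
    using assms unfolding of_real_eq_0_iff complex_ball_iff by linarith
  then show ?thesis by (simp add: cip_self)
qed

lemma disc_metric_eq:
  assumes "w \<in> \<Delta>" shows "disc_metric w u v = u * cnj v / (1 - w * cnj w)\<^sup>2"
proof -
  have "pad_zeros 1 (\<lambda>_. w) \<in> complex_ball 1"
    using assms by (auto simp: pad_zeros_def complex_ball_def cvec_def power_less_one_iff)
  moreover have "cip 1 (pad_zeros 1 (\<lambda>_. x)) (pad_zeros 1 (\<lambda>_. y)) = x * cnj y" for x y
    by (simp add: cip_def pad_zeros_def)
  ultimately have "disc_metric w u v =
      u * cnj v / (1 - w * cnj w) + (u * cnj w) * cnj (v * cnj w) / (1 - w * cnj w)\<^sup>2"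
    unfolding disc_metric_def by (simp only: ball_metric_eq)
  also have "\<dots> = (u * cnj v * (1 - w * cnj w) + (u * cnj w) * (cnj v * w)) / (1 - w * cnj w)\<^sup>2"
    using one_minus_norm_sq_neq_0 [of w] assms by (simp add: add_divide_distrib power2_eq_square)
  also have "u * cnj v * (1 - w * cnj w) + (u * cnj w) * (cnj v * w) = u * cnj v"
    by (simp add: algebra_simps)
  finally show ?thesis .
qed

lemma disc_isometry_iff:
  "disc_isometry F \<longleftrightarrow> F holomorphic_on \<Delta> \<and> F ` \<Delta> \<subseteq> \<Delta> \<and>
     (\<forall>w\<in>\<Delta>. disc_sq w 1 = disc_sq (F w) (deriv F w))"
proof -
  have "(\<forall>u v. disc_metric w u v = disc_metric (F w) (deriv F w * u) (deriv F w * v)) \<longleftrightarrow>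
      disc_sq w 1 = disc_sq (F w) (deriv F w)" if "w \<in> \<Delta>" "F w \<in> \<Delta>" for w
  proof -
    have "disc_metric w u v = u * cnj v * disc_sq w 1"
      "disc_metric (F w) (deriv F w * u) (deriv F w * v) = u * cnj v * disc_sq (F w) (deriv F w)" for u v
      using that by (simp_all add: disc_metric_eq disc_sq_def)
    then show ?thesis by (metis complex_cnj_one mult_1)
  qed
  then show ?thesis unfolding disc_isometry_def by (auto simp: image_subset_iff)
qed

text \<open>The source has dimension one: every term is \<open>u * cnj v\<close> times a function of
  \<open>w\<close>, so the case \<open>u = v = 1\<close> decides.\<close>

lemma holo_isometry_iff:
  "holo_isometry n f \<longleftrightarrow>
     (\<lambda>w. fst (f w)) holomorphic_on \<Delta> \<and>
     (\<forall>j<n. (\<lambda>w. snd (f w) j) holomorphic_on \<Delta>) \<and>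
     f ` \<Delta> \<subseteq> disc_ball n \<and>
     (\<forall>w\<in>\<Delta>. disc_sq w 1 = disc_sq (fst (f w)) (deriv (\<lambda>w. fst (f w)) w) +
        ball_sq n (snd (f w)) (\<lambda>j. deriv (\<lambda>w. snd (f w) j) w))"
proof -
  have "(\<forall>u v. disc_metric w u v =
          disc_metric (fst (f w)) (deriv (\<lambda>w. fst (f w)) w * u) (deriv (\<lambda>w. fst (f w)) w * v) +
          ball_metric n (snd (f w))
            (\<lambda>j. deriv (\<lambda>w. snd (f w) j) w * u) (\<lambda>j. deriv (\<lambda>w. snd (f w) j) w * v)) \<longleftrightarrow>
      disc_sq w 1 = disc_sq (fst (f w)) (deriv (\<lambda>w. fst (f w)) w) +
        ball_sq n (snd (f w)) (\<lambda>j. deriv (\<lambda>w. snd (f w) j) w)"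
    if "w \<in> \<Delta>" "f w \<in> disc_ball n" for w
  proof -
    have f: "fst (f w) \<in> \<Delta>" "snd (f w) \<in> complex_ball n"
      using that(2) by (auto simp: disc_ball_def mem_Times_iff)
    have 1: "disc_metric w u v = u * cnj v * disc_sq w 1"
      "disc_metric (fst (f w)) (d * u) (d * v) = u * cnj v * disc_sq (fst (f w)) d" for u v d
      using that(1) f(1) by (simp_all add: disc_metric_eq disc_sq_def)
    have 2: "ball_metric n (snd (f w)) (\<lambda>j. d j * u) (\<lambda>j. d j * v) = u * cnj v * ball_sq n (snd (f w)) d" for u v d
      unfolding ball_metric_eq [OF f(2)] ball_sq_def cip_scale_left cip_scale_right complex_cnj_mult
      by (simp add: distrib_left mult_ac)
    have 3: "(\<forall>u v. u * cnj v * x = u * cnj v * y + u * cnj v * z) \<longleftrightarrow> x = y + z" for x y z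
      by (auto dest!: spec [of _ 1] simp flip: distrib_left)
    show ?thesis unfolding 1 2 by (rule 3)
  qed
  then show ?thesis unfolding holo_isometry_def by (auto simp: image_subset_iff)
qed

lemma holo_isometry_transfer:
  assumes f: "holo_isometry n f"
    and g: "\<And>w. w \<in> \<Delta> \<Longrightarrow> g w \<in> disc_ball n'"
      "(\<lambda>w. fst (g w)) holomorphic_on \<Delta>" "\<And>j. j < n' \<Longrightarrow> (\<lambda>w. snd (g w) j) holomorphic_on \<Delta>"
    and fst_eq: "\<And>w. w \<in> \<Delta> \<Longrightarrow> disc_sq (fst (g w)) (deriv (\<lambda>w. fst (g w)) w) =
        disc_sq (fst (f w)) (deriv (\<lambda>w. fst (f w)) w)"
    and snd_eq: "\<And>w. w \<in> \<Delta> \<Longrightarrow> ball_sq n' (snd (g w)) (\<lambda>j. deriv (\<lambda>w. snd (g w) j) w) =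
        ball_sq n (snd (f w)) (\<lambda>j. deriv (\<lambda>w. snd (f w) j) w)"
  shows "holo_isometry n' g"
  using assms unfolding holo_isometry_iff by (auto simp: image_subset_iff)


subsection \<open>Automorphisms of the factors\<close>

text \<open>The involution exchanging \<open>0\<close> and \<open>a\<close>. Since it is its own
  inverse, one check of holomorphy serves both directions.\<close>

definition disc_mob :: "complex \<Rightarrow> complex \<Rightarrow> complex" where
  "disc_mob a z = (a - z) / (1 - cnj a * z)"

lemma mob_denom_neq_0:
  assumes "cmod a < 1" "cmod z < 1" shows "1 - cnj a * z \<noteq> 0"
proof
  assume "1 - cnj a * z = 0"
  then have "cmod (cnj a * z) = 1" by simp
  moreover have "cmod a * cmod z < 1 * 1" using assms by (intro mult_strict_mono') auto
  ultimately show False by (simp add: norm_mult)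
qed

lemma disc_mob_denom:
  assumes "cmod a < 1" "cmod z < 1"
  shows "1 - disc_mob a z * cnj (disc_mob a z) =
    (1 - a * cnj a) * (1 - z * cnj z) / ((1 - cnj a * z) * cnj (1 - cnj a * z))"
proof -
  have D: "(1 - cnj a * z) * cnj (1 - cnj a * z) \<noteq> 0"
    using mob_denom_neq_0 [OF assms] by (simp only: mult_eq_0_iff complex_cnj_zero_iff) simp
  have "disc_mob a z * cnj (disc_mob a z) =
      ((a - z) * cnj (a - z)) / ((1 - cnj a * z) * cnj (1 - cnj a * z))"
    by (simp add: disc_mob_def)
  then have "1 - disc_mob a z * cnj (disc_mob a z) =
      ((1 - cnj a * z) * cnj (1 - cnj a * z) - (a - z) * cnj (a - z)) / ((1 - cnj a * z) * cnj (1 - cnj a * z))"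
    using D by (simp only: diff_divide_distrib divide_self not_False_eq_True)
  also have "(1 - cnj a * z) * cnj (1 - cnj a * z) - (a - z) * cnj (a - z) = (1 - a * cnj a) * (1 - z * cnj z)"
    by (simp add: algebra_simps)
  finally show ?thesis .
qed

lemma norm_disc_mob:
  assumes "cmod a < 1" "cmod z < 1" shows "cmod (disc_mob a z) < 1"
proof -
  note * = of_real_one_minus_norm_sq
  have "complex_of_real (1 - (cmod (disc_mob a z))\<^sup>2) =
      of_real ((1 - (cmod a)\<^sup>2) * (1 - (cmod z)\<^sup>2) / (cmod (1 - cnj a * z))\<^sup>2)"
    unfolding of_real_divide of_real_mult * disc_mob_denom [OF assms] complex_norm_square ..
  then have "1 - (cmod (disc_mob a z))\<^sup>2 = (1 - (cmod a)\<^sup>2) * (1 - (cmod z)\<^sup>2) / (cmod (1 - cnj a * z))\<^sup>2"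
    by (simp only: of_real_eq_iff)
  also have "\<dots> > 0"
    using assms mob_denom_neq_0 [OF assms]
    by (intro divide_pos_pos mult_pos_pos) (simp_all add: power_less_one_iff)
  finally show ?thesis by (simp add: power_less_one_iff)
qed

lemma disc_mob_invol:
  assumes "cmod a < 1" "cmod z < 1" shows "disc_mob a (disc_mob a z) = z"
proof -
  let ?D = "1 - cnj a * z" and ?t = "1 - cnj a * a"
  have D: "?D \<noteq> 0" using mob_denom_neq_0 [OF assms] .
  have t: "?t \<noteq> 0" using one_minus_norm_sq_neq_0 [OF assms(1)] by (simp add: mult.commute)
  have "a - disc_mob a z = ?t * z / ?D" "1 - cnj a * disc_mob a z = ?t / ?D"
    using D by (simp_all add: disc_mob_def field_simps)
  then show ?thesis using D t unfolding disc_mob_def [of a "disc_mob a z"] by simp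
qed

lemma DERIV_disc_mob:
  assumes "cmod a < 1" "cmod (g w) < 1" "(g has_field_derivative g') (at w)"
  shows "((\<lambda>w. disc_mob a (g w)) has_field_derivative
    - (1 - a * cnj a) * g' / (1 - cnj a * g w)\<^sup>2) (at w)"
proof -
  have D: "1 - cnj a * g w \<noteq> 0" using mob_denom_neq_0 assms by blast
  show ?thesis unfolding disc_mob_def
    by (rule DERIV_cong [OF DERIV_divide [OF DERIV_diff [OF DERIV_const assms(3)]
          DERIV_diff [OF DERIV_const DERIV_cmult [OF assms(3)]] D]])
       (simp add: power2_eq_square algebra_simps)
qed

lemma disc_sq_disc_mob:
  assumes "cmod a < 1" "cmod z < 1"
  shows "disc_sq (disc_mob a z) (- (1 - a * cnj a) * d / (1 - cnj a * z)\<^sup>2) = disc_sq z d"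
proof -
  define D t where "D = 1 - cnj a * z" and "t = 1 - a * cnj a"
  have nz: "D \<noteq> 0" "t \<noteq> 0" "1 - z * cnj z \<noteq> 0" "cnj t = t"
    using mob_denom_neq_0 [OF assms] one_minus_norm_sq_neq_0 assms by (simp_all add: D_def t_def)
  show ?thesis
    unfolding disc_sq_def disc_mob_denom [OF assms] D_def [symmetric] t_def [symmetric]
    using nz by (simp add: power2_eq_square)
qed

section \<open>Moebius involutions of the ball along the first axis\<close>

lemma cip_split0: "n \<ge> 1 \<Longrightarrow> cip n x y = x 0 * cnj (y 0) + (\<Sum>j\<in>{1..<n}. x j * cnj (y j))"
  unfolding cip_def by (subst lessThan_atLeast0, subst sum.atLeast_Suc_lessThan) auto

text \<open>The involution of the ball that exchanges the origin and the point \<open>a\<close> on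
  the first axis. Other points are brought to this axis by a reflection beforehand.\<close>

definition ball_mob :: "complex \<Rightarrow> (nat \<Rightarrow> complex) \<Rightarrow> (nat \<Rightarrow> complex)" where
  "ball_mob a v = (\<lambda>j. if j = 0 then disc_mob a (v 0)
     else - of_real (sqrt (1 - (cmod a)\<^sup>2)) * v j / (1 - cnj a * v 0))"

lemma cmod_coord_less:
  assumes "v \<in> complex_ball n" shows "cmod (v j) < 1"
proof (cases "j < n")
  case True
  then have "(cmod (v j))\<^sup>2 \<le> (\<Sum>j<n. (cmod (v j))\<^sup>2)" by (intro member_le_sum) auto
  then have "(cmod (v j))\<^sup>2 < 1" using assms by (simp add: complex_ball_iff)
  then show ?thesis by (simp add: power_less_one_iff)
next
  case False
  then show ?thesis using assms by (simp add: complex_ball_iff cvec_def)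
qed

lemma sqrt_factor:
  assumes "cmod a < 1"
  defines "\<sigma> \<equiv> complex_of_real (sqrt (1 - (cmod a)\<^sup>2))"
  shows "\<sigma> * \<sigma> = 1 - a * cnj a" "cnj \<sigma> = \<sigma>"
proof -
  have "(cmod a)\<^sup>2 \<le> 1" using assms by (simp add: power_le_one)
  then have "\<sigma> * \<sigma> = complex_of_real (1 - (cmod a)\<^sup>2)"
    unfolding \<sigma>_def of_real_mult [symmetric] by simp
  also have "\<dots> = 1 - a * cnj a" by (rule of_real_one_minus_norm_sq)
  finally show "\<sigma> * \<sigma> = 1 - a * cnj a" .
qed (simp add: \<sigma>_def)

lemma ball_mob_denom:
  assumes a: "cmod a < 1" and v: "v \<in> complex_ball n" and n: "n \<ge> 1"
  shows "1 - cip n (ball_mob a v) (ball_mob a v) =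
    (1 - a * cnj a) * (1 - cip n v v) / ((1 - cnj a * v 0) * cnj (1 - cnj a * v 0))"
proof -
  define T where "T = (\<Sum>j\<in>{1..<n}. v j * cnj (v j))"
  define D where "D = (1 - cnj a * v 0) * cnj (1 - cnj a * v 0)"
  have "(\<Sum>j\<in>{1..<n}. ball_mob a v j * cnj (ball_mob a v j)) =
      (\<Sum>j\<in>{1..<n}. (1 - a * cnj a) / D * (v j * cnj (v j)))"
    unfolding sqrt_factor(1) [OF a, symmetric] D_def
    by (intro sum.cong) (auto simp: ball_mob_def)
  also have "\<dots> = (1 - a * cnj a) / D * T" by (simp add: T_def sum_distrib_left)
  finally have "1 - cip n (ball_mob a v) (ball_mob a v) =
      (1 - disc_mob a (v 0) * cnj (disc_mob a (v 0))) - (1 - a * cnj a) / D * T"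
    using n by (simp add: cip_split0 ball_mob_def)
  also have "\<dots> = (1 - a * cnj a) * (1 - v 0 * cnj (v 0)) / D - (1 - a * cnj a) / D * T"
    unfolding disc_mob_denom [OF a cmod_coord_less [OF v]] D_def ..
  also have "\<dots> = (1 - a * cnj a) * (1 - v 0 * cnj (v 0) - T) / D"
  proof -
    have "t * x / D - t / D * y = t * (x - y) / D" for t x y
      by (simp add: right_diff_distrib diff_divide_distrib)
    then show ?thesis .
  qed
  also have "1 - v 0 * cnj (v 0) - T = 1 - cip n v v" using n by (simp add: cip_split0 T_def)
  finally show ?thesis by (simp only: D_def)
qed

lemma ball_mob_in_ball:
  assumes a: "cmod a < 1" and v: "v \<in> complex_ball n" and n: "n \<ge> 1"
  shows "ball_mob a v \<in> complex_ball n"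
proof -
  note * = of_real_one_minus_norm_sq
  have **: "of_real (1 - (\<Sum>j<n. (cmod (x j))\<^sup>2)) = 1 - cip n x x" for x
    by (simp only: of_real_diff cip_self of_real_1)
  have "complex_of_real (1 - (\<Sum>j<n. (cmod (ball_mob a v j))\<^sup>2)) =
      of_real ((1 - (cmod a)\<^sup>2) * (1 - (\<Sum>j<n. (cmod (v j))\<^sup>2)) / (cmod (1 - cnj a * v 0))\<^sup>2)"
    unfolding of_real_divide of_real_mult * ** ball_mob_denom [OF assms] complex_norm_square ..
  then have "1 - (\<Sum>j<n. (cmod (ball_mob a v j))\<^sup>2) =
      (1 - (cmod a)\<^sup>2) * (1 - (\<Sum>j<n. (cmod (v j))\<^sup>2)) / (cmod (1 - cnj a * v 0))\<^sup>2"
    by (simp only: of_real_eq_iff)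
  also have "\<dots> > 0"
    using a v mob_denom_neq_0 [OF a cmod_coord_less [OF v]]
    by (intro divide_pos_pos mult_pos_pos) (simp_all add: power_less_one_iff complex_ball_iff)
  finally have "(\<Sum>j<n. (cmod (ball_mob a v j))\<^sup>2) < 1" by simp
  moreover have "ball_mob a v j = 0" if "j \<ge> n" for j
    using v n that by (simp add: ball_mob_def complex_ball_iff cvec_def)
  ultimately show ?thesis by (simp add: complex_ball_iff cvec_def)
qed

lemma ball_mob_invol:
  assumes a: "cmod a < 1" and v: "v \<in> complex_ball n"
  shows "ball_mob a (ball_mob a v) = v"
proof
  fix j
  show "ball_mob a (ball_mob a v) j = v j"
  proof (cases "j = 0")
    case True
    then show ?thesis using disc_mob_invol [OF a cmod_coord_less [OF v]] by (simp add: ball_mob_def)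
  next
    case False
    define \<sigma> where "\<sigma> = complex_of_real (sqrt (1 - (cmod a)\<^sup>2))"
    let ?D = "1 - cnj a * v 0" and ?t = "1 - a * cnj a"
    have D: "?D \<noteq> 0" by (rule mob_denom_neq_0 [OF a cmod_coord_less [OF v]])
    have t: "?t \<noteq> 0" by (rule one_minus_norm_sq_neq_0 [OF a])
    have \<sigma>: "\<sigma> * \<sigma> = ?t" unfolding \<sigma>_def by (rule sqrt_factor(1) [OF a])
    have "1 - cnj a * disc_mob a (v 0) = ?t / ?D"
      using D by (simp add: disc_mob_def field_simps)
    then have "ball_mob a (ball_mob a v) j = - \<sigma> * (- \<sigma> * v j / ?D) / (?t / ?D)"
      using False by (simp add: ball_mob_def \<sigma>_def)
    also have "\<dots> = (\<sigma> * \<sigma>) * v j / ?t" using D by simp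
    finally show ?thesis using t \<sigma> by simp
  qed
qed

text \<open>The polynomial identity behind invariance of the metric. The letters \<open>b\<close>,
  \<open>e\<close>, \<open>zb\<close>, \<open>Xb\<close> stand for the conjugates of
  \<open>a\<close>, \<open>d\<close>, \<open>z\<close>, \<open>X\<close>; here \<open>z\<close> and
  \<open>d\<close> are first coordinates of the point and the tangent vector, and \<open>T\<close>,
  \<open>X\<close>, \<open>Y\<close> are inner products over the remaining coordinates.\<close>

lemma mob_metric_identity:
  fixes a b z zb d e X Xb Y T :: "'a::comm_ring_1"
  shows "((1 - a * b) * d * e + (Y * (1 - b * z) * (1 - a * zb) + (1 - b * z) * a * e * X
        + b * d * (1 - a * zb) * Xb + a * b * d * e * T)) * (1 - z * zb - T)
      + ((1 - b * z) * X + b * d * T - d * (b - zb)) * ((1 - a * zb) * Xb + a * e * T - e * (a - z))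
    = ((1 - b * z) * (1 - a * zb)) * ((d * e + Y) * (1 - z * zb - T) + (d * zb + X) * (e * z + Xb))"
  by (simp add: algebra_simps)

text \<open>The vector given by cases is the derivative of \<open>ball_mob a\<close> at
  \<open>v\<close> applied to \<open>d\<close>. The coordinates other than the first enter only
  through \<open>T\<close>, \<open>X\<close> and \<open>Y\<close>, so after clearing denominators
  \<open>mob_metric_identity\<close> is all that remains.\<close>

lemma ball_sq_ball_mob:
  assumes a: "cmod a < 1" and v: "v \<in> complex_ball n" and n: "n \<ge> 1"
  defines "\<sigma> \<equiv> complex_of_real (sqrt (1 - (cmod a)\<^sup>2))" and "D \<equiv> 1 - cnj a * v 0"
  shows "ball_sq n (ball_mob a v) (\<lambda>j. if j = 0 then - (1 - a * cnj a) * d 0 / D\<^sup>2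
      else - \<sigma> * (d j * D + cnj a * d 0 * v j) / D\<^sup>2) = ball_sq n v d"
proof -
  define t s T X Y where "t = 1 - a * cnj a" and "s = 1 - cip n v v"
    and "T = (\<Sum>j\<in>{1..<n}. v j * cnj (v j))" and "X = (\<Sum>j\<in>{1..<n}. d j * cnj (v j))"
    and "Y = (\<Sum>j\<in>{1..<n}. d j * cnj (d j))"
  define d' where "d' = (\<lambda>j. if j = 0 then - t * d 0 / D\<^sup>2 else - \<sigma> * (d j * D + cnj a * d 0 * v j) / D\<^sup>2)"
  have t: "t \<noteq> 0" "cnj t = t" using one_minus_norm_sq_neq_0 [OF a] by (simp_all add: t_def)
  have D: "D \<noteq> 0" unfolding D_def by (rule mob_denom_neq_0 [OF a cmod_coord_less [OF v]])
  have s0: "s \<noteq> 0" unfolding s_def by (rule one_minus_cip_neq_0 [OF v])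
  have \<sigma>: "\<sigma> * \<sigma> = t" "cnj \<sigma> = \<sigma>" unfolding \<sigma>_def t_def by (rule sqrt_factor [OF a])+
  have s: "s = 1 - v 0 * cnj (v 0) - T" using n by (simp add: s_def T_def cip_split0)
  let ?t = "\<lambda>j. t / (D\<^sup>2 * (cnj D)\<^sup>2) * (D * cnj D * (d j * cnj (d j)) + D * a * cnj (d 0) * (d j * cnj (v j))
        + cnj a * d 0 * cnj D * cnj (d j * cnj (v j)) + a * cnj a * d 0 * cnj (d 0) * (v j * cnj (v j)))"
  have "(\<Sum>j\<in>{1..<n}. d' j * cnj (d' j)) =
      (\<Sum>j\<in>{1..<n}. ?t j)"
  proof (intro sum.cong refl)
    fix j assume "j \<in> {1..<n}"
    then have "d' j * cnj (d' j) = (\<sigma> * \<sigma>) / (D\<^sup>2 * (cnj D)\<^sup>2) *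
        ((d j * D + cnj a * d 0 * v j) * (cnj (d j) * cnj D + a * cnj (d 0) * cnj (v j)))"
      using \<sigma>(2) by (simp add: d'_def)
    then show "d' j * cnj (d' j) = ?t j"
      unfolding \<sigma>(1) by (simp add: distrib_left distrib_right mult_ac add_ac)
  qed
  also have "\<dots> = t / (D\<^sup>2 * (cnj D)\<^sup>2) * (D * cnj D * Y + D * a * cnj (d 0) * X
        + cnj a * d 0 * cnj D * cnj X + a * cnj a * d 0 * cnj (d 0) * T)"
    unfolding X_def Y_def T_def cnj_sum sum_distrib_left sum.distrib distrib_left ..
  finally have 1: "cip n d' d' = t / (D\<^sup>2 * (cnj D)\<^sup>2) * (t * d 0 * cnj (d 0) + (Y * D * cnj D + D * a * cnj (d 0) * X
        + cnj a * d 0 * cnj D * cnj X + a * cnj a * d 0 * cnj (d 0) * T))"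
    using n t(2) by (simp add: cip_split0 d'_def distrib_left mult_ac)
  have "(\<Sum>j\<in>{1..<n}. d' j * cnj (ball_mob a v j)) =
      (\<Sum>j\<in>{1..<n}. t / (D\<^sup>2 * cnj D) * (D * (d j * cnj (v j)) + cnj a * d 0 * (v j * cnj (v j))))"
  proof (intro sum.cong refl)
    fix j assume "j \<in> {1..<n}"
    then have "d' j * cnj (ball_mob a v j) = (\<sigma> * \<sigma>) / (D\<^sup>2 * cnj D) * ((d j * D + cnj a * d 0 * v j) * cnj (v j))"
      using \<sigma>(2) by (simp add: d'_def ball_mob_def D_def \<sigma>_def)
    then show "d' j * cnj (ball_mob a v j) = t / (D\<^sup>2 * cnj D) * (D * (d j * cnj (v j)) + cnj a * d 0 * (v j * cnj (v j)))"
      unfolding \<sigma>(1) by (simp add: distrib_left distrib_right mult_ac)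
  qed
  also have "\<dots> = t / (D\<^sup>2 * cnj D) * (D * X + cnj a * d 0 * T)"
    unfolding X_def T_def sum_distrib_left sum.distrib distrib_left ..
  moreover have "d' 0 * cnj (ball_mob a v 0) = t / (D\<^sup>2 * cnj D) * (- (d 0 * (cnj a - cnj (v 0))))"
    by (simp add: d'_def ball_mob_def disc_mob_def D_def)
  ultimately have 2: "cip n d' (ball_mob a v) = t / (D\<^sup>2 * cnj D) * (D * X + cnj a * d 0 * T - d 0 * (cnj a - cnj (v 0)))"
    using n by (simp add: cip_split0 distrib_left right_diff_distrib)
  have 3: "1 - cip n (ball_mob a v) (ball_mob a v) = t * s / (D * cnj D)"
    using ball_mob_denom [OF a v n] by (simp add: t_def s_def D_def)
  have T: "cnj T = T" by (simp add: T_def mult.commute)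
  define P where "P = t * d 0 * cnj (d 0) + (Y * D * cnj D + D * a * cnj (d 0) * X
        + cnj a * d 0 * cnj D * cnj X + a * cnj a * d 0 * cnj (d 0) * T)"
  define Q where "Q = D * X + cnj a * d 0 * T - d 0 * (cnj a - cnj (v 0))"
  have "ball_sq n (ball_mob a v) d' = (t / (D\<^sup>2 * (cnj D)\<^sup>2) * P) / (t * s / (D * cnj D))
      + (t / (D\<^sup>2 * cnj D) * Q) * cnj (t / (D\<^sup>2 * cnj D) * Q) / (t * s / (D * cnj D))\<^sup>2"
    unfolding ball_sq_def 1 2 3 P_def Q_def ..
  also have "\<dots> = (P * s + Q * cnj Q) / (D * cnj D * s\<^sup>2)"
    using t D s0 by (simp add: add_divide_distrib power2_eq_square)
  also have "P * s + Q * cnj Q = (D * cnj D) * ((d 0 * cnj (d 0) + Y) * s + (d 0 * cnj (v 0) + X) * (cnj (d 0) * v 0 + cnj X))"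
    using mob_metric_identity [of a "cnj a" "d 0" "cnj (d 0)" Y "v 0" "cnj (v 0)" X "cnj X" T]
    unfolding P_def Q_def s D_def t_def by (simp add: T)
  also have "\<dots> / (D * cnj D * s\<^sup>2) = (d 0 * cnj (d 0) + Y) / s
      + (d 0 * cnj (v 0) + X) * cnj (d 0 * cnj (v 0) + X) / s\<^sup>2"
    using D s0 by (simp add: add_divide_distrib power2_eq_square)
  also have "\<dots> = ball_sq n v d"
    using n by (simp add: ball_sq_def s_def cip_split0 X_def Y_def)
  finally show ?thesis by (simp only: d'_def t_def)
qed


text \<open>The Householder reflection in the hyperplane orthogonal to \<open>u\<close>. For
  \<open>u = 0\<close> division by zero makes it the identity, so this case need not be
  excluded.\<close>

definition ball_refl :: "nat \<Rightarrow> (nat \<Rightarrow> complex) \<Rightarrow> (nat \<Rightarrow> complex) \<Rightarrow> (nat \<Rightarrow> complex)" where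
  "ball_refl n u v = (\<lambda>j. v j - 2 * cip n v u / cip n u u * u j)"

lemma cip_linear_left: "cip n (\<lambda>j. x j - c * u j) y = cip n x y - c * cip n u y"
  by (simp add: cip_def left_diff_distrib sum_subtractf sum_distrib_left mult.assoc)

lemma cip_linear_right: "cip n y (\<lambda>j. x j - c * u j) = cip n y x - cnj c * cip n y u"
  by (simp add: cip_def right_diff_distrib sum_subtractf sum_distrib_left mult_ac)

lemma cip_ball_refl: "cip n (ball_refl n u x) (ball_refl n u y) = cip n x y"
proof (cases "cip n u u = 0")
  case True
  then show ?thesis by (simp add: ball_refl_def)
next
  case False
  have "cnj (cip n u u) = cip n u u" "cnj (cip n y u) = cip n u y"
    using cip_commute [of n u u] cip_commute [of n u y] by simp_all
  then show ?thesis using False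
    unfolding ball_refl_def cip_linear_left cip_linear_right
    by (simp add: right_diff_distrib)
qed

lemma ball_refl_invol: "ball_refl n u (ball_refl n u x) = x"
proof (cases "cip n u u = 0")
  case False
  have "cip n (ball_refl n u x) u = cip n x u - 2 * cip n x u"
    using False unfolding ball_refl_def cip_linear_left by simp
  then have "2 * cip n (ball_refl n u x) u / cip n u u = - (2 * cip n x u / cip n u u)" by simp
  then show ?thesis
    unfolding ball_refl_def [of n u "ball_refl n u x"] by (simp only:) (simp add: ball_refl_def)
qed (simp add: ball_refl_def)

lemma ball_refl_in_cvec: "u \<in> cvec n \<Longrightarrow> x \<in> cvec n \<Longrightarrow> ball_refl n u x \<in> cvec n"
  by (simp add: cvec_def ball_refl_def)

lemma ball_refl_in_ball: "u \<in> cvec n \<Longrightarrow> x \<in> complex_ball n \<Longrightarrow> ball_refl n u x \<in> complex_ball n"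
  unfolding complex_ball_iff by (simp add: ball_refl_in_cvec cip_ball_refl flip: Re_cip_self)

lemma ball_refl_sum:
  "ball_refl n u (\<lambda>j. \<Sum>a\<in>A. c a * v a j) = (\<lambda>j. \<Sum>a\<in>A. c a * ball_refl n u (v a) j)"
proof -
  have "cip n (\<lambda>j. \<Sum>a\<in>A. c a * v a j) u = (\<Sum>a\<in>A. c a * cip n (v a) u)"
    unfolding cip_def sum_distrib_right sum_distrib_left by (subst sum.swap) (simp add: mult.assoc)
  then show ?thesis
    by (simp add: ball_refl_def right_diff_distrib sum_subtractf sum_distrib_left sum_distrib_right
        sum_divide_distrib mult_ac)
qed

text \<open>Let \<open>y\<close> be the part of \<open>x\<close> from index \<open>k\<close> on and
  let |\<alpha>| = |y|. Then \<open>u\<close>, which is \<open>y\<close> minus \<alpha> times the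
  unit vector \<open>e\<close>, satisfies <u,u> = 2 <y,u>, so the reflection replaces
  \<open>y\<close> by a multiple of \<open>e\<close> and leaves the entries below \<open>k\<close>
  alone. Apart from position \<open>k\<close>, the support of \<open>u\<close> lies in that of
  \<open>x\<close>; this is what later preserves coordinate hyperplanes.\<close>

lemma ball_refl_eliminate:
  assumes x: "x \<in> cvec n" and k: "k < n"
  obtains u where "u \<in> cvec n" "\<And>j. j < k \<Longrightarrow> u j = 0" "\<And>j. j \<noteq> k \<Longrightarrow> x j = 0 \<Longrightarrow> u j = 0"
    "\<And>j. j > k \<Longrightarrow> ball_refl n u x j = 0"
proof -
  define y where "y j = (if j \<ge> k then x j else 0)" for j
  define r where "r = sqrt (\<Sum>j<n. (cmod (y j))\<^sup>2)"
  \<comment> \<open>The phase of \<open>x k\<close> makes \<open>x k * cnj \<alpha>\<close> real, as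
    <u,u> = 2 <y,u> requires in the complex case; for \<open>x k = 0\<close> any phase will
    do.\<close>
  define \<alpha> where "\<alpha> = of_real r * (if x k = 0 then 1 else x k / of_real (cmod (x k)))"
  define e where "e j = (if j = k then 1 else 0 :: complex)" for j
  define u where "u j = y j - \<alpha> * e j" for j
  have yy: "cip n y y = (of_real r)\<^sup>2"
    unfolding cip_self r_def of_real_power [symmetric] by (simp add: sum_nonneg)
  have ze: "cip n z e = z k" "cip n e z = cnj (z k)" for z
    using k by (simp_all add: cip_def e_def if_distrib [of "\<lambda>t. t * _"] if_distrib [of "\<lambda>t. _ * t"]
        if_distrib [of cnj] cong: if_cong)
  have yk: "y k = x k" by (simp add: y_def)
  have cm: "x k * cnj (x k) / of_real (cmod (x k)) = of_real (cmod (x k))" if "x k \<noteq> 0"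
    using complex_norm_square [of "x k"] that by (simp add: divide_eq_eq power2_eq_square)
  have real: "x k * cnj \<alpha> = of_real (r * cmod (x k))" "\<alpha> * cnj (x k) = of_real (r * cmod (x k))"
    using cm by (auto simp: \<alpha>_def mult_ac)
  have norm: "\<alpha> * cnj \<alpha> = (of_real r)\<^sup>2"
    using complex_norm_square [of "x k"] by (auto simp: \<alpha>_def power2_eq_square field_simps)
  have yu: "cip n y u = (of_real r)\<^sup>2 - of_real (r * cmod (x k))"
    unfolding u_def cip_linear_right yy ze yk using real(1) by (simp add: mult.commute)
  have "cip n u u = cip n y u - \<alpha> * cip n e u"
    by (subst (1) u_def [abs_def]) (rule cip_linear_left)
  also have "cip n e u = cnj (x k) - cnj \<alpha>" unfolding ze by (simp add: u_def e_def yk)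
  finally have uu: "cip n u u = 2 * cip n y u"
    unfolding yu using real(2) norm by (simp add: right_diff_distrib)
  have u0: "u j = 0" if "j < k" for j using that by (simp add: u_def y_def e_def)
  have xu: "cip n x u = cip n y u"
    unfolding cip_def using u0 by (intro sum.cong) (auto simp: y_def)
  show ?thesis
  proof
    show "u \<in> cvec n" using x k by (auto simp: cvec_def u_def y_def e_def)
    show "u j = 0" if "j < k" for j by (rule u0 [OF that])
    show "u j = 0" if "j \<noteq> k" "x j = 0" for j using that by (simp add: u_def y_def e_def)
    show "ball_refl n u x j = 0" if "j > k" for j
    proof (cases "cip n u u = 0")
      case True
      have "x j = 0"
      proof (cases "j < n")
        case j: True
        have "u j = 0" using cip_self_eq_0 [OF True j] .
        then show ?thesis using that by (simp add: u_def y_def e_def)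
      qed (use x in \<open>simp add: cvec_def\<close>)
      then show ?thesis using True by (simp add: ball_refl_def)
    next
      case False
      then have "2 * cip n x u / cip n u u = 1" using uu xu by simp
      then show ?thesis using that by (simp add: ball_refl_def u_def y_def e_def)
    qed
  qed
qed

subsection \<open>Isometric automorphisms\<close>

text \<open>A normalized map must again be an isometry, so invariance of the metric has to accompany
  an automorphism. It is stated through its effect on isometries, which makes it stable under
  composition; it is verified for Moebius maps and reflections.\<close>

definition isometric_aut where
  "isometric_aut n \<Psi> \<longleftrightarrow> \<Psi> \<in> disc_ball_aut n \<and>
     (\<forall>f. holo_isometry n f \<longrightarrow> holo_isometry n (\<lambda>w. \<Psi> (f w)))"

lemma isometric_aut_compose:
  "isometric_aut n \<Psi> \<Longrightarrow> isometric_aut n \<Psi>' \<Longrightarrow> isometric_aut n (\<lambda>p. \<Psi> (\<Psi>' p))"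
  unfolding isometric_aut_def by (auto intro: disc_ball_aut_compose)

lemma isometric_aut_id: "isometric_aut n (\<lambda>p. p)"
  by (simp add: isometric_aut_def id_disc_ball_aut)

lemma in_disc_ball_iff: "p \<in> disc_ball n \<longleftrightarrow> cmod (fst p) < 1 \<and> snd p \<in> complex_ball n"
  by (auto simp: disc_ball_def mem_Times_iff)

lemma disc_ball_aut_invol:
  assumes "\<And>p. p \<in> disc_ball n \<Longrightarrow> \<Psi> p \<in> disc_ball n" "\<And>p. p \<in> disc_ball n \<Longrightarrow> \<Psi> (\<Psi> p) = p"
    and "holomorphic_map n \<Psi> (disc_ball n)"
  shows "\<Psi> \<in> disc_ball_aut n"
  by (rule disc_ball_autI [of n \<Psi> \<Psi>]) (use assms in auto)

lemma holo_isometryD: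
  assumes "holo_isometry n f"
  shows "(\<lambda>w. fst (f w)) holomorphic_on \<Delta>" "\<And>j. j < n \<Longrightarrow> (\<lambda>w. snd (f w) j) holomorphic_on \<Delta>"
    "\<And>w. w \<in> \<Delta> \<Longrightarrow> f w \<in> disc_ball n"
    "\<And>w. w \<in> \<Delta> \<Longrightarrow> ((\<lambda>w. fst (f w)) has_field_derivative deriv (\<lambda>w. fst (f w)) w) (at w)"
    "\<And>w j. w \<in> \<Delta> \<Longrightarrow> j < n \<Longrightarrow> ((\<lambda>w. snd (f w) j) has_field_derivative deriv (\<lambda>w. snd (f w) j) w) (at w)"
  using assms unfolding holo_isometry_iff by (auto intro!: holomorphic_derivI [of _ \<Delta>])

lemma ball_sq_cong: "(\<And>j. j < n \<Longrightarrow> d j = d' j) \<Longrightarrow> ball_sq n z d = ball_sq n z d'"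
proof -
  assume "\<And>j. j < n \<Longrightarrow> d j = d' j"
  then have "cip n d y = cip n d' y" "cip n y d = cip n y d'" for y by (simp_all add: cip_def)
  then show ?thesis by (simp add: ball_sq_def)
qed

lemma isometric_aut_disc_mob:
  assumes a: "cmod a < 1"
  shows "isometric_aut n (\<lambda>p. (disc_mob a (fst p), snd p))"
  unfolding isometric_aut_def
proof (intro conjI allI impI)
  have nz: "1 - cnj a * fst p \<noteq> 0" if "p \<in> disc_ball n" for p
    using that mob_denom_neq_0 [OF a] by (auto simp: in_disc_ball_iff)
  have "holomorphic_prod n (\<lambda>p. disc_mob a (fst p)) (disc_ball n)"
    unfolding disc_mob_def
    by (intro holomorphic_prod_divide holomorphic_prod_diff holomorphic_prod_mult holomorphic_prod_const
        holomorphic_prod_fst nz)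
  then show "(\<lambda>p. (disc_mob a (fst p), snd p)) \<in> disc_ball_aut n"
    by (intro disc_ball_aut_invol)
       (simp_all add: in_disc_ball_iff norm_disc_mob disc_mob_invol a holomorphic_map_def holomorphic_prod_snd)
  fix f assume f: "holo_isometry n f"
  note fD = holo_isometryD [OF f]
  have fst_lt: "cmod (fst (f w)) < 1" if "w \<in> \<Delta>" for w using fD(3) [OF that] by (simp add: in_disc_ball_iff)
  have D: "((\<lambda>w. disc_mob a (fst (f w))) has_field_derivative
      - (1 - a * cnj a) * deriv (\<lambda>w. fst (f w)) w / (1 - cnj a * fst (f w))\<^sup>2) (at w)" if "w \<in> \<Delta>" for w
    by (rule DERIV_disc_mob [OF a fst_lt [OF that] fD(4) [OF that]])
  show "holo_isometry n (\<lambda>w. (disc_mob a (fst (f w)), snd (f w)))"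
  proof (rule holo_isometry_transfer [OF f])
    show "(disc_mob a (fst (f w)), snd (f w)) \<in> disc_ball n" if "w \<in> \<Delta>" for w
      using fD(3) [OF that] norm_disc_mob [OF a] by (simp add: in_disc_ball_iff)
    show "(\<lambda>w. fst (disc_mob a (fst (f w)), snd (f w))) holomorphic_on \<Delta>"
      unfolding holomorphic_on_open [OF open_ball] fst_conv using D by blast
    show "disc_sq (fst (disc_mob a (fst (f w)), snd (f w))) (deriv (\<lambda>w. fst (disc_mob a (fst (f w)), snd (f w))) w) =
        disc_sq (fst (f w)) (deriv (\<lambda>w. fst (f w)) w)" if "w \<in> \<Delta>" for w
      using DERIV_imp_deriv [OF D [OF that]] disc_sq_disc_mob [OF a fst_lt [OF that]] by simp
  qed (simp_all add: fD)
qed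

lemma isometric_aut_ball_mob:
  assumes a: "cmod a < 1" and n: "n \<ge> 1"
  shows "isometric_aut n (\<lambda>p. (fst p, ball_mob a (snd p)))"
  unfolding isometric_aut_def
proof (intro conjI allI impI)
  define \<sigma> where "\<sigma> = complex_of_real (sqrt (1 - (cmod a)\<^sup>2))"
  have nz: "1 - cnj a * snd p 0 \<noteq> 0" if "p \<in> disc_ball n" for p
    using that by (intro mob_denom_neq_0 [OF a] cmod_coord_less [of _ n]) (simp add: in_disc_ball_iff)
  have eq: "ball_mob a (snd p) j = (if j = 0 then (a - snd p 0) / (1 - cnj a * snd p 0)
      else - \<sigma> * snd p j / (1 - cnj a * snd p 0))" for p :: "complex \<times> (nat \<Rightarrow> complex)" and j
    by (simp add: ball_mob_def disc_mob_def \<sigma>_def)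
  have hol: "holomorphic_prod n (\<lambda>p. ball_mob a (snd p) j) (disc_ball n)" if "j < n" for j
  proof (cases "j = 0")
    case True
    have "holomorphic_prod n (\<lambda>p. (a - snd p 0) / (1 - cnj a * snd p 0)) (disc_ball n)"
      by (intro holomorphic_prod_divide holomorphic_prod_diff holomorphic_prod_mult holomorphic_prod_const
          holomorphic_prod_snd nz) (use n in auto)
    then show ?thesis using True by (simp add: eq)
  next
    case False
    have "holomorphic_prod n (\<lambda>p. - \<sigma> * snd p j / (1 - cnj a * snd p 0)) (disc_ball n)"
      by (intro holomorphic_prod_divide holomorphic_prod_diff holomorphic_prod_mult holomorphic_prod_const
          holomorphic_prod_snd nz) (use n that in auto)
    then show ?thesis using False by (simp add: eq)
  qed
  show "(\<lambda>p. (fst p, ball_mob a (snd p))) \<in> disc_ball_aut n"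
    by (rule disc_ball_aut_invol)
       (auto simp: in_disc_ball_iff ball_mob_in_ball [OF a _ n] ball_mob_invol [OF a, of _ n] holomorphic_map_def hol
          holomorphic_prod_fst)
  fix f assume f: "holo_isometry n f"
  note fD = holo_isometryD [OF f]
  have in_ball: "snd (f w) \<in> complex_ball n" if "w \<in> \<Delta>" for w
    using fD(3) [OF that] by (simp add: in_disc_ball_iff)
  define d where "d w = (\<lambda>j. deriv (\<lambda>w. snd (f w) j) w)" for w
  define d' where "d' w = (\<lambda>j. if j = 0 then - (1 - a * cnj a) * d w 0 / (1 - cnj a * snd (f w) 0)\<^sup>2
      else - \<sigma> * (d w j * (1 - cnj a * snd (f w) 0) + cnj a * d w 0 * snd (f w) j) / (1 - cnj a * snd (f w) 0)\<^sup>2)" for w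
  have D: "((\<lambda>w. ball_mob a (snd (f w)) j) has_field_derivative d' w j) (at w)" if w: "w \<in> \<Delta>" and j: "j < n" for w j
  proof (cases "j = 0")
    case True
    have "((\<lambda>w. disc_mob a (snd (f w) 0)) has_field_derivative d' w 0) (at w)"
      unfolding d'_def d_def if_P [OF refl]
      using n by (intro DERIV_disc_mob [OF a cmod_coord_less [OF in_ball [OF w]] fD(5) [OF w]]) simp
    then show ?thesis using True by (simp add: ball_mob_def)
  next
    case False
    have E: "1 - cnj a * snd (f w) 0 \<noteq> 0" by (rule nz [OF fD(3) [OF w]])
    have "((\<lambda>w. - \<sigma> * snd (f w) j / (1 - cnj a * snd (f w) 0)) has_field_derivative d' w j) (at w)"
      by (rule DERIV_cong [OF DERIV_divide [OF DERIV_cmult [OF fD(5) [OF w j]]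
            DERIV_diff [OF DERIV_const DERIV_cmult [OF fD(5) [OF w]]] E]])
         (use n False in \<open>simp_all add: d'_def d_def power2_eq_square algebra_simps\<close>)
    then show ?thesis using False by (simp add: ball_mob_def \<sigma>_def)
  qed
  show "holo_isometry n (\<lambda>w. (fst (f w), ball_mob a (snd (f w))))"
  proof (rule holo_isometry_transfer [OF f])
    show "(fst (f w), ball_mob a (snd (f w))) \<in> disc_ball n" if "w \<in> \<Delta>" for w
      using fD(3) [OF that] ball_mob_in_ball [OF a _ n] by (simp add: in_disc_ball_iff)
    show "(\<lambda>w. snd (fst (f w), ball_mob a (snd (f w))) j) holomorphic_on \<Delta>" if "j < n" for j
      unfolding holomorphic_on_open [OF open_ball] snd_conv using D [OF _ that] by blast
    show "ball_sq n (snd (fst (f w), ball_mob a (snd (f w)))) (\<lambda>j. deriv (\<lambda>w. snd (fst (f w), ball_mob a (snd (f w))) j) w) =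
        ball_sq n (snd (f w)) (\<lambda>j. deriv (\<lambda>w. snd (f w) j) w)" if w: "w \<in> \<Delta>" for w
    proof -
      have "ball_sq n (ball_mob a (snd (f w))) (\<lambda>j. deriv (\<lambda>w. ball_mob a (snd (f w)) j) w) =
          ball_sq n (ball_mob a (snd (f w))) (d' w)"
        by (intro ball_sq_cong DERIV_imp_deriv D w)
      also have "\<dots> = ball_sq n (snd (f w)) (d w)"
        unfolding d'_def \<sigma>_def by (rule ball_sq_ball_mob [OF a in_ball [OF w] n])
      finally show ?thesis by (simp add: d_def)
    qed
  qed (simp_all add: fD)
qed

lemma isometric_aut_ball_refl:
  assumes u: "u \<in> cvec n"
  shows "isometric_aut n (\<lambda>p. (fst p, ball_refl n u (snd p)))"
  unfolding isometric_aut_def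
proof (intro conjI allI impI)
  have hol: "holomorphic_prod n (\<lambda>p. ball_refl n u (snd p) j) (disc_ball n)" if "j < n" for j
    unfolding ball_refl_def cip_def divide_inverse using that
    by (auto intro!: holomorphic_prod_diff holomorphic_prod_mult holomorphic_prod_sum
        holomorphic_prod_const holomorphic_prod_snd)
  show "(\<lambda>p. (fst p, ball_refl n u (snd p))) \<in> disc_ball_aut n"
    by (rule disc_ball_aut_invol)
       (auto simp: in_disc_ball_iff ball_refl_in_ball ball_refl_invol u holomorphic_map_def hol
          holomorphic_prod_fst)
  fix f assume f: "holo_isometry n f"
  note fD = holo_isometryD [OF f]
  define d where "d w = (\<lambda>j. deriv (\<lambda>w. snd (f w) j) w)" for w
  have D: "((\<lambda>w. ball_refl n u (snd (f w)) j) has_field_derivative ball_refl n u (d w) j) (at w)"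
    if w: "w \<in> \<Delta>" and j: "j < n" for w j
    unfolding ball_refl_def cip_def divide_inverse d_def
    by (intro DERIV_diff DERIV_cmult DERIV_cmult_right DERIV_sum fD(5) [OF w] j) simp
  show "holo_isometry n (\<lambda>w. (fst (f w), ball_refl n u (snd (f w))))"
  proof (rule holo_isometry_transfer [OF f])
    show "(fst (f w), ball_refl n u (snd (f w))) \<in> disc_ball n" if "w \<in> \<Delta>" for w
      using fD(3) [OF that] ball_refl_in_ball [OF u] by (simp add: in_disc_ball_iff)
    show "(\<lambda>w. snd (fst (f w), ball_refl n u (snd (f w))) j) holomorphic_on \<Delta>" if "j < n" for j
      unfolding holomorphic_on_open [OF open_ball] snd_conv using D [OF _ that] by blast
    show "ball_sq n (snd (fst (f w), ball_refl n u (snd (f w)))) (\<lambda>j. deriv (\<lambda>w. snd (fst (f w), ball_refl n u (snd (f w))) j) w) =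
        ball_sq n (snd (f w)) (\<lambda>j. deriv (\<lambda>w. snd (f w) j) w)" if w: "w \<in> \<Delta>" for w
    proof -
      have "ball_sq n (ball_refl n u (snd (f w))) (\<lambda>j. deriv (\<lambda>w. ball_refl n u (snd (f w)) j) w) =
          ball_sq n (ball_refl n u (snd (f w))) (ball_refl n u (d w))"
        by (intro ball_sq_cong DERIV_imp_deriv D w)
      also have "\<dots> = ball_sq n (snd (f w)) (d w)"
        by (simp add: ball_sq_def cip_ball_refl)
      finally show ?thesis by (simp add: d_def)
    qed
  qed (simp_all add: fD)
qed

text \<open>A reflection brings the ball part of \<open>p\<close> to the first axis, then Moebius
  maps act on both factors. The last clause records that a coordinate hyperplane through
  \<open>p\<close> is preserved: the reflection vector vanishes where \<open>p\<close> does, and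
  \<open>ball_mob\<close> preserves zeros except in the first coordinate. If the ball part of
  \<open>p\<close> is zero the ball is not moved, and the first coordinate is covered as
  well.\<close>

lemma move_to_origin:
  assumes p: "p \<in> disc_ball n" and n: "n \<ge> 1"
  obtains \<Theta> where "isometric_aut n \<Theta>" "\<Theta> p = (0, \<lambda>_. 0)"
    "\<And>q. fst (\<Theta> q) = disc_mob (fst p) (fst q)"
    "\<And>q k. snd p k = 0 \<Longrightarrow> snd q k = 0 \<Longrightarrow> k \<ge> 1 \<or> snd p = (\<lambda>_. 0) \<Longrightarrow> snd (\<Theta> q) k = 0"
proof (cases "snd p = (\<lambda>_. 0)")
  case True
  show ?thesis
  proof (rule that)
    show "isometric_aut n (\<lambda>q. (disc_mob (fst p) (fst q), snd q))"
      using p by (intro isometric_aut_disc_mob) (simp add: in_disc_ball_iff)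
  qed (simp_all add: True disc_mob_def)
next
  case False
  have cv: "snd p \<in> cvec n" and b: "snd p \<in> complex_ball n" and fp: "cmod (fst p) < 1"
    using p by (simp_all add: in_disc_ball_iff complex_ball_iff)
  obtain u where u: "u \<in> cvec n" "\<And>j. j \<noteq> 0 \<Longrightarrow> snd p j = 0 \<Longrightarrow> u j = 0"
    "\<And>j. j > 0 \<Longrightarrow> ball_refl n u (snd p) j = 0"
    using ball_refl_eliminate [OF cv, of 0] n by (metis less_eq_Suc_le One_nat_def)
  define \<beta> where "\<beta> = ball_refl n u (snd p) 0"
  have \<beta>: "cmod \<beta> < 1" unfolding \<beta>_def by (rule cmod_coord_less [OF ball_refl_in_ball [OF u(1) b]])
  show ?thesis
  proof (rule that)
    show "isometric_aut n (\<lambda>q. (disc_mob (fst p) (fst q), ball_mob \<beta> (ball_refl n u (snd q))))"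
      using isometric_aut_compose [OF isometric_aut_disc_mob [OF fp]
          isometric_aut_compose [OF isometric_aut_ball_mob [OF \<beta> n] isometric_aut_ball_refl [OF u(1)]]] by simp
    have "ball_mob \<beta> (ball_refl n u (snd p)) j = 0" for j
      using u(3) [of j] by (cases "j = 0") (simp_all add: ball_mob_def disc_mob_def \<beta>_def)
    then show "(disc_mob (fst p) (fst p), ball_mob \<beta> (ball_refl n u (snd p))) = (0, \<lambda>_. 0)"
      by (auto simp: disc_mob_def)
    fix q :: "complex \<times> (nat \<Rightarrow> complex)" and k
    assume "snd p k = 0" "snd q k = 0" "k \<ge> 1 \<or> snd p = (\<lambda>_. 0)"
    with False u(2) [of k] show "snd (disc_mob (fst p) (fst q), ball_mob \<beta> (ball_refl n u (snd q))) k = 0"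
      by (simp add: ball_mob_def ball_refl_def)
  qed simp
qed

text \<open>Householder's QR decomposition. Step \<open>k\<close> reflects in a vector supported on
  coordinates from \<open>k\<close> on, hence orthogonal to the vectors already treated, which live
  in coordinates below \<open>k\<close>. Linearity of \<open>U\<close> is recorded for combinations
  of \<open>m\<close> vectors, the form in which the curve is expressed.\<close>

lemma triangularize:
  assumes v: "\<And>a. a < m \<Longrightarrow> v a \<in> cvec n" and "m \<le> n"
  obtains U where "isometric_aut n (\<lambda>p. (fst p, U (snd p)))"
    "\<And>c x. U (\<lambda>j. \<Sum>a<m. c a * x a j) = (\<lambda>j. \<Sum>a<m. c a * U (x a) j)"
    "\<And>a j. a < m \<Longrightarrow> j \<ge> m \<Longrightarrow> U (v a) j = 0"
proof -
  have "\<exists>U. isometric_aut n (\<lambda>p. (fst p, U (snd p))) \<and>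
      (\<forall>c x. U (\<lambda>j. \<Sum>a<m. c a * x a j) = (\<lambda>j. \<Sum>a<m. c a * U (x a) j)) \<and>
      (\<forall>x\<in>cvec n. U x \<in> cvec n) \<and> (\<forall>a<k. \<forall>j\<ge>k. U (v a) j = 0)" if "k \<le> m" for k
    using that
  proof (induction k)
    case 0
    show ?case by (rule exI [of _ "\<lambda>x. x"]) (simp add: isometric_aut_id)
  next
    case (Suc k)
    from Suc.IH [OF Suc_leD [OF Suc.prems]] obtain U where "isometric_aut n (\<lambda>p. (fst p, U (snd p)))"
      "\<forall>c x. U (\<lambda>j. \<Sum>a<m. c a * x a j) = (\<lambda>j. \<Sum>a<m. c a * U (x a) j)"
      "\<forall>x\<in>cvec n. U x \<in> cvec n" "\<forall>a<k. \<forall>j\<ge>k. U (v a) j = 0"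
      by blast
    note U = this [rule_format]
    have "U (v k) \<in> cvec n" "k < n" using U(3) v Suc.prems \<open>m \<le> n\<close> by auto
    then obtain u where u: "u \<in> cvec n" "\<And>j. j < k \<Longrightarrow> u j = 0" "\<And>j. j > k \<Longrightarrow> ball_refl n u (U (v k)) j = 0"
      by (metis ball_refl_eliminate)
    have "ball_refl n u (U (v a)) j = 0" if a: "a < Suc k" and j: "j \<ge> Suc k" for a j
    proof (cases "a = k")
      case True
      then show ?thesis using u(3) j by simp
    next
      case False
      then have ak: "a < k" using a by simp
      have "U (v a) i * cnj (u i) = 0" for i
        using u(2) [of i] U(4) [OF ak, of i] by (cases "i < k") auto
      then have "cip n (U (v a)) u = 0" unfolding cip_def by (intro sum.neutral ballI)
      then show ?thesis using U(4) [OF ak, of j] j by (simp add: ball_refl_def)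
    qed
    then show ?case
      using isometric_aut_compose [OF isometric_aut_ball_refl [OF u(1)] U(1)] U(2,3) ball_refl_in_cvec [OF u(1)]
      by (intro exI [of _ "\<lambda>x. ball_refl n u (U x)"]) (simp add: ball_refl_sum)
  qed
  from this [of m] show ?thesis using that by blast
qed

section \<open>Automorphisms fixing the origin\<close>

lemma holomorphic_prod_curve:
  assumes h: "holomorphic_prod n h U" and "open S" and U: "\<And>t. t \<in> S \<Longrightarrow> g t \<in> U"
    and f: "(\<lambda>t. fst (g t)) holomorphic_on S" and s: "\<And>j. j < n \<Longrightarrow> (\<lambda>t. snd (g t) j) holomorphic_on S"
  shows "(\<lambda>t. h (g t)) holomorphic_on S"
  unfolding holomorphic_on_def field_differentiable_def
proof
  fix t assume t: "t \<in> S"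
  obtain a b where "has_prod_deriv n U h (g t) a b"
    using h U [OF t] unfolding holomorphic_prod_iff by blast
  from has_prod_deriv_curve [where g = g and S = S, OF this
      holomorphic_derivI [OF f \<open>open S\<close> t] holomorphic_derivI [OF s \<open>open S\<close> t] U]
  show "\<exists>f'. ((\<lambda>t. h (g t)) has_field_derivative f') (at t within S)" by blast
qed

lemma has_field_derivative_lin_comb:
  assumes "\<And>i. i < m \<Longrightarrow> ((\<lambda>t. f t i) has_field_derivative d i) (at x within S)"
  shows "((\<lambda>t. \<Sum>i<m. c i * f t i) has_field_derivative (\<Sum>i<m. c i * d i)) (at x within S)"
  by (rule DERIV_sum [where f = "\<lambda>t i. c i * f t i" and f' = "\<lambda>i. c i * d i"])
     (rule DERIV_cmult, rule assms, simp)

lemma cmod_sum_mult_le: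
  "cmod (\<Sum>i<m. c i * x i) \<le> sqrt (\<Sum>i<m. (cmod (c i))\<^sup>2) * sqrt (\<Sum>i<m. (cmod (x i))\<^sup>2)"
proof -
  have "cmod (\<Sum>i<m. c i * x i) \<le> (\<Sum>i<m. \<bar>cmod (c i)\<bar> * \<bar>cmod (x i)\<bar>)"
    by (rule order_trans [OF norm_sum]) (simp add: norm_mult)
  also have "\<dots> \<le> L2_set (\<lambda>i. cmod (c i)) {..<m} * L2_set (\<lambda>i. cmod (x i)) {..<m}"
    by (rule L2_set_mult_ineq)
  finally show ?thesis by (simp add: L2_set_def)
qed

definition scale_pt :: "complex \<Rightarrow> complex \<times> (nat \<Rightarrow> complex) \<Rightarrow> complex \<times> (nat \<Rightarrow> complex)" where
  "scale_pt t p = (t * fst p, \<lambda>j. t * snd p j)"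

lemma scale_pt_in_disc_ball:
  assumes "cmod t < 1" "cmod (fst p) \<le> 1" "snd p \<in> cvec n" "(\<Sum>j<n. (cmod (snd p j))\<^sup>2) \<le> 1"
  shows "scale_pt t p \<in> disc_ball n"
proof -
  have "cmod t * cmod (fst p) \<le> cmod t" by (rule mult_left_le) (use assms in auto)
  moreover have "(\<Sum>j<n. (cmod (t * snd p j))\<^sup>2) = (cmod t)\<^sup>2 * (\<Sum>j<n. (cmod (snd p j))\<^sup>2)"
    by (simp add: norm_mult power_mult_distrib sum_distrib_left)
  moreover have "\<dots> \<le> (cmod t)\<^sup>2" by (rule mult_left_le) (use assms in auto)
  moreover have "(cmod t)\<^sup>2 < 1" using assms(1) by (simp add: power_less_one_iff)
  ultimately show ?thesis
    using assms by (auto simp: in_disc_ball_iff scale_pt_def complex_ball_iff cvec_def norm_mult)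
qed

text \<open>Cartan's theorem on automorphisms fixing the origin: \<open>\<Psi>\<close> is inverted on the whole domain by
  the derivative of \<open>\<Psi>\<inverse>\<close> at the origin. By Schwarz' lemma on complex lines this holds where
  \<open>\<bar>z\<bar> \<le> \<bar>v\<bar>\<close>, and then everywhere by the identity theorem.\<close>

lemma disc_ball_aut_linear:
  assumes aut: "\<Psi> \<in> disc_ball_aut m" and fix0: "\<Psi> (0, \<lambda>_. 0) = (0, \<lambda>_. 0)" and "k < m"
  obtains \<alpha> \<beta> where
    "\<And>p. p \<in> disc_ball m \<Longrightarrow> \<alpha> * fst (\<Psi> p) + (\<Sum>j<m. \<beta> j * snd (\<Psi> p) j) = snd p k"
proof -
  let ?O = "(0, \<lambda>_. 0) :: complex \<times> (nat \<Rightarrow> complex)"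
  have "\<exists>\<Phi>\<in>disc_ball_aut m. \<forall>p\<in>disc_ball m. \<Phi> (\<Psi> p) = p"
    by (rule disc_ball_autE [OF aut]) blast
  then obtain \<Phi> where "\<Phi> \<in> disc_ball_aut m" "\<forall>p\<in>disc_ball m. \<Phi> (\<Psi> p) = p"
    by blast
  note \<Phi> = this [rule_format]
  have O: "?O \<in> disc_ball m" by (simp add: in_disc_ball_iff complex_ball_iff cvec_def)
  have \<Phi>0: "\<Phi> ?O = ?O" using \<Phi>(2) [OF O] fix0 by simp
  have hol: "holomorphic_prod m (\<lambda>p. fst (\<Theta> p)) (disc_ball m)"
    "i < m \<Longrightarrow> holomorphic_prod m (\<lambda>p. snd (\<Theta> p) i) (disc_ball m)" if "\<Theta> \<in> disc_ball_aut m" for \<Theta> i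
    using that by (simp_all add: disc_ball_aut_def holomorphic_map_def)
  define P where "P i a b \<longleftrightarrow> has_prod_deriv m (disc_ball m) (\<lambda>q. snd (\<Phi> q) i) ?O a b" for i a b
  have "\<exists>a b. P i a b" if "i < m" for i
    using hol(2) [OF \<Phi>(1) that] O unfolding holomorphic_prod_iff P_def by blast
  then obtain \<alpha> \<beta> where "\<And>i. i < m \<Longrightarrow> P i (\<alpha> i) (\<beta> i)" by metis
  then have d\<Phi>: "\<And>i. i < m \<Longrightarrow>
      has_prod_deriv m (disc_ball m) (\<lambda>q. snd (\<Phi> q) i) ?O (\<alpha> i) (\<beta> i)"
    unfolding P_def .
  \<comment> \<open>The ball components of the derivative of \<open>\<Phi>\<close> at the
    origin.\<close>
  define L where "L i q = \<alpha> i * fst q + (\<Sum>j<m. \<beta> i j * snd q j)" for i and q :: "complex \<times> (nat \<Rightarrow> complex)"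
  have L_scale: "L i (scale_pt t q) = t * L i q" for i t q
    by (simp add: L_def scale_pt_def distrib_left sum_distrib_left mult_ac)
  have scale_0: "scale_pt 0 q = ?O" for q by (simp add: scale_pt_def)
  have lin: "((\<lambda>t. fst (scale_pt t q)) has_field_derivative fst q) (at t within S)"
    "((\<lambda>t. snd (scale_pt t q) j) has_field_derivative snd q j) (at t within S)" for q t j S
    unfolding scale_pt_def by (auto intro!: derivative_eq_intros)
  have lin_hol: "(\<lambda>t. fst (scale_pt t q)) holomorphic_on S" "(\<lambda>t. snd (scale_pt t q) j) holomorphic_on S" for q j S
    unfolding scale_pt_def by (auto intro!: holomorphic_intros)
  define small where "small q \<longleftrightarrow> cmod (fst q) \<le> 1 \<and> snd q \<in> cvec m \<and> (\<Sum>j<m. (cmod (snd q j))\<^sup>2) \<le> 1"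
    for q :: "complex \<times> (nat \<Rightarrow> complex)"
  have scale_in: "scale_pt t q \<in> disc_ball m" if "small q" "t \<in> \<Delta>" for t q
    using that unfolding small_def by (intro scale_pt_in_disc_ball) auto
  \<comment> \<open>Schwarz' lemma for the function t -> c . \<Phi>(t q), whose derivative at 0 is c
    . L(q). Letting \<open>c\<close> range over the dual unit ball shows that \<open>L\<close> maps
    the closed domain into the closed ball.\<close>
  have L_le: "cmod (\<Sum>i<m. c i * L i q) \<le> 1" if q: "small q" and c: "(\<Sum>i<m. (cmod (c i))\<^sup>2) \<le> 1" for q c
  proof -
    define h where "h t = (\<Sum>i<m. c i * snd (\<Phi> (scale_pt t q)) i)" for t
    have "h holomorphic_on \<Delta>"
      unfolding h_def
      by (intro holomorphic_intros holomorphic_prod_curve [OF hol(2) [OF \<Phi>(1)]] scale_in [OF q] lin_hol) auto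
    moreover have "h 0 = 0" by (simp add: h_def scale_0 \<Phi>0)
    moreover have "cmod (h t) < 1" if "cmod t < 1" for t
    proof -
      have "\<Phi> (scale_pt t q) \<in> disc_ball m"
        using disc_ball_aut_maps [OF \<Phi>(1)] scale_in [OF q] that by simp
      then have "(\<Sum>i<m. (cmod (snd (\<Phi> (scale_pt t q)) i))\<^sup>2) < 1"
        by (simp add: in_disc_ball_iff complex_ball_iff)
      then have "sqrt (\<Sum>i<m. (cmod (snd (\<Phi> (scale_pt t q)) i))\<^sup>2) < 1" by simp
      moreover have "sqrt (\<Sum>i<m. (cmod (c i))\<^sup>2) \<le> 1" using c by simp
      moreover have "cmod (h t) \<le> sqrt (\<Sum>i<m. (cmod (c i))\<^sup>2) * sqrt (\<Sum>i<m. (cmod (snd (\<Phi> (scale_pt t q)) i))\<^sup>2)"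
        unfolding h_def by (rule cmod_sum_mult_le)
      moreover have "\<dots> \<le> 1 * sqrt (\<Sum>i<m. (cmod (snd (\<Phi> (scale_pt t q)) i))\<^sup>2)"
        using c by (intro mult_right_mono) (auto simp: sum_nonneg)
      ultimately show ?thesis by linarith
    qed
    ultimately have dh_le: "cmod (deriv h 0) \<le> 1" by (intro Schwarz_Lemma(2) [of h 0]) auto
    have dh: "((\<lambda>t. snd (\<Phi> (scale_pt t q)) i) has_field_derivative L i q) (at 0 within \<Delta>)"
      if i: "i < m" for i
    proof -
      have "has_prod_deriv m (disc_ball m) (\<lambda>p. snd (\<Phi> p) i) (scale_pt 0 q) (\<alpha> i) (\<beta> i)"
        unfolding scale_0 by (rule d\<Phi> [OF i])
      from has_prod_deriv_curve [where g = "\<lambda>t. scale_pt t q" and S = \<Delta> and t = 0, OF this lin scale_in [OF q]]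
      show ?thesis by (simp only: L_def)
    qed
    have "(h has_field_derivative (\<Sum>i<m. c i * L i q)) (at 0 within \<Delta>)"
      unfolding h_def by (rule has_field_derivative_lin_comb [OF dh])
    then have "deriv h 0 = (\<Sum>i<m. c i * L i q)"
      by (intro DERIV_imp_deriv) (simp add: at_within_open [OF _ open_ball])
    then show ?thesis using dh_le by simp
  qed
  \<comment> \<open>Strictness comes from the room left by an interior point: \<open>q\<close>
    divided by some \<open>\<rho> < 1\<close> still lies in the closed domain.\<close>
  have L_less: "cmod (\<Sum>i<m. c i * L i q) < 1" if q: "q \<in> disc_ball m" and c: "(\<Sum>i<m. (cmod (c i))\<^sup>2) \<le> 1" for q c
  proof -
    let ?N = "\<Sum>j<m. (cmod (snd q j))\<^sup>2"
    have q': "cmod (fst q) < 1" "?N < 1" "snd q \<in> cvec m"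
      using q by (simp_all add: in_disc_ball_iff complex_ball_iff)
    obtain \<rho> where \<rho>: "max (cmod (fst q)) (sqrt ?N) < \<rho>" "\<rho> < 1"
      using dense [of "max (cmod (fst q)) (sqrt ?N)" 1] q' by auto
    have \<rho>0: "\<rho> > 0" using \<rho>(1) norm_ge_zero [of "fst q"] by linarith
    have "?N = (sqrt ?N)\<^sup>2" by (simp add: sum_nonneg)
    also have "\<dots> \<le> \<rho>\<^sup>2" using \<rho>(1) by (intro power_mono) (auto simp: sum_nonneg)
    finally have N: "?N \<le> \<rho>\<^sup>2" .
    have "(\<Sum>j<m. (cmod (snd (scale_pt (1 / of_real \<rho>) q) j))\<^sup>2) = ?N / \<rho>\<^sup>2"
      using \<rho>0 by (simp add: scale_pt_def norm_divide power_divide sum_divide_distrib)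
    then have "small (scale_pt (1 / of_real \<rho>) q)"
      using \<rho> \<rho>0 q'(3) N by (simp add: small_def) (simp add: scale_pt_def norm_divide cvec_def)
    then have "cmod (\<Sum>i<m. c i * L i (scale_pt (1 / of_real \<rho>) q)) \<le> 1" using c by (rule L_le)
    also have "(\<Sum>i<m. c i * L i (scale_pt (1 / of_real \<rho>) q)) = (\<Sum>i<m. c i * L i q) / of_real \<rho>"
      by (simp add: L_scale sum_divide_distrib)
    finally show ?thesis using \<rho>0 \<rho>(2) by (simp add: norm_divide)
  qed
  have L_hol: "holomorphic_prod m (\<lambda>p. L i (\<Psi> p)) (disc_ball m)" for i
    unfolding L_def by (intro holomorphic_prod_add holomorphic_prod_mult holomorphic_prod_sum
        holomorphic_prod_const hol [OF aut]) auto
  \<comment> \<open>Along the disc t -> t p the map \<open>L\<close> after \<open>\<Psi>\<close> has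
    derivative \<open>snd p\<close> at 0, because \<open>\<Phi>\<close> inverts
    \<open>\<Psi>\<close>. As \<open>snd p\<close> is a unit vector, this is the extremal case of
    Schwarz' lemma.\<close>
  have key: "L i (\<Psi> (scale_pt t p)) = t * snd p i"
    if p: "small p" and norm_p: "(\<Sum>j<m. (cmod (snd p j))\<^sup>2) = 1" and t: "cmod t < 1" and "i < m" for p t i
  proof -
    define u where "u t i = L i (\<Psi> (scale_pt t p))" for t i
    have u_hol: "(\<lambda>t. u t i) holomorphic_on \<Delta>" for i
      unfolding u_def by (intro holomorphic_prod_curve [OF L_hol] scale_in [OF p] lin_hol) auto
    have u0: "u 0 i = 0" for i by (simp add: u_def scale_0 fix0 L_def)
    have du: "((\<lambda>t. u t i) has_field_derivative snd p i) (at 0)" if i: "i < m" for i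
    proof -
      have 0: "0 \<in> \<Delta>" by simp
      have holF: "(\<lambda>t. fst (\<Psi> (scale_pt t p))) holomorphic_on \<Delta>"
        by (intro holomorphic_prod_curve [OF hol(1) [OF aut]] scale_in [OF p] lin_hol) auto
      have holS: "(\<lambda>t. snd (\<Psi> (scale_pt t p)) j) holomorphic_on \<Delta>" if "j < m" for j
        by (intro holomorphic_prod_curve [OF hol(2) [OF aut that]] scale_in [OF p] lin_hol) auto
      note dF = holomorphic_derivI [OF holF open_ball 0]
      note dS = holomorphic_derivI [OF holS open_ball 0]
      let ?d = "\<alpha> i * deriv (\<lambda>t. fst (\<Psi> (scale_pt t p))) 0 + (\<Sum>j<m. \<beta> i j * deriv (\<lambda>t. snd (\<Psi> (scale_pt t p)) j) 0)"
      have d1: "((\<lambda>t. u t i) has_field_derivative ?d) (at 0)"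
        unfolding u_def L_def by (intro DERIV_add DERIV_cmult [OF dF] has_field_derivative_lin_comb [OF dS])
      have "((\<lambda>t. snd (\<Phi> (\<Psi> (scale_pt t p))) i) has_field_derivative ?d) (at 0 within \<Delta>)"
      proof -
        have "has_prod_deriv m (disc_ball m) (\<lambda>p. snd (\<Phi> p) i) (\<Psi> (scale_pt 0 p)) (\<alpha> i) (\<beta> i)"
          unfolding scale_0 fix0 by (rule d\<Phi> [OF i])
        from has_prod_deriv_curve [where g = "\<lambda>t. \<Psi> (scale_pt t p)" and S = \<Delta> and t = 0,
            OF this dF dS disc_ball_aut_maps [OF aut scale_in [OF p]]]
        show ?thesis .
      qed
      then have "((\<lambda>t. t * snd p i) has_field_derivative ?d) (at 0 within \<Delta>)"
      proof (rule has_field_derivative_transform_within [of _ _ _ _ 1])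
        fix t :: complex assume "t \<in> \<Delta>"
        then show "snd (\<Phi> (\<Psi> (scale_pt t p))) i = t * snd p i"
          unfolding \<Phi>(2) [OF scale_in [OF p \<open>t \<in> \<Delta>\<close>]] by (simp add: scale_pt_def)
      qed auto
      then have d2: "((\<lambda>t. t * snd p i) has_field_derivative ?d) (at 0)" by (simp add: at_within_open [OF _ open_ball])
      have "((\<lambda>t. t * snd p i) has_field_derivative snd p i) (at 0)"
        by (auto intro!: derivative_eq_intros)
      from DERIV_unique [OF d2 this] d1 show ?thesis by (simp only:)
    qed
    have schwarz: "cmod (\<Sum>i<m. c i * u t i) \<le> cmod t"
      "(\<Sum>i<m. c i * snd p i) = 1 \<Longrightarrow> (\<Sum>i<m. c i * u t i) = t"
      if c: "(\<Sum>i<m. (cmod (c i))\<^sup>2) \<le> 1" and t: "cmod t < 1" for c t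
    proof -
      define g where "g t = (\<Sum>i<m. c i * u t i)" for t
      have g_hol: "g holomorphic_on \<Delta>" unfolding g_def by (intro holomorphic_intros u_hol)
      have g0: "g 0 = 0" by (simp add: g_def u0)
      have g_less: "cmod (g t) < 1" if "cmod t < 1" for t
        unfolding g_def u_def
        by (intro L_less c disc_ball_aut_maps [OF aut] scale_in [OF p]) (use that in simp)
      have dg: "(g has_field_derivative (\<Sum>i<m. c i * snd p i)) (at 0)"
        unfolding g_def by (rule has_field_derivative_lin_comb [OF du])
      show "cmod (\<Sum>i<m. c i * u t i) \<le> cmod t"
        using Schwarz_Lemma(1) [OF g_hol g0 g_less t] by (simp add: g_def)
      assume 1: "(\<Sum>i<m. c i * snd p i) = 1"
      then have "cmod (deriv g 0) = 1" using DERIV_imp_deriv [OF dg] by simp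
      then obtain a where a: "\<And>t. cmod t < 1 \<Longrightarrow> g t = a * t"
        using Schwarz_Lemma(3) [OF g_hol g0 g_less t] by blast
      have "((\<lambda>t. a * t) has_field_derivative 1) (at 0 within \<Delta>)"
      proof (rule has_field_derivative_transform_within)
        show "(g has_field_derivative 1) (at 0 within \<Delta>)"
          using dg unfolding 1 by (rule has_field_derivative_at_within)
        show "g t = a * t" if "t \<in> \<Delta>" for t using a that by simp
      qed (rule zero_less_one, simp)
      then have d1: "((\<lambda>t. a * t) has_field_derivative 1) (at 0)" by (simp add: at_within_open [OF _ open_ball])
      have "((\<lambda>t. a * t) has_field_derivative a) (at 0)" by (auto intro!: derivative_eq_intros)
      from DERIV_unique [OF this d1] have "a = 1" .
      then show "(\<Sum>i<m. c i * u t i) = t" using a [OF t] by (simp add: g_def)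
    qed
    have pp: "cip m (snd p) (snd p) = 1" unfolding cip_self norm_p by simp
    \<comment> \<open>The equality case of Cauchy-Schwarz: \<open>u t\<close> has inner product
      \<open>t\<close> with the unit vector \<open>snd p\<close> and norm at most |t|, so it must be
      \<open>t * snd p\<close>.\<close>
    have up: "cip m (u t) (snd p) = t"
    proof -
      have "(\<Sum>i<m. cnj (snd p i) * u t i) = t"
        by (rule schwarz(2)) (use norm_p t pp in \<open>auto simp: cip_def mult.commute\<close>)
      then show ?thesis by (simp add: cip_def mult.commute)
    qed
    have uu: "(\<Sum>i<m. (cmod (u t i))\<^sup>2) \<le> (cmod t)\<^sup>2"
    proof (cases "(\<Sum>i<m. (cmod (u t i))\<^sup>2) = 0")
      case False
      define N where "N = sqrt (\<Sum>i<m. (cmod (u t i))\<^sup>2)"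
      have N2: "N\<^sup>2 = (\<Sum>i<m. (cmod (u t i))\<^sup>2)" by (simp add: N_def sum_nonneg)
      have N0: "N > 0" using False by (simp add: N_def less_le sum_nonneg)
      have "cmod (\<Sum>i<m. cnj (u t i) / of_real N * u t i) \<le> cmod t"
        by (rule schwarz(1)) (use t N0 N2 in \<open>simp_all add: norm_divide power_divide flip: sum_divide_distrib\<close>)
      also have "(\<Sum>i<m. cnj (u t i) / of_real N * u t i) = cip m (u t) (u t) / of_real N"
        by (simp add: cip_def sum_divide_distrib mult.commute)
      also have "\<dots> = of_real N"
        unfolding cip_self N2 [symmetric] using N0 by (simp add: power2_eq_square)
      finally have "N \<le> cmod t" using N0 by simp
      then show ?thesis unfolding N2 [symmetric] using N0 by (intro power_mono) auto
    qed simp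
    have "cip m (\<lambda>i. u t i - t * snd p i) (\<lambda>i. u t i - t * snd p i) = cip m (u t) (u t) - t * cnj t"
      unfolding cip_linear_left cip_linear_right up pp
      using cip_commute [of m "snd p" "u t"] by (simp add: up algebra_simps)
    then have "(\<Sum>i<m. (cmod (u t i - t * snd p i))\<^sup>2) = (\<Sum>i<m. (cmod (u t i))\<^sup>2) - (cmod t)\<^sup>2"
      unfolding Re_cip_self [symmetric] complex_norm_square [symmetric]
      by (simp only: minus_complex.sel Re_complex_of_real)
    with uu have "(\<Sum>i<m. (cmod (u t i - t * snd p i))\<^sup>2) \<le> 0" by simp
    then have "(\<Sum>i<m. (cmod (u t i - t * snd p i))\<^sup>2) = 0" by (intro antisym) (auto simp: sum_nonneg)
    then have "(cmod (u t i - t * snd p i))\<^sup>2 = 0"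
      using \<open>i < m\<close> by (subst (asm) sum_nonneg_eq_0_iff) auto
    then show ?thesis by (simp add: u_def)
  qed
  have nonzero: "L i (\<Psi> (z, v)) = v i" if z: "z \<in> \<Delta>" and v: "v \<in> complex_ball m" "cip m v v \<noteq> 0" and i: "i < m" for z v i
  proof -
    define N where "N = sqrt (\<Sum>j<m. (cmod (v j))\<^sup>2)"
    have N2: "N\<^sup>2 = (\<Sum>j<m. (cmod (v j))\<^sup>2)" by (simp add: N_def sum_nonneg)
    have N0: "N > 0" using v(2) unfolding cip_self of_real_eq_0_iff N_def by (simp add: less_le sum_nonneg)
    have N1: "N < 1" using v(1) by (simp add: N_def complex_ball_iff)
    \<comment> \<open>Dividing by \<open>N\<close> makes the ball part a unit vector, and |z| < N
      keeps the first entry below 1, so \<open>key\<close> applies. The identity theorem in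
      \<open>z\<close> then removes the bound on \<open>z\<close>.\<close>
    have small: "L i (\<Psi> (z, v)) = v i" if "z \<in> ball 0 N" for z
    proof -
      let ?p = "(z / of_real N, \<lambda>j. v j / of_real N)"
      have 1: "(\<Sum>j<m. (cmod (snd ?p j))\<^sup>2) = 1"
        using N0 by (simp add: norm_divide power_divide N2 [symmetric] flip: sum_divide_distrib)
      have "small ?p"
        using that N0 v(1) 1 by (simp add: small_def) (simp add: norm_divide complex_ball_iff cvec_def)
      then have "L i (\<Psi> (scale_pt (of_real N) ?p)) = of_real N * snd ?p i"
        using 1 N0 N1 i by (intro key) auto
      then show ?thesis using N0 by (simp add: scale_pt_def)
    qed
    have "(\<lambda>z. L i (\<Psi> (z, v))) holomorphic_on \<Delta>"
      by (rule holomorphic_prod_curve [OF L_hol, where g = "\<lambda>z. (z, v)"])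
         (use v in \<open>auto simp: in_disc_ball_iff intro!: holomorphic_intros\<close>)
    then show ?thesis
    proof (rule analytic_continuation_open [of "ball 0 N" \<Delta> "\<lambda>z. L i (\<Psi> (z, v))" "\<lambda>_. v i", rotated 5])
      show "ball (0 :: complex) N \<noteq> {}" using N0 by simp
      show "ball (0 :: complex) N \<subseteq> \<Delta>" using N1 by (intro subset_ball) simp
    qed (use z small in auto)
  qed
  have "L k (\<Psi> (z, v)) = v k" if z: "z \<in> \<Delta>" and v: "v \<in> complex_ball m" for z v
  proof (cases "cip m v v = 0")
    case False
    then show ?thesis using nonzero z v \<open>k < m\<close> by blast
  next
    case True
    have v0: "v = (\<lambda>j. 0)"
    proof
      fix j show "v j = 0"
        using cip_self_eq_0 [OF True, of j] v by (cases "j < m") (auto simp: complex_ball_iff cvec_def)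
    qed
    \<comment> \<open>A zero ball part cannot be normalized; the value there is reached by
      continuation along the axis of coordinate \<open>k\<close>.\<close>
    define e where "e t = (\<lambda>j. if j = k then t else 0 :: complex)" for t
    have e_cip: "cip m (e t) (e t) = t * cnj t" for t
      using \<open>k < m\<close> by (simp add: cip_def e_def if_distrib [of "\<lambda>x. x * _"] cong: if_cong)
    have e_in: "e t \<in> complex_ball m" if "t \<in> \<Delta>" for t
    proof -
      have "(\<Sum>j<m. (cmod (e t j))\<^sup>2) = (cmod t)\<^sup>2"
        unfolding Re_cip_self [symmetric] e_cip complex_norm_square [symmetric] by (rule Re_complex_of_real)
      then show ?thesis using that \<open>k < m\<close> by (auto simp: complex_ball_iff cvec_def e_def power_less_one_iff)
    qed
    have "(\<lambda>t. L k (\<Psi> (z, e t))) holomorphic_on \<Delta>"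
    proof (rule holomorphic_prod_curve [OF L_hol, where g = "\<lambda>t. (z, e t)"])
      show "(\<lambda>t. snd (z, e t) j) holomorphic_on \<Delta>" for j
        by (cases "j = k") (auto simp: e_def intro!: holomorphic_intros)
    qed (use z e_in in \<open>auto simp: in_disc_ball_iff\<close>)
    moreover have "L k (\<Psi> (z, e t)) = t" if "t \<in> \<Delta> - {0}" for t
      using nonzero [OF z e_in, of t k] that \<open>k < m\<close> by (simp add: e_cip) (simp add: e_def)
    moreover have "(1/2 :: complex) \<in> \<Delta> - {0}" by simp
    then have "\<Delta> - {0 :: complex} \<noteq> {}" by blast
    ultimately have "L k (\<Psi> (z, e 0)) = 0"
      by (intro analytic_continuation_open [of "\<Delta> - {0}" \<Delta> "\<lambda>t. L k (\<Psi> (z, e t))" "\<lambda>t. t" 0])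
         (auto intro: holomorphic_intros)
    then show ?thesis by (simp add: v0 e_def)
  qed
  then have "\<alpha> k * fst (\<Psi> p) + (\<Sum>j<m. \<beta> k j * snd (\<Psi> p) j) = snd p k" if "p \<in> disc_ball m" for p
    using that by (cases p) (auto simp: L_def in_disc_ball_iff)
  then show ?thesis by (rule that)
qed

section \<open>The functional equation\<close>

lemma zero_islimpt_reals:
  assumes "r > 0" shows "(0 :: complex) islimpt (of_real ` {- r<..<r})"
  unfolding islimpt_approachable
proof (intro allI impI)
  fix e :: real assume "e > 0"
  define t where "t = min r e / 2"
  have t: "0 < t" "t < r" "t < e" using assms \<open>e > 0\<close> by (auto simp: t_def)
  then have "complex_of_real t \<in> of_real ` {- r<..<r}" by (intro imageI) simp
  moreover have "complex_of_real t \<noteq> 0" "dist (complex_of_real t) 0 < e" using t by simp_all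
  ultimately show "\<exists>x'\<in>of_real ` {- r<..<r}. x' \<noteq> (0 :: complex) \<and> dist x' 0 < e" by blast
qed

text \<open>With \<open>w = x + \<i>y\<close> and \<open>\<zeta> = x - \<i>y\<close> the antidiagonal \<open>\<zeta> = cnj w\<close> becomes the real plane, on
  which the identity theorem applies to one variable at a time.\<close>

lemma polarization_zero:
  assumes hol: "\<And>S p q. p holomorphic_on S \<Longrightarrow> q holomorphic_on S \<Longrightarrow> p ` S \<subseteq> \<Delta> \<Longrightarrow> q ` S \<subseteq> \<Delta> \<Longrightarrow>
      (\<lambda>t. E (p t) (q t)) holomorphic_on S"
    and diag: "\<And>w. w \<in> \<Delta> \<Longrightarrow> E w (cnj w) = 0"
    and "cmod w < 1/2" "cmod \<zeta> < 1/2"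
  shows "E w \<zeta> = 0"
proof -
  \<comment> \<open>Radius 1/2 ensures that \<open>x + \<i> * y\<close> and
    \<open>x - \<i> * y\<close> stay in the unit disc.\<close>
  let ?B = "ball (0 :: complex) (1/2)" and ?R = "complex_of_real ` {- (1/2)<..<1/2}"
  have R: "?R \<subseteq> ?B" by auto
  have sum: "x + \<i> * y \<in> \<Delta>" "x - \<i> * y \<in> \<Delta>" if "x \<in> ?B" "y \<in> ?B" for x y
  proof -
    have "cmod (\<i> * y) = cmod y" by (simp add: norm_mult)
    then show "x + \<i> * y \<in> \<Delta>" "x - \<i> * y \<in> \<Delta>"
      using that norm_triangle_ineq [of x "\<i> * y"] norm_triangle_ineq4 [of x "\<i> * y"] by simp_all
  qed
  have 1: "E (x + \<i> * of_real y) (x - \<i> * of_real y) = 0" if x: "x \<in> ?B" and y: "\<bar>y\<bar> < 1/2" for x y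
  proof (rule analytic_continuation [of "\<lambda>x. E (x + \<i> * of_real y) (x - \<i> * of_real y)" ?B ?R 0])
    have y': "complex_of_real y \<in> ?B" using y by simp
    show "(\<lambda>x. E (x + \<i> * of_real y) (x - \<i> * of_real y)) holomorphic_on ?B"
      by (intro hol holomorphic_intros image_subsetI sum y')
    fix z assume "z \<in> ?R"
    then obtain s where s: "z = of_real s" "\<bar>s\<bar> < 1/2" by auto
    have "z + \<i> * of_real y \<in> \<Delta>" using sum(1) [OF _ y'] s by simp
    from diag [OF this] show "E (z + \<i> * of_real y) (z - \<i> * of_real y) = 0" by (simp add: s)
  qed (use x zero_islimpt_reals [of "1/2"] R in auto)
  have 2: "E (x + \<i> * y) (x - \<i> * y) = 0" if x: "x \<in> ?B" and y: "y \<in> ?B" for x y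
  proof (rule analytic_continuation [of "\<lambda>y. E (x + \<i> * y) (x - \<i> * y)" ?B ?R 0])
    show "(\<lambda>y. E (x + \<i> * y) (x - \<i> * y)) holomorphic_on ?B"
      by (intro hol holomorphic_intros image_subsetI sum x)
    fix z assume "z \<in> ?R"
    then show "E (x + \<i> * z) (x - \<i> * z) = 0" using 1 [OF x] by auto
  qed (use y zero_islimpt_reals [of "1/2"] R in auto)
  define x y where "x = (w + \<zeta>) / 2" and "y = (w - \<zeta>) / (2 * \<i>)"
  have "x \<in> ?B" "y \<in> ?B"
    using norm_triangle_ineq [of w \<zeta>] norm_triangle_ineq4 [of w \<zeta>] assms(3,4)
    by (simp_all add: x_def y_def norm_divide norm_mult)
  from 2 [OF this] show ?thesis by (simp add: x_def y_def field_simps)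
qed

section \<open>Integrating the polarized metric equation\<close>

lemma cmod_cip_less:
  assumes "x \<in> complex_ball n" "y \<in> complex_ball n" shows "cmod (cip n x y) < 1"
proof -
  have s: "sqrt (\<Sum>i<n. (cmod (x i))\<^sup>2) < 1" "sqrt (\<Sum>i<n. (cmod (y i))\<^sup>2) < 1"
    using assms by (simp_all add: complex_ball_iff)
  have "cmod (cip n x y) \<le> sqrt (\<Sum>i<n. (cmod (x i))\<^sup>2) * sqrt (\<Sum>i<n. (cmod (cnj (y i)))\<^sup>2)"
    unfolding cip_def by (rule cmod_sum_mult_le)
  also have "\<dots> < 1 * 1" using s by (intro mult_strict_mono') (simp_all add: sum_nonneg)
  finally show ?thesis by simp
qed

lemma has_field_derivative_star:
  assumes "(g has_field_derivative d) (at (cnj z))"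
  shows "((\<lambda>z. cnj (g (cnj z))) has_field_derivative cnj d) (at z)"
  using has_field_derivative_cnj_cnj [OF assms] by (simp add: o_def)

text \<open>The metric equation says that the logarithm of the quotient of the two sides has zero
  mixed derivative on the antidiagonal. Polarization frees the two variables; integrating in
  \<open>\<zeta> = cnj \<xi>\<close> and then in \<open>w\<close>,
  \<open>f 0 = (0, \<lambda>_. 0)\<close> fixes both constants. Derivatives of logarithms are
  written as quotients, so no branch is chosen.\<close>

lemma isometry_functional_equation:
  assumes f: "holo_isometry n f" and f0: "f 0 = (0, \<lambda>_. 0)"
    and w: "cmod w < 1/2" and \<xi>: "cmod \<xi> < 1/2"
  shows "1 - w * cnj \<xi> = (1 - fst (f w) * cnj (fst (f \<xi>))) * (1 - cip n (snd (f w)) (snd (f \<xi>)))"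
proof -
  note fD = holo_isometryD [OF f]
  \<comment> \<open>\<open>as\<close> and \<open>bs\<close> are the reflections of \<open>a\<close>
    and \<open>b\<close> by conjugation. They are holomorphic in \<open>\<zeta>\<close>, which
    replaces the antiholomorphic dependence on \<open>\<xi>\<close>.\<close>
  define a a' as as' where "a w = fst (f w)" and "a' = deriv a"
    and "as \<zeta> = cnj (a (cnj \<zeta>))" and "as' \<zeta> = cnj (a' (cnj \<zeta>))" for w \<zeta>
  define b b' bs bs' where "b j w = snd (f w) j" and "b' j = deriv (b j)"
    and "bs j \<zeta> = cnj (b j (cnj \<zeta>))" and "bs' j \<zeta> = cnj (b' j (cnj \<zeta>))" for j w \<zeta>
  have a_eq: "a = (\<lambda>w. fst (f w))" and b_eq: "b j = (\<lambda>w. snd (f w) j)" for j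
    by (simp_all add: a_def b_def fun_eq_iff)
  have da: "(a has_field_derivative a' w) (at w)" if "w \<in> \<Delta>" for w
    using fD(4) [OF that] by (simp add: a_eq a'_def)
  have db: "(b j has_field_derivative b' j w) (at w)" if "w \<in> \<Delta>" "j < n" for w j
    using fD(5) [OF that] by (simp add: b_eq b'_def)
  have das: "(as has_field_derivative as' \<zeta>) (at \<zeta>)" if "\<zeta> \<in> \<Delta>" for \<zeta>
    unfolding as_def [abs_def] as'_def using that by (intro has_field_derivative_star da) simp
  have dbs: "(bs j has_field_derivative bs' j \<zeta>) (at \<zeta>)" if "\<zeta> \<in> \<Delta>" "j < n" for \<zeta> j
    unfolding bs_def [abs_def] bs'_def using that by (intro has_field_derivative_star db) simp_all
  have star: "cnj \<circ> g \<circ> cnj holomorphic_on \<Delta>" if "g holomorphic_on \<Delta>" for g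
  proof (rule holomorphic_on_compose_cnj_cnj)
    have "cnj ` \<Delta> = \<Delta>" by (auto intro: image_eqI [of _ _ "cnj _"])
    then show "g holomorphic_on cnj ` \<Delta>" using that by simp
  qed simp
  have hol: "a holomorphic_on \<Delta>" "a' holomorphic_on \<Delta>" "as holomorphic_on \<Delta>" "as' holomorphic_on \<Delta>"
  proof -
    show 1: "a holomorphic_on \<Delta>" using fD(1) by (simp add: a_eq)
    show 2: "a' holomorphic_on \<Delta>" unfolding a'_def by (intro holomorphic_deriv 1) simp
    show "as holomorphic_on \<Delta>" "as' holomorphic_on \<Delta>"
      using star [OF 1] star [OF 2] by (simp_all add: as_def [abs_def] as'_def [abs_def] o_def)
  qed
  have holb: "b j holomorphic_on \<Delta>" "b' j holomorphic_on \<Delta>" "bs j holomorphic_on \<Delta>" "bs' j holomorphic_on \<Delta>"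
    if "j < n" for j
  proof -
    show 1: "b j holomorphic_on \<Delta>" using fD(2) [OF that] by (simp add: b_eq)
    show 2: "b' j holomorphic_on \<Delta>" unfolding b'_def by (intro holomorphic_deriv 1) simp
    show "bs j holomorphic_on \<Delta>" "bs' j holomorphic_on \<Delta>"
      using star [OF 1] star [OF 2] by (simp_all add: bs_def [abs_def] bs'_def [abs_def] o_def)
  qed
  have comp: "(\<lambda>t. g (p t)) holomorphic_on S"
    if "g holomorphic_on \<Delta>" "p holomorphic_on S" "p ` S \<subseteq> \<Delta>" for g p and S :: "complex set"
    using holomorphic_on_compose_gen [OF that(2,1,3)] by (simp add: o_def)
  define P Pw Pz Pwz where "P w \<zeta> = (\<Sum>j<n. b j w * bs j \<zeta>)" and "Pw w \<zeta> = (\<Sum>j<n. b' j w * bs j \<zeta>)"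
    and "Pz w \<zeta> = (\<Sum>j<n. b j w * bs' j \<zeta>)" and "Pwz w \<zeta> = (\<Sum>j<n. b' j w * bs' j \<zeta>)" for w \<zeta>
  have P_hol: "(\<lambda>t. P (p t) (q t)) holomorphic_on S" "(\<lambda>t. Pw (p t) (q t)) holomorphic_on S"
    "(\<lambda>t. Pz (p t) (q t)) holomorphic_on S" "(\<lambda>t. Pwz (p t) (q t)) holomorphic_on S"
    if "p holomorphic_on S" "q holomorphic_on S" "p ` S \<subseteq> \<Delta>" "q ` S \<subseteq> \<Delta>" for p q and S :: "complex set"
    unfolding P_def Pw_def Pz_def Pwz_def
    by (intro holomorphic_on_sum holomorphic_on_mult comp [OF holb(1)] comp [OF holb(2)]
        comp [OF holb(3)] comp [OF holb(4)] that; simp)+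
  have Pw_deriv: "((\<lambda>w. P w \<zeta>) has_field_derivative Pw w \<zeta>) (at w)" if "w \<in> \<Delta>" for w \<zeta>
    unfolding P_def Pw_def by (intro DERIV_sum DERIV_cmult_right db that) simp
  have Pz_deriv: "((\<lambda>\<zeta>. P w \<zeta>) has_field_derivative Pz w \<zeta>) (at \<zeta>)"
    "((\<lambda>\<zeta>. Pw w \<zeta>) has_field_derivative Pwz w \<zeta>) (at \<zeta>)" if "\<zeta> \<in> \<Delta>" for w \<zeta>
    unfolding P_def Pw_def Pz_def Pwz_def by (intro DERIV_sum DERIV_cmult dbs that; simp)+
  have in_ball: "fst (f w) \<in> \<Delta>" "snd (f w) \<in> complex_ball n" if "w \<in> \<Delta>" for w
    using fD(3) [OF that] by (simp_all add: in_disc_ball_iff)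
  have less_neq: "1 - x \<noteq> 0" if "cmod x < 1" for x :: complex
    using that by auto
  have nz1: "1 - w * \<zeta> \<noteq> 0" "1 - a w * as \<zeta> \<noteq> 0" "1 - P w \<zeta> \<noteq> 0" if "w \<in> \<Delta>" "\<zeta> \<in> \<Delta>" for w \<zeta>
  proof -
    have \<zeta>: "cnj \<zeta> \<in> \<Delta>" using that by simp
    have prod: "cmod (x * y) < 1" if "cmod x < 1" "cmod y < 1" for x y :: complex
      using mult_strict_mono' [of "cmod x" 1 "cmod y" 1] that by (simp add: norm_mult)
    show "1 - w * \<zeta> \<noteq> 0" using that by (intro less_neq prod) auto
    show "1 - a w * as \<zeta> \<noteq> 0"
      using in_ball(1) [OF that(1)] in_ball(1) [OF \<zeta>] by (intro less_neq prod) (auto simp: a_def as_def)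
    have "P w \<zeta> = cip n (snd (f w)) (snd (f (cnj \<zeta>)))" by (simp add: P_def cip_def b_def bs_def)
    then show "1 - P w \<zeta> \<noteq> 0"
      using cmod_cip_less [OF in_ball(2) [OF that(1)] in_ball(2) [OF \<zeta>]] by (intro less_neq) simp
  qed
  \<comment> \<open>The mixed derivative of -log(1 - w \<zeta>) + log(1 - a(w) as(\<zeta>)) + log(1
    - P(w, \<zeta>)).\<close>
  define E where "E w \<zeta> = 1 / (1 - w * \<zeta>)\<^sup>2 - (a' w * as' \<zeta> / (1 - a w * as \<zeta>)\<^sup>2
      + (Pwz w \<zeta> / (1 - P w \<zeta>) + Pw w \<zeta> * Pz w \<zeta> / (1 - P w \<zeta>)\<^sup>2))" for w \<zeta>
  have E0: "E w \<zeta> = 0" if "cmod w < 1/2" "cmod \<zeta> < 1/2" for w \<zeta>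
  proof (rule polarization_zero [OF _ _ that])
    fix S p q
    assume pq: "p holomorphic_on S" "q holomorphic_on S" "p ` S \<subseteq> \<Delta>" "q ` S \<subseteq> \<Delta>"
    show "(\<lambda>t. E (p t) (q t)) holomorphic_on S"
      unfolding E_def
      by (intro holomorphic_on_diff holomorphic_on_add holomorphic_on_divide holomorphic_on_mult
          holomorphic_on_power holomorphic_on_const P_hol pq power_not_zero nz1
          comp [OF hol(1)] comp [OF hol(2)] comp [OF hol(3)] comp [OF hol(4)])
         (use pq in auto)
  next
    fix w :: complex assume w: "w \<in> \<Delta>"
    have "disc_sq w 1 = disc_sq (a w) (a' w) + ball_sq n (snd (f w)) (\<lambda>j. b' j w)"
      using f w unfolding holo_isometry_iff by (simp add: a_eq a'_def b_eq b'_def)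
    moreover have "disc_sq w 1 = 1 / (1 - w * cnj w)\<^sup>2" by (simp add: disc_sq_def)
    moreover have "disc_sq (a w) (a' w) = a' w * as' (cnj w) / (1 - a w * as (cnj w))\<^sup>2"
      by (simp add: disc_sq_def as_def as'_def)
    moreover have "ball_sq n (snd (f w)) (\<lambda>j. b' j w) = Pwz w (cnj w) / (1 - P w (cnj w))
        + Pw w (cnj w) * Pz w (cnj w) / (1 - P w (cnj w))\<^sup>2"
      by (simp add: ball_sq_def cip_def P_def Pw_def Pz_def Pwz_def b_def bs_def bs'_def mult.commute)
    ultimately show "E w (cnj w) = 0" by (simp add: E_def)
  qed
  let ?B = "ball (0 :: complex) (1/2)"
  have B: "?B \<subseteq> \<Delta>" by (intro subset_ball) simp
  define \<zeta> where "\<zeta> = cnj \<xi>"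
  have \<zeta>: "\<zeta> \<in> ?B" using \<xi> by (simp add: \<zeta>_def)
  have as0: "as 0 = 0" and bs0: "bs j 0 = 0" for j by (simp_all add: as_def bs_def a_def b_def f0)
  \<comment> \<open>The w-derivative of log(1 - w \<zeta>) - log(1 - a(w) as(\<zeta>)) - log(1 -
    P(w, \<zeta>)). Its \<zeta>-derivative is \<open>- E\<close>, and it vanishes at
    \<open>\<zeta> = 0\<close> because \<open>as\<close> and all \<open>bs j\<close> do.\<close>
  define \<Lambda> where "\<Lambda> w \<zeta> = - \<zeta> / (1 - w * \<zeta>) + (a' w * as \<zeta> / (1 - a w * as \<zeta>) + Pw w \<zeta> / (1 - P w \<zeta>))" for w \<zeta>
  have \<Lambda>0: "\<Lambda> w \<zeta> = 0" if w: "w \<in> ?B" for w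
  proof -
    have "(\<Lambda> w has_field_derivative 0) (at x within ?B)" if x: "x \<in> ?B" for x
    proof -
      have x': "x \<in> \<Delta>" and w': "w \<in> \<Delta>" using x w B by auto
      note nz = nz1 [OF w' x']
      have quot: "((\<lambda>\<zeta>. u \<zeta> / (1 - v \<zeta>)) has_field_derivative u' / (1 - v x) + u x * v' / (1 - v x)\<^sup>2) (at x)"
        if "(u has_field_derivative u') (at x)" "(v has_field_derivative v') (at x)" "1 - v x \<noteq> 0" for u v u' v'
        by (rule DERIV_cong [OF DERIV_divide [OF that(1) DERIV_diff [OF DERIV_const that(2)] that(3)]])
           (use that(3) in \<open>simp add: power2_eq_square add_divide_distrib\<close>)
      have contract: "r / (1 - y) + r * y / (1 - y)\<^sup>2 = r / (1 - y)\<^sup>2" if "1 - y \<noteq> 0" for r y :: complex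
      proof -
        have "r / (1 - y) = r * (1 - y) / (1 - y)\<^sup>2" using that by (simp add: power2_eq_square)
        then have "r / (1 - y) + r * y / (1 - y)\<^sup>2 = (r * (1 - y) + r * y) / (1 - y)\<^sup>2"
          by (simp only: add_divide_distrib)
        then show ?thesis by (simp add: right_diff_distrib)
      qed
      have 1: "((\<lambda>\<zeta>. - \<zeta> / (1 - w * \<zeta>)) has_field_derivative - (1 / (1 - w * x)\<^sup>2)) (at x)"
        by (rule DERIV_cong [OF quot [OF DERIV_minus [OF DERIV_ident] DERIV_cmult [OF DERIV_ident] nz(1)]])
           (use contract [OF nz(1), of "-1"] in \<open>simp add: mult.commute\<close>)
      have 2: "((\<lambda>\<zeta>. a' w * as \<zeta> / (1 - a w * as \<zeta>)) has_field_derivative a' w * as' x / (1 - a w * as x)\<^sup>2) (at x)"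
        by (rule DERIV_cong [OF quot [OF DERIV_cmult [OF das [OF x']] DERIV_cmult [OF das [OF x']] nz(2)]])
           (use contract [OF nz(2), of "a' w * as' x"] in \<open>simp add: mult_ac\<close>)
      have 3: "((\<lambda>\<zeta>. Pw w \<zeta> / (1 - P w \<zeta>)) has_field_derivative
          Pwz w x / (1 - P w x) + Pw w x * Pz w x / (1 - P w x)\<^sup>2) (at x)"
        by (rule quot [OF Pz_deriv(2) [OF x'] Pz_deriv(1) [OF x'] nz(3)])
      let ?E = "- (1 / (1 - w * x)\<^sup>2) + (a' w * as' x / (1 - a w * as x)\<^sup>2
          + (Pwz w x / (1 - P w x) + Pw w x * Pz w x / (1 - P w x)\<^sup>2))"
      have "(\<Lambda> w has_field_derivative ?E) (at x)"
        unfolding \<Lambda>_def [abs_def] by (intro DERIV_add 1 2 3)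
      moreover have "?E = - E w x"
        by (simp add: E_def)
      ultimately have "(\<Lambda> w has_field_derivative 0) (at x)" using E0 [of w x] w x by simp
      then show ?thesis by (rule has_field_derivative_at_within)
    qed
    then obtain c where c: "\<And>x. x \<in> ?B \<Longrightarrow> \<Lambda> w x = c"
      using has_field_derivative_zero_constant [of ?B "\<Lambda> w"] by auto
    have "c = \<Lambda> w 0" using c [of 0] by simp
    also have "\<dots> = 0" by (simp add: \<Lambda>_def as0 bs0 Pw_def)
    finally show ?thesis using c [OF \<zeta>] by simp
  qed
  \<comment> \<open>The logarithmic derivative of \<open>H\<close> in \<open>w\<close> is
    \<open>- \<Lambda>\<close>, so \<open>H\<close> keeps its value 1 at the origin.\<close>
  define H where "H w = (1 - a w * as \<zeta>) * (1 - P w \<zeta>) / (1 - w * \<zeta>)" for w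
  have "(H has_field_derivative 0) (at x within ?B)" if x: "x \<in> ?B" for x
  proof -
    have x': "x \<in> \<Delta>" and \<zeta>': "\<zeta> \<in> \<Delta>" using x \<zeta> B by auto
    note nz = nz1 [OF x' \<zeta>']
    define A1 A2 A3 where "A1 = 1 - x * \<zeta>" and "A2 = 1 - a x * as \<zeta>" and "A3 = 1 - P x \<zeta>"
    have "(H has_field_derivative ((- (a' x * as \<zeta>) * A3 + - Pw x \<zeta> * A2) * A1 - A2 * A3 * - \<zeta>) / (A1 * A1)) (at x)"
      unfolding H_def [abs_def] A1_def A2_def A3_def
    proof (rule DERIV_divide, rule DERIV_mult)
      show "((\<lambda>w. 1 - a w * as \<zeta>) has_field_derivative - (a' x * as \<zeta>)) (at x)"
        by (rule DERIV_cong [OF DERIV_diff [OF DERIV_const DERIV_cmult_right [OF da [OF x']]]]) simp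
      show "((\<lambda>w. 1 - P w \<zeta>) has_field_derivative - Pw x \<zeta>) (at x)"
        by (rule DERIV_cong [OF DERIV_diff [OF DERIV_const Pw_deriv [OF x']]]) simp
      show "((\<lambda>w. 1 - w * \<zeta>) has_field_derivative - \<zeta>) (at x)"
        by (rule DERIV_cong [OF DERIV_diff [OF DERIV_const DERIV_cmult_right [OF DERIV_ident]]]) simp
      show "1 - x * \<zeta> \<noteq> 0" by (rule nz(1))
    qed
    moreover have "(- (a' x * as \<zeta>) * A3 + - Pw x \<zeta> * A2) * A1 - A2 * A3 * - \<zeta> = - \<Lambda> x \<zeta> * (A1 * A2 * A3)"
    proof -
      have "\<Lambda> x \<zeta> = - \<zeta> / A1 + (a' x * as \<zeta> / A2 + Pw x \<zeta> / A3)"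
        by (simp add: \<Lambda>_def A1_def A2_def A3_def)
      moreover have "A1 \<noteq> 0" "A2 \<noteq> 0" "A3 \<noteq> 0" using nz by (simp_all add: A1_def A2_def A3_def)
      ultimately have "\<Lambda> x \<zeta> = - (\<zeta> / A1) + (a' x * as \<zeta> / A2 + Pw x \<zeta> / A3)"
        "\<zeta> = \<zeta> / A1 * A1" "a' x * as \<zeta> = a' x * as \<zeta> / A2 * A2" "Pw x \<zeta> = Pw x \<zeta> / A3 * A3"
        by simp_all
      moreover have "(- (Y * A2) * A3 + - (Z * A3) * A2) * A1 - A2 * A3 * - (X * A1) = - (- X + (Y + Z)) * (A1 * A2 * A3)"
        for X Y Z by (simp add: algebra_simps)
      ultimately show ?thesis by metis
    qed
    ultimately have "(H has_field_derivative 0) (at x)" using \<Lambda>0 [OF x] by simp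
    then show ?thesis by (rule has_field_derivative_at_within)
  qed
  then obtain c where c: "\<And>x. x \<in> ?B \<Longrightarrow> H x = c"
    using has_field_derivative_zero_constant [of ?B H] by auto
  have "c = H 0" using c [of 0] by simp
  also have "\<dots> = 1" by (simp add: H_def a_def P_def b_def f0)
  finally have "H w = 1" using c [of w] w by simp
  then have "(1 - a w * as \<zeta>) * (1 - P w \<zeta>) = 1 - w * \<zeta>"
    using nz1(1) [of w \<zeta>] w \<zeta> by (simp add: H_def divide_eq_1_iff)
  moreover have "P w \<zeta> = cip n (snd (f w)) (snd (f \<xi>))" by (simp add: P_def cip_def b_def bs_def \<zeta>_def)
  ultimately show ?thesis by (simp add: a_def as_def \<zeta>_def)
qed

section \<open>Moebius changes of the inverse\<close>

lemma has_fps_expansion_poly: "poly (p :: complex poly) has_fps_expansion fps_of_poly p"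
  by (simp add: has_fps_expansion_def)

lemma fps_expansion_unique_ev:
  fixes F G :: "complex fps"
  assumes "f has_fps_expansion F" "g has_fps_expansion G" "eventually (\<lambda>z. f z = g z) (nhds 0)"
  shows "F = G"
  using assms fps_expansion_unique_complex has_fps_expansion_cong [OF assms(3) refl] by blast

lemma coeff_mult_top:
  fixes p q :: "'a::comm_semiring_0 poly"
  assumes "degree p \<le> k" "degree q \<le> l"
  shows "coeff (p * q) (k + l) = coeff p k * coeff q l"
proof -
  have "coeff p i * coeff q (k + l - i) = 0" if "i \<in> {..k + l} - {k}" for i
  proof (cases "i < k")
    case True
    then have "coeff q (k + l - i) = 0" using assms by (intro coeff_eq_0) simp
    then show ?thesis by simp
  next
    case False
    then have "coeff p i = 0" using that assms by (intro coeff_eq_0) simp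
    then show ?thesis by simp
  qed
  then show ?thesis unfolding coeff_mult by (subst sum.remove [of _ k]) auto
qed

lemma degree_linear_power_le: "degree ([:a, b:] ^ k :: 'a::comm_semiring_1 poly) \<le> k"
  using degree_power_le [of "[:a, b:]" k] by (rule order_trans) simp

lemma coeff_linear_power_top: "coeff ([:a, b:] ^ k :: 'a::comm_semiring_1 poly) k = b ^ k"
proof (induction k)
  case (Suc k)
  have "coeff ([:a, b:] * [:a, b:] ^ k) (1 + k) = b * b ^ k"
    using degree_linear_power_le [of a b k] by (subst coeff_mult_top) (simp_all add: Suc)
  then show ?case by simp
qed simp

text \<open>This is (1 - conj(a) z)^d times p at (a - z) / (1 - conj(a) z). The exponent
  \<open>d\<close> is a parameter and not the degree of \<open>p\<close>, so that numerator and
  denominator of a fraction acquire the same factor.\<close>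

definition poly_mob :: "complex \<Rightarrow> nat \<Rightarrow> complex poly \<Rightarrow> complex poly" where
  "poly_mob a d p = (\<Sum>k\<le>d. smult (coeff p k) ([:a, -1:] ^ k * [:1, - cnj a:] ^ (d - k)))"

lemma poly_poly_mob_sum:
  "poly (poly_mob a d p) z = (\<Sum>k\<le>d. coeff p k * ((a - z) ^ k * (1 - cnj a * z) ^ (d - k)))"
  by (simp add: poly_mob_def poly_sum mult.commute)

lemma poly_poly_mob:
  assumes "degree p \<le> d" "1 - cnj a * z \<noteq> 0"
  shows "poly (poly_mob a d p) z = (1 - cnj a * z) ^ d * poly p (disc_mob a z)"
proof -
  have "poly (poly_mob a d p) z = (\<Sum>k\<le>d. coeff p k * ((a - z) ^ k * (1 - cnj a * z) ^ (d - k)))"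
    by (rule poly_poly_mob_sum)
  also have "\<dots> = (\<Sum>k\<le>d. (1 - cnj a * z) ^ d * (coeff p k * disc_mob a z ^ k))"
  proof (intro sum.cong refl)
    fix k assume "k \<in> {..d}"
    then have "(1 - cnj a * z) ^ d = (1 - cnj a * z) ^ k * (1 - cnj a * z) ^ (d - k)"
      by (simp flip: power_add)
    then show "coeff p k * ((a - z) ^ k * (1 - cnj a * z) ^ (d - k)) = (1 - cnj a * z) ^ d * (coeff p k * disc_mob a z ^ k)"
      using assms(2) by (simp add: disc_mob_def power_divide)
  qed
  also have "\<dots> = (1 - cnj a * z) ^ d * poly p (disc_mob a z)"
    unfolding sum_distrib_left [symmetric] poly_altdef
    using assms(1) by (intro arg_cong2 [where f = "(*)"] refl sum.mono_neutral_right) (auto simp: coeff_eq_0)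
  finally show ?thesis .
qed

lemma poly_poly_mob_pole:
  assumes "1 - cnj a * z = 0"
  shows "poly (poly_mob a d p) z = coeff p d * (a - z) ^ d"
proof -
  have "poly (poly_mob a d p) z = (\<Sum>k\<le>d. coeff p k * ((a - z) ^ k * (1 - cnj a * z) ^ (d - k)))"
    by (rule poly_poly_mob_sum)
  also have "\<dots> = (\<Sum>k\<le>d. if k = d then coeff p d * (a - z) ^ d else 0)"
    by (intro sum.cong refl) (auto simp: assms)
  finally show ?thesis by simp
qed

lemma degree_poly_mob: "degree (poly_mob a d p) \<le> d"
  unfolding poly_mob_def
proof (intro degree_sum_le)
  fix k assume "k \<in> {..d}"
  have "degree ([:a, -1:] ^ k * [:1, - cnj a:] ^ (d - k)) \<le> k + (d - k)"
    by (intro order_trans [OF degree_mult_le] add_mono degree_linear_power_le)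
  then show "degree (smult (coeff p k) ([:a, -1:] ^ k * [:1, - cnj a:] ^ (d - k))) \<le> d"
    using \<open>k \<in> {..d}\<close> by (intro order_trans [OF degree_smult_le]) simp
qed simp

text \<open>The coefficient of index \<open>d\<close> plays the role of the value at infinity. The
  involution sends infinity to \<open>1 / cnj a\<close>, or to itself when \<open>a = 0\<close>,
  hence the two cases.\<close>

lemma coeff_poly_mob_top:
  assumes "degree p \<le> d"
  shows "coeff (poly_mob a d p) d = (if a = 0 then (-1) ^ d * coeff p d else (- cnj a) ^ d * poly p (1 / cnj a))"
proof -
  have "coeff ([:a, -1:] ^ k * [:1, - cnj a:] ^ (d - k)) d = (-1) ^ k * (- cnj a) ^ (d - k)" if "k \<le> d" for k
    using coeff_mult_top [OF degree_linear_power_le [of a "-1" k] degree_linear_power_le [of 1 "- cnj a" "d - k"]] that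
    by (simp add: coeff_linear_power_top)
  then have *: "coeff (poly_mob a d p) d = (\<Sum>k\<le>d. coeff p k * ((-1) ^ k * (- cnj a) ^ (d - k)))"
    by (simp add: poly_mob_def coeff_sum)
  show ?thesis
  proof (cases "a = 0")
    case True
    have "(\<Sum>k\<le>d. coeff p k * ((-1) ^ k * (- cnj a) ^ (d - k))) = (\<Sum>k\<le>d. if k = d then (-1) ^ d * coeff p d else 0)"
      by (intro sum.cong refl) (auto simp: True)
    then show ?thesis using * True by simp
  next
    case False
    have "(\<Sum>k\<le>d. coeff p k * ((-1) ^ k * (- cnj a) ^ (d - k))) = (\<Sum>k\<le>d. (- cnj a) ^ d * (coeff p k * (1 / cnj a) ^ k))"
    proof (intro sum.cong refl)
      fix k assume "k \<in> {..d}"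
      then have "(- cnj a) ^ d = (- cnj a) ^ k * (- cnj a) ^ (d - k)" by (simp flip: power_add)
      also have "(- cnj a) ^ k = (-1) ^ k * cnj a ^ k" by (rule power_minus)
      finally show "coeff p k * ((-1) ^ k * (- cnj a) ^ (d - k)) = (- cnj a) ^ d * (coeff p k * (1 / cnj a) ^ k)"
        using False by (simp add: power_divide)
    qed
    also have "\<dots> = (- cnj a) ^ d * poly p (1 / cnj a)"
      unfolding sum_distrib_left [symmetric] poly_altdef
      using assms by (intro arg_cong2 [where f = "(*)"] refl sum.mono_neutral_right) (auto simp: coeff_eq_0)
    finally show ?thesis using * False by simp
  qed
qed

lemma coprime_if_no_common_root:
  fixes p q :: "complex poly"
  assumes "\<And>z. poly p z = 0 \<Longrightarrow> poly q z = 0 \<Longrightarrow> False"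
  shows "coprime p q"
proof (rule coprimeI)
  fix g assume g: "g dvd p" "g dvd q"
  have "poly g z \<noteq> 0" for z
    using g assms [of z] by (auto elim!: dvdE)
  then have "degree g = 0" using fundamental_theorem_of_algebra_alt [of g] by (metis degree_pCons_0 poly_0)
  moreover have "g \<noteq> 0" using \<open>\<And>z. poly g z \<noteq> 0\<close> by auto
  ultimately show "is_unit g" by (simp add: is_unit_iff_degree)
qed

text \<open>Coprimality and exact degree together exclude common zeros on the whole sphere. A common
  zero of the new pair off the pole would give one of the old pair at \<open>disc_mob a z\<close>;
  at the pole it would make both old coefficients of index \<open>d\<close> vanish. A drop in degree
  would mean a common zero at \<open>1 / cnj a\<close>, or again vanishing coefficients when
  \<open>a = 0\<close>.\<close>

lemma poly_mob_pair:
  assumes cop: "coprime p q" and deg: "max (degree p) (degree q) = d" and a: "cmod a < 1"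
  shows "coprime (poly_mob a d p) (poly_mob a d q)" "max (degree (poly_mob a d p)) (degree (poly_mob a d q)) = d"
proof -
  have d: "degree p \<le> d" "degree q \<le> d" using deg by auto
  have no_root: "poly p z \<noteq> 0 \<or> poly q z \<noteq> 0" for z using coprime_poly_0 [OF cop] by blast
  have top: "coeff p d \<noteq> 0 \<or> coeff q d \<noteq> 0"
  proof (cases "d = 0")
    case True
    then have "poly p 0 = coeff p d" "poly q 0 = coeff q d" by (simp_all add: poly_0_coeff_0)
    then show ?thesis using no_root [of 0] by simp
  next
    case False
    then show ?thesis using deg by (metis leading_coeff_0_iff degree_0 max_def)
  qed
  show "coprime (poly_mob a d p) (poly_mob a d q)"
  proof (rule coprime_if_no_common_root)
    fix z assume z: "poly (poly_mob a d p) z = 0" "poly (poly_mob a d q) z = 0"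
    show False
    proof (cases "1 - cnj a * z = 0")
      case True
      have "a - z \<noteq> 0"
      proof
        assume "a - z = 0"
        then have "1 - a * cnj a = 0" using True by (simp add: mult.commute)
        then show False using one_minus_norm_sq_neq_0 [OF a] by simp
      qed
      then show False using z top poly_poly_mob_pole [OF True] by simp
    next
      case False
      then show False using z no_root [of "disc_mob a z"] poly_poly_mob [OF d(1) False] poly_poly_mob [OF d(2) False] by simp
    qed
  qed
  have "coeff (poly_mob a d p) d \<noteq> 0 \<or> coeff (poly_mob a d q) d \<noteq> 0"
    using top no_root [of "1 / cnj a"] by (auto simp: coeff_poly_mob_top d)
  then show "max (degree (poly_mob a d p)) (degree (poly_mob a d q)) = d"
    using degree_poly_mob [of a d p] degree_poly_mob [of a d q] le_degree by (metis max.absorb1 max.absorb2 le_antisym)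
qed

subsection \<open>Normalized isometries\<close>

text \<open>The inverse is kept as a coprime pair with cleared denominators, since a pair
  transformed by \<open>poly_mob\<close> need not be the one that \<open>quot_of_fract\<close>
  selects. The degree is written \<open>Suc m\<close> because \<open>m\<close> is the dimension to
  be reached.\<close>

locale normalized_isometry =
  fixes n m :: nat and f :: "complex \<Rightarrow> complex \<times> (nat \<Rightarrow> complex)" and P Q :: "complex poly"
  assumes iso: "holo_isometry n f" and f0: "f 0 = (0, \<lambda>_. 0)"
    and cop: "coprime P Q" and deg: "max (degree P) (degree Q) = Suc m"
    and inverse_eq: "\<And>w. w \<in> \<Delta> \<Longrightarrow> poly P (fst (f w)) = w * poly Q (fst (f w))"
    and Q_nz: "\<And>w. w \<in> \<Delta> \<Longrightarrow> poly Q (fst (f w)) \<noteq> 0"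
begin

lemma inj: "inj_on (\<lambda>w. fst (f w)) \<Delta>"
proof (rule inj_onI)
  fix w w' assume w: "w \<in> \<Delta>" "w' \<in> \<Delta>" "fst (f w) = fst (f w')"
  have "w * poly Q (fst (f w)) = w' * poly Q (fst (f w))"
    using inverse_eq [OF w(1)] inverse_eq [OF w(2)] unfolding w(3) by (rule trans [OF sym])
  then show "w = w'" using Q_nz [OF w(1)] by (simp only: mult_cancel_right) simp
qed

text \<open>The functional equation is available for arguments of modulus below 1/2, so the local
  inverse has to take its values there; the open mapping theorem provides the radius.\<close>

lemma image_ball:
  obtains r where "r > 0" "ball 0 r \<subseteq> (\<lambda>w. fst (f w)) ` ball 0 (1/2)"
proof -
  let ?B = "ball (0 :: complex) (1/2)"
  have B: "?B \<subseteq> \<Delta>" by (intro subset_ball) simp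
  have "open ((\<lambda>w. fst (f w)) ` ?B)"
    by (rule open_mapping_thm3)
       (use holomorphic_on_subset [OF holo_isometryD(1) [OF iso] B] inj_on_subset [OF inj B] in auto)
  moreover have "0 \<in> (\<lambda>w. fst (f w)) ` ?B" using f0 by (intro image_eqI [of _ _ 0]) auto
  ultimately show ?thesis using that by (meson open_contains_ball)
qed

text \<open>Here \<open>p\<close> is \<open>P\<close> divided by the variable, and
  \<open>v a\<close> collects the coefficients of index \<open>a + 1\<close> of g = Q (f_2 o R). The
  second conclusion says that these series stop at degree \<open>m\<close>, transported from a
  neighbourhood of 0 to all of the disc.\<close>

lemma displacement_coefficients:
  obtains v p where "displacement n m v p Q"
    "\<forall>w\<in>\<Delta>. \<forall>j<n. snd (f w) j * poly Q (fst (f w)) = fst (f w) * (\<Sum>a<m. v a j * fst (f w) ^ a)"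
proof -
  note fD = holo_isometryD [OF iso]
  have Q0: "poly Q 0 \<noteq> 0" and P0: "poly P 0 = 0" using Q_nz [of 0] inverse_eq [of 0] f0 by simp_all
  obtain p where p: "P = pCons 0 p" using P0 by (cases P) auto
  obtain r where r: "r > 0" "ball 0 r \<subseteq> (\<lambda>w. fst (f w)) ` ball 0 (1/2)" by (rule image_ball)
  \<comment> \<open>Near 0 this inverts the first component, so z can serve as the coordinate in
    place of \<open>fst (f w)\<close>.\<close>
  define R where "R z = poly P z / poly Q z" for z
  have R: "poly Q z \<noteq> 0" "R z \<in> ball 0 (1/2)" "fst (f (R z)) = z" if z: "z \<in> ball 0 r" for z
  proof -
    obtain w where w: "w \<in> ball 0 (1/2)" "z = fst (f w)" using subsetD [OF r(2) z] by blast
    then have w': "w \<in> \<Delta>" by simp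
    show Qz: "poly Q z \<noteq> 0" using Q_nz [OF w'] w by simp
    have "R z = w" using inverse_eq [OF w'] Qz w by (simp add: R_def)
    then show "R z \<in> ball 0 (1/2)" "fst (f (R z)) = z" using w by simp_all
  qed
  have R\<Delta>: "R ` ball 0 r \<subseteq> \<Delta>" using R(2) by fastforce
  define g where "g j z = snd (f (R z)) j * poly Q z" for j z
  have R0: "R 0 = 0" by (simp add: R_def P0)
  have g0: "g j 0 = 0" for j by (simp add: g_def R0 f0)
  have "g j holomorphic_on ball 0 r" if "j < n" for j
  proof -
    have "R holomorphic_on ball 0 r" unfolding R_def [abs_def] using R(1) by (auto intro!: holomorphic_intros)
    from holomorphic_on_compose_gen [OF this fD(2) [OF that] R\<Delta>]
    have "(\<lambda>z. snd (f (R z)) j) holomorphic_on ball 0 r" by (simp add: o_def)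
    then show ?thesis unfolding g_def [abs_def] by (auto intro!: holomorphic_intros)
  qed
  define G where "G j = fps_expansion (g j) 0" for j
  have G: "g j has_fps_expansion G j" if "j < n" for j
    unfolding G_def by (rule has_fps_expansion_fps_expansion [of "ball 0 r"]) (use r(1) that \<open>\<And>j. j < n \<Longrightarrow> g j holomorphic_on ball 0 r\<close> in auto)
  define c where "c j a = fps_nth (G j) a" for j a
  have c0: "c j 0 = 0" if "j < n" for j
    using has_fps_expansion_imp_0_eq_fps_nth_0 [OF G [OF that]] g0 by (simp add: c_def)
  \<comment> \<open>The functional equation at \<open>R z\<close> and \<open>R \<xi>\<close>,
    multiplied by \<open>?q\<close>. The factor of the disc is \<open>1 - z * cnj \<xi>\<close>
    because \<open>fst (f (R z)) = z\<close>.\<close>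
  have eq: "(1 - z * cnj \<xi>) * (\<Sum>j<n. g j z * cnj (g j \<xi>)) =
      poly P z * cnj (poly P \<xi>) - z * cnj \<xi> * (poly Q z * cnj (poly Q \<xi>))"
    if z: "z \<in> ball 0 r" and \<xi>: "\<xi> \<in> ball 0 r" for z \<xi>
  proof -
    let ?q = "poly Q z * cnj (poly Q \<xi>)"
    have fe: "1 - R z * cnj (R \<xi>) = (1 - z * cnj \<xi>) * (1 - cip n (snd (f (R z))) (snd (f (R \<xi>))))"
      using isometry_functional_equation [OF iso f0, of "R z" "R \<xi>"] R(2) [OF z] R(2) [OF \<xi>] R(3) [OF z] R(3) [OF \<xi>] by simp
    have "(\<Sum>j<n. g j z * cnj (g j \<xi>)) = ?q * cip n (snd (f (R z))) (snd (f (R \<xi>)))"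
      by (simp add: g_def cip_def sum_distrib_left mult_ac)
    moreover have "poly P z * cnj (poly P \<xi>) = ?q * (R z * cnj (R \<xi>))"
      using R(1) [OF z] R(1) [OF \<xi>] by (simp add: R_def)
    moreover have "(1 - x) * (q * k) = q * y - x * q" if "1 - y = (1 - x) * (1 - k)" for x y k q :: complex
    proof -
      have y: "y = x + (1 - x) * k" using that by (simp add: algebra_simps)
      show ?thesis unfolding y by (simp add: algebra_simps)
    qed
    from this [OF fe, of ?q] show ?thesis using calculation by (simp only:)
  qed
  have nhds: "eventually (\<lambda>z. z \<in> ball 0 r) (nhds (0 :: complex))"
    using r(1) by (intro eventually_nhds_in_open) auto
  \<comment> \<open>Coefficients are compared in \<open>z\<close> for fixed \<open>\<xi>\<close>;
    the result is conjugated and compared in \<open>\<xi>\<close> afterwards, so only power series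
    in one variable occur.\<close>
  have coeff1: "(\<Sum>j<n. c j (Suc a) * cnj (g j \<xi>)) - cnj \<xi> * (\<Sum>j<n. c j a * cnj (g j \<xi>)) =
      coeff P (Suc a) * cnj (poly P \<xi>) - cnj \<xi> * (coeff Q a * cnj (poly Q \<xi>))" if \<xi>: "\<xi> \<in> ball 0 r" for a \<xi>
  proof -
    let ?F = "(\<Sum>j<n. G j * fps_const (cnj (g j \<xi>))) - fps_X * (fps_const (cnj \<xi>) * (\<Sum>j<n. G j * fps_const (cnj (g j \<xi>))))"
    let ?G = "fps_of_poly P * fps_const (cnj (poly P \<xi>)) - fps_X * (fps_const (cnj \<xi>) * (fps_of_poly Q * fps_const (cnj (poly Q \<xi>))))"
    let ?f = "\<lambda>z. (\<Sum>j<n. g j z * cnj (g j \<xi>)) - z * (cnj \<xi> * (\<Sum>j<n. g j z * cnj (g j \<xi>)))"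
    let ?g = "\<lambda>z. poly P z * cnj (poly P \<xi>) - z * (cnj \<xi> * (poly Q z * cnj (poly Q \<xi>)))"
    have "?f has_fps_expansion ?F"
      by (intro fps_expansion_intros has_fps_expansion_sum G) auto
    moreover have "?g has_fps_expansion ?G"
      by (intro fps_expansion_intros has_fps_expansion_poly)
    moreover have "eventually (\<lambda>z. ?f z = ?g z) (nhds 0)"
      using nhds by (rule eventually_mono) (use eq [OF _ \<xi>] in \<open>simp add: left_diff_distrib mult.assoc\<close>)
    ultimately have "?F = ?G" by (rule fps_expansion_unique_ev)
    then have "fps_nth ?F (Suc a) = fps_nth ?G (Suc a)" by simp
    then show ?thesis by (simp add: fps_sum_nth c_def)
  qed
  have coeff2: "(\<Sum>j<n. c j (Suc b) * cnj (c j (Suc a))) - (\<Sum>j<n. c j b * cnj (c j a)) =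
      coeff P (Suc b) * cnj (coeff P (Suc a)) - coeff Q b * cnj (coeff Q a)" for a b
  proof -
    let ?F = "(\<Sum>j<n. G j * fps_const (cnj (c j (Suc a)))) - fps_X * (\<Sum>j<n. G j * fps_const (cnj (c j a)))"
    let ?G = "fps_of_poly P * fps_const (cnj (coeff P (Suc a))) - fps_X * (fps_of_poly Q * fps_const (cnj (coeff Q a)))"
    let ?f = "\<lambda>z. (\<Sum>j<n. g j z * cnj (c j (Suc a))) - z * (\<Sum>j<n. g j z * cnj (c j a))"
    let ?g = "\<lambda>z. poly P z * cnj (coeff P (Suc a)) - z * (poly Q z * cnj (coeff Q a))"
    have "?f has_fps_expansion ?F"
      by (intro fps_expansion_intros has_fps_expansion_sum G) auto
    moreover have "?g has_fps_expansion ?G"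
      by (intro fps_expansion_intros has_fps_expansion_poly)
    moreover have "eventually (\<lambda>z. ?f z = ?g z) (nhds 0)"
      using nhds
    proof (rule eventually_mono)
      fix \<xi> :: complex assume "\<xi> \<in> ball 0 r"
      from arg_cong [OF coeff1 [OF this, of a], of cnj]
      show "?f \<xi> = ?g \<xi>"
        by (simp add: mult.commute)
    qed
    ultimately have "?F = ?G" by (rule fps_expansion_unique_ev)
    then have "fps_nth ?F (Suc b) = fps_nth ?G (Suc b)" by simp
    then show ?thesis by (simp add: fps_sum_nth c_def)
  qed
  \<comment> \<open>The shift of the index is the division by z; \<open>c j 0 = 0\<close> turns the
    first comparison into the row that starts the displacement.\<close>
  define v where "v a j = c j (Suc a)" for a j
  interpret displacement n m v p Q
  proof
    show "cip n (v 0) (v b) = coeff p 0 * cnj (coeff p b) - coeff Q 0 * cnj (coeff Q b)" for b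
      using coeff2 [of 0 b] c0 by (simp add: v_def cip_def p)
    show "cip n (v (Suc a)) (v (Suc b)) = cip n (v a) (v b)
        + coeff p (Suc a) * cnj (coeff p (Suc b)) - coeff Q (Suc a) * cnj (coeff Q (Suc b))" for a b
      using coeff2 [of "Suc a" "Suc b"] by (simp add: v_def cip_def p algebra_simps)
    show "degree p \<le> m" using deg by (cases "p = 0") (auto simp: p)
    show "degree Q \<le> Suc m" using deg by simp
    show "degree p = m \<or> degree Q = Suc m" using deg by (cases "p = 0") (auto simp: p max_def split: if_splits)
    show "coeff Q 0 \<noteq> 0" using Q0 by (simp add: poly_0_coeff_0)
    have "P = [:0, 1:] * p" by (simp add: p)
    then show "coprime p Q" using cop by (metis coprime_mult_left_iff)
  qed
  have near: "snd (f w) j * poly Q (fst (f w)) = fst (f w) * (\<Sum>a<m. v a j * fst (f w) ^ a)"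
    if w: "w \<in> \<Delta>" and j: "j < n" for w j
  proof -
    \<comment> \<open>The vanishing of \<open>v a\<close> from index \<open>m\<close> on makes the
      Taylor series a polynomial. The equality near \<open>z = 0\<close> holds near
      \<open>w = 0\<close> by continuity, then on \<open>\<Delta>\<close> by the identity
      theorem.\<close>
    define q where "q = pCons 0 (\<Sum>a<m. monom (v a j) a)"
    have "G j = fps_of_poly q"
    proof (rule fps_ext)
      fix k show "fps_nth (G j) k = fps_nth (fps_of_poly q) k"
      proof (cases k)
        case 0
        then show ?thesis using c0 [OF j] by (simp add: c_def q_def)
      next
        case (Suc a)
        have "c j (Suc a) = 0" if "a \<ge> m" using v_zero [OF that j] by (simp add: v_def)
        then show ?thesis using Suc by (simp add: q_def coeff_sum v_def c_def)
      qed
    qed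
    then have "g j has_fps_expansion fps_of_poly q" using G [OF j] by simp
    then have "eventually (\<lambda>z. poly q z = g j z) (nhds 0)" by (simp add: has_fps_expansion_def)
    then have ev: "eventually (\<lambda>z. z \<in> ball 0 r \<and> poly q z = g j z) (nhds 0)"
      using nhds eventually_conj by blast
    have "isCont (\<lambda>w. fst (f w)) 0"
      using holomorphic_on_imp_continuous_on [OF fD(1)] by (simp add: continuous_on_eq_continuous_at)
    then have "filterlim (\<lambda>w. fst (f w)) (nhds 0) (nhds 0)"
      using f0 tendsto_at_iff_tendsto_nhds [of "\<lambda>w. fst (f w)" 0] by (simp add: isCont_def)
    then have "eventually (\<lambda>w. fst (f w) \<in> ball 0 r \<and> poly q (fst (f w)) = g j (fst (f w))) (nhds 0)"
      using ev by (rule eventually_compose_filterlim [rotated])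
    then obtain e where e: "e > 0" "\<And>w. w \<in> ball 0 e \<Longrightarrow> fst (f w) \<in> ball 0 r \<and> poly q (fst (f w)) = g j (fst (f w))"
      unfolding eventually_nhds_metric by (auto simp: dist_commute)
    have poly_q: "poly q z = z * (\<Sum>a<m. v a j * z ^ a)" for z
      by (simp add: q_def poly_sum poly_monom)
    have loc: "snd (f w) j * poly Q (fst (f w)) = poly q (fst (f w))" if "w \<in> ball 0 (min e 1)" for w
    proof -
      have w: "w \<in> \<Delta>" "w \<in> ball 0 e" using that by auto
      have "R (fst (f w)) = w" using inverse_eq [OF w(1)] Q_nz [OF w(1)] by (simp add: R_def)
      then show ?thesis using e(2) [OF w(2)] by (simp add: g_def)
    qed
    have "snd (f w) j * poly Q (fst (f w)) = poly q (fst (f w))"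
    proof (rule analytic_continuation_open [of "ball 0 (min e 1)" \<Delta>
          "\<lambda>w. snd (f w) j * poly Q (fst (f w))" "\<lambda>w. poly q (fst (f w))"])
      show "ball (0 :: complex) (min e 1) \<noteq> {}" using e(1) by simp
      show "(\<lambda>w. snd (f w) j * poly Q (fst (f w))) holomorphic_on \<Delta>" "(\<lambda>w. poly q (fst (f w))) holomorphic_on \<Delta>"
        using fD(1) fD(2) [OF j] by (auto intro!: holomorphic_intros)
    qed (use w loc in auto)
    then show ?thesis by (simp only: poly_q)
  qed
  show ?thesis by (rule that [OF displacement_axioms]) (use near in blast)
qed

text \<open>Multiplied by \<open>Q\<close>, the relation becomes a polynomial in
  \<open>fst (f w)\<close> with infinitely many roots. The vectors \<open>v a\<close> contribute to
  \<open>s\<close> only below degree \<open>m\<close>, while \<open>coeff Q m\<close> is nonzero, so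
  \<open>\<alpha>\<close> vanishes first. What remains says that \<open>\<beta>\<close> annihilates
  all \<open>m\<close> vectors, which would make them dependent in dimension \<open>n = m\<close>
  and give a null vector of their Gram matrix.\<close>

lemma components_independent:
  assumes nm: "n = m" and rel: "\<And>w. w \<in> \<Delta> \<Longrightarrow> \<alpha> * fst (f w) + (\<Sum>j<m. \<beta> j * snd (f w) j) = 0"
  shows "\<alpha> = 0" "j < m \<Longrightarrow> \<beta> j = 0"
proof -
  obtain v p where disp: "displacement n m v p Q" and
    rep: "\<forall>w\<in>\<Delta>. \<forall>j<n. snd (f w) j * poly Q (fst (f w)) = fst (f w) * (\<Sum>a<m. v a j * fst (f w) ^ a)"
    by (rule displacement_coefficients)
  interpret displacement n m v p Q by (rule disp)
  define s where "s = smult \<alpha> Q + (\<Sum>a<m. monom (\<Sum>j<m. \<beta> j * v a j) a)"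
  have "poly (pCons 0 s) (fst (f w)) = 0" if w: "w \<in> \<Delta>" for w
  proof -
    let ?z = "fst (f w)"
    have "(\<Sum>j<m. \<beta> j * (snd (f w) j * poly Q ?z)) = (\<Sum>j<m. \<beta> j * (?z * (\<Sum>a<m. v a j * ?z ^ a)))"
      using rep w nm by (intro sum.cong) auto
    also have "\<dots> = ?z * (\<Sum>j<m. \<Sum>a<m. \<beta> j * v a j * ?z ^ a)"
      by (simp add: sum_distrib_left mult_ac)
    also have "\<dots> = ?z * (\<Sum>a<m. (\<Sum>j<m. \<beta> j * v a j) * ?z ^ a)"
      by (subst sum.swap) (simp add: sum_distrib_right)
    finally have "poly (pCons 0 s) ?z = \<alpha> * ?z * poly Q ?z + (\<Sum>j<m. \<beta> j * (snd (f w) j * poly Q ?z))"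
      by (simp add: s_def poly_sum poly_monom distrib_left)
    also have "\<dots> = (\<alpha> * ?z + (\<Sum>j<m. \<beta> j * snd (f w) j)) * poly Q ?z"
      by (simp add: distrib_right sum_distrib_right mult.assoc)
    finally have "poly (pCons 0 s) ?z = (\<alpha> * ?z + (\<Sum>j<m. \<beta> j * snd (f w) j)) * poly Q ?z" .
    then show ?thesis using rel [OF w] by simp
  qed
  then have sub: "(\<lambda>w. fst (f w)) ` \<Delta> \<subseteq> {z. poly (pCons 0 s) z = 0}" by blast
  have "infinite (ball (0 :: complex) 1)" using uncountable_ball [of 1 "0 :: complex"] countable_finite by auto
  then have "infinite ((\<lambda>w. fst (f w)) ` \<Delta>)" using finite_imageD [OF _ inj] by blast
  then have "pCons 0 s = 0" using sub poly_roots_finite finite_subset by blast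
  then have s: "s = 0" by simp
  have "coeff s m = \<alpha> * coeff Q m" by (simp add: s_def coeff_sum)
  then show \<alpha>: "\<alpha> = 0" using s coeff_q_m by simp
  have ann: "(\<Sum>j<m. \<beta> j * v a j) = 0" if "a < m" for a
  proof -
    have "coeff s a = (\<Sum>j<m. \<beta> j * v a j)" using that by (simp add: s_def coeff_sum \<alpha>)
    then show ?thesis using s by simp
  qed
  assume "j < m"
  show "\<beta> j = 0"
  proof (rule ccontr)
    assume "\<beta> j \<noteq> 0"
    from linear_dependence_hyperplane [of j m \<beta> v, OF \<open>j < m\<close> this ann]
    obtain x a where x: "a < m" "x a \<noteq> 0" "\<And>j. j < m \<Longrightarrow> (\<Sum>a<m. x a * v a j) = 0" by blast
    have "(\<Sum>a<m. x a * cip n (v a) (v b)) = 0" for b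
    proof -
      have "(\<Sum>a<m. x a * cip n (v a) (v b)) = (\<Sum>j<m. (\<Sum>a<m. x a * v a j) * cnj (v b j))"
        unfolding cip_def nm sum_distrib_left sum_distrib_right by (subst sum.swap) (simp add: mult.assoc)
      then show ?thesis using x(3) by simp
    qed
    then show False using null_vector_zero [of x a] x by blast
  qed
qed

end

section \<open>Reduction of the dimension\<close>

text \<open>Following the first component by the involution \<open>disc_mob a\<close> means
  preceding its inverse by the same involution; \<open>poly_mob\<close> performs this on numerator
  and denominator without changing the degree.\<close>

lemma normalize_isometry:
  assumes f: "holo_isometry n f" and "n \<ge> 1" and R: "\<forall>w\<in>\<Delta>. rational_value R (fst (f w)) w"
    and deg: "rational_degree R = Suc m"
  obtains \<Theta> P Q where "isometric_aut n \<Theta>" "normalized_isometry n m (\<lambda>w. \<Theta> (f w)) P Q"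
proof -
  define P Q where "P = fst (quot_of_fract R)" and "Q = snd (quot_of_fract R)"
  define a where "a = fst (f 0)"
  note fD = holo_isometryD [OF f]
  have in_disc: "cmod (fst (f w)) < 1" if "w \<in> \<Delta>" for w using fD(3) [OF that] by (simp add: in_disc_ball_iff)
  have a: "cmod a < 1" unfolding a_def by (rule in_disc) simp
  have "f 0 \<in> disc_ball n" by (rule fD(3)) simp
  then obtain \<Theta> where \<Theta>: "isometric_aut n \<Theta>" "\<Theta> (f 0) = (0, \<lambda>_. 0)" "\<And>q. fst (\<Theta> q) = disc_mob a (fst q)"
    using move_to_origin [of "f 0" n] \<open>n \<ge> 1\<close> unfolding a_def by metis
  have cop: "coprime P Q" unfolding P_def Q_def by (rule coprime_quot_of_fract)
  have d: "max (degree P) (degree Q) = Suc m" using deg by (simp add: rational_degree_def P_def Q_def)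
  have mob: "poly (poly_mob a (Suc m) p) (disc_mob a (fst (f w))) =
      (1 - cnj a * disc_mob a (fst (f w))) ^ Suc m * poly p (fst (f w))"
    "1 - cnj a * disc_mob a (fst (f w)) \<noteq> 0" if "w \<in> \<Delta>" "degree p \<le> Suc m" for w p
  proof -
    show nz: "1 - cnj a * disc_mob a (fst (f w)) \<noteq> 0"
      by (intro mob_denom_neq_0 a norm_disc_mob in_disc that)
    show "poly (poly_mob a (Suc m) p) (disc_mob a (fst (f w))) =
      (1 - cnj a * disc_mob a (fst (f w))) ^ Suc m * poly p (fst (f w))"
      using poly_poly_mob [OF that(2) nz] disc_mob_invol [OF a in_disc [OF that(1)]] by simp
  qed
  have deg_le: "degree P \<le> Suc m" "degree Q \<le> Suc m" using d by auto
  have val: "poly Q (fst (f w)) \<noteq> 0" "poly P (fst (f w)) = w * poly Q (fst (f w))" if "w \<in> \<Delta>" for w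
    using R that by (auto simp: rational_value_def P_def Q_def divide_eq_eq)
  have "normalized_isometry n m (\<lambda>w. \<Theta> (f w)) (poly_mob a (Suc m) P) (poly_mob a (Suc m) Q)"
  proof
    show "holo_isometry n (\<lambda>w. \<Theta> (f w))" using \<Theta>(1) f by (simp add: isometric_aut_def)
    show "\<Theta> (f 0) = (0, \<lambda>_. 0)" by (rule \<Theta>(2))
    show "coprime (poly_mob a (Suc m) P) (poly_mob a (Suc m) Q)"
      "max (degree (poly_mob a (Suc m) P)) (degree (poly_mob a (Suc m) Q)) = Suc m"
      using poly_mob_pair [OF cop d a] by simp_all
    fix w assume w: "w \<in> \<Delta>"
    show "poly (poly_mob a (Suc m) P) (fst (\<Theta> (f w))) = w * poly (poly_mob a (Suc m) Q) (fst (\<Theta> (f w)))"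
      unfolding \<Theta>(3) mob(1) [OF w deg_le(1)] mob(1) [OF w deg_le(2)] val(2) [OF w] by (rule mult.left_commute)
    show "poly (poly_mob a (Suc m) Q) (fst (\<Theta> (f w))) \<noteq> 0"
      unfolding \<Theta>(3) mob(1) [OF w deg_le(2)] using mob(2) [OF w deg_le(2)] val(1) [OF w] by simp
  qed
  with \<Theta>(1) show ?thesis by (rule that)
qed

section \<open>Padding, restriction to fewer coordinates, and congruence\<close>

lemma holo_isometry_cong:
  assumes f: "holo_isometry n f" and eq: "\<And>w. w \<in> \<Delta> \<Longrightarrow> g w = f w"
  shows "holo_isometry n g"
proof -
  note fD = holo_isometryD [OF f]
  have ev: "eventually (\<lambda>x. x \<in> \<Delta>) (nhds w)" if "w \<in> \<Delta>" for w
    using that by (intro eventually_nhds_in_open) auto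
  have d: "deriv (\<lambda>w. h (g w)) w = deriv (\<lambda>w. h (f w)) w" if "w \<in> \<Delta>" for h :: "_ \<Rightarrow> complex" and w
    by (rule deriv_cong_ev) (use ev [OF that] in \<open>auto elim!: eventually_mono simp: eq\<close>)
  have hol: "(\<lambda>w. h (g w)) holomorphic_on \<Delta> \<longleftrightarrow> (\<lambda>w. h (f w)) holomorphic_on \<Delta>" for h :: "_ \<Rightarrow> complex"
    by (rule holomorphic_cong) (simp_all add: eq)
  show ?thesis
  proof (rule holo_isometry_transfer [OF f])
    show "g w \<in> disc_ball n" if "w \<in> \<Delta>" for w using fD(3) [OF that] eq [OF that] by simp
    show "(\<lambda>w. fst (g w)) holomorphic_on \<Delta>" using hol [of fst] fD(1) by simp
    show "(\<lambda>w. snd (g w) j) holomorphic_on \<Delta>" if "j < n" for j using hol [of "\<lambda>p. snd p j"] fD(2) [OF that] by simp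
    fix w assume w: "w \<in> \<Delta>"
    show "disc_sq (fst (g w)) (deriv (\<lambda>w. fst (g w)) w) = disc_sq (fst (f w)) (deriv (\<lambda>w. fst (f w)) w)"
      using d [OF w, of fst] eq [OF w] by simp
    show "ball_sq n (snd (g w)) (\<lambda>j. deriv (\<lambda>w. snd (g w) j) w) = ball_sq n (snd (f w)) (\<lambda>j. deriv (\<lambda>w. snd (f w) j) w)"
      using d [OF w, of "\<lambda>p. snd p j" for j] eq [OF w] by simp
  qed
qed

lemma cip_restrict:
  assumes "m \<le> n" "\<And>j. m \<le> j \<Longrightarrow> j < n \<Longrightarrow> x j * cnj (y j) = 0"
  shows "cip n x y = cip m x y"
  unfolding cip_def using assms by (intro sum.mono_neutral_right) auto

lemma deriv_zero_coordinate:
  assumes "\<And>w. w \<in> \<Delta> \<Longrightarrow> g w = (0 :: complex)" "w \<in> \<Delta>" shows "deriv g w = 0"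
proof -
  have "eventually (\<lambda>x. x \<in> \<Delta>) (nhds w)" using assms(2) by (intro eventually_nhds_in_open) auto
  then have "deriv g w = deriv (\<lambda>_. 0) w"
    by (intro deriv_cong_ev) (auto elim!: eventually_mono simp: assms(1))
  then show ?thesis by simp
qed

lemma holo_isometry_restrict:
  assumes f: "holo_isometry n f" and "m \<le> n" and cv: "\<And>w. w \<in> \<Delta> \<Longrightarrow> snd (f w) \<in> cvec m"
  shows "holo_isometry m f"
proof (rule holo_isometry_transfer [OF f])
  note fD = holo_isometryD [OF f]
  show "f w \<in> disc_ball m" if "w \<in> \<Delta>" for w
  proof -
    have "(\<Sum>j<m. (cmod (snd (f w) j))\<^sup>2) \<le> (\<Sum>j<n. (cmod (snd (f w) j))\<^sup>2)"
      using \<open>m \<le> n\<close> by (intro sum_mono2) auto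
    then show ?thesis using fD(3) [OF that] cv [OF that] by (simp add: in_disc_ball_iff complex_ball_iff)
  qed
  fix w assume w: "w \<in> \<Delta>"
  have z: "snd (f w) j = 0" if "j \<ge> m" "w \<in> \<Delta>" for j w using cv [OF that(2)] that(1) by (simp add: cvec_def)
  have d: "deriv (\<lambda>w. snd (f w) j) w = 0" if "j \<ge> m" for j
    by (rule deriv_zero_coordinate [OF z w]) (use that in auto)
  show "ball_sq m (snd (f w)) (\<lambda>j. deriv (\<lambda>w. snd (f w) j) w) = ball_sq n (snd (f w)) (\<lambda>j. deriv (\<lambda>w. snd (f w) j) w)"
    unfolding ball_sq_def using z [OF _ w] d \<open>m \<le> n\<close> by (simp add: cip_restrict [of m n])
qed (use \<open>m \<le> n\<close> holo_isometryD [OF f] in auto)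

text \<open>\<open>congruent_maps\<close> expresses its first map through the second, so the witness
  is the inverse automorphism, with the identity on the source.\<close>

lemma congruent_by_aut:
  assumes "\<Psi> \<in> disc_ball_aut n" "\<And>w. w \<in> \<Delta> \<Longrightarrow> f w \<in> disc_ball n" "\<And>w. w \<in> \<Delta> \<Longrightarrow> g w = \<Psi> (f w)"
  shows "congruent_maps n f g"
proof -
  have "\<exists>\<Phi>\<in>disc_ball_aut n. \<forall>p\<in>disc_ball n. \<Phi> (\<Psi> p) = p"
    by (rule disc_ball_autE [OF assms(1)]) blast
  then obtain \<Phi> where \<Phi>: "\<Phi> \<in> disc_ball_aut n" "\<forall>p\<in>disc_ball n. \<Phi> (\<Psi> p) = p" by blast
  have "f w = \<Phi> (g w)" if "w \<in> \<Delta>" for w using \<Phi>(2) assms(2,3) [OF that] by simp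
  then show ?thesis
    unfolding congruent_maps_def
    by (intro bexI [of _ "\<lambda>z. z"] bexI [of _ \<Phi>] ballI \<Phi>(1) id_disc_aut)
qed

text \<open>After moving \<open>g 0\<close> to the origin, the automorphism maps the hyperplane into a hyperplane by
  Cartan's theorem, but the components of the curve are linearly independent.\<close>

lemma (in normalized_isometry) not_in_hyperplane_image:
  assumes nm: "n = m" and m: "m \<ge> 1" and \<Psi>: "\<Psi> \<in> disc_ball_aut m"
    and g: "\<And>w. w \<in> \<Delta> \<Longrightarrow> g w \<in> disc_ball m" "\<And>w. w \<in> \<Delta> \<Longrightarrow> snd (g w) (m - 1) = 0"
    and fg: "\<And>w. w \<in> \<Delta> \<Longrightarrow> f w = \<Psi> (g w)"
  shows False
proof -
  have g0: "g 0 \<in> disc_ball m" "snd (g 0) (m - 1) = 0" using g by simp_all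
  \<comment> \<open>\<open>move_to_origin\<close> preserves the vanishing of coordinate
    \<open>m - 1\<close> unless it is the first one. It is the first for \<open>m = 1\<close>, but
    then the whole ball part of \<open>g 0\<close> is zero.\<close>
  have side: "m - 1 \<ge> 1 \<or> snd (g 0) = (\<lambda>_. 0)"
  proof (cases "m = 1")
    case True
    have "snd (g 0) j = 0" for j
      using g0 True by (cases "j = 0") (auto simp: in_disc_ball_iff complex_ball_iff cvec_def)
    then show ?thesis by blast
  next
    case False
    then have "m - 1 \<ge> 1" using m by linarith
    then show ?thesis by blast
  qed
  have "\<exists>\<Theta>. isometric_aut m \<Theta> \<and> \<Theta> (g 0) = (0, \<lambda>_. 0) \<and> (\<forall>q. snd q (m - 1) = 0 \<longrightarrow> snd (\<Theta> q) (m - 1) = 0)"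
    by (rule move_to_origin [OF g0(1) m]) (use g0(2) side in blast)
  then obtain \<Theta> where \<Theta>: "isometric_aut m \<Theta>" "\<Theta> (g 0) = (0, \<lambda>_. 0)"
    "\<And>q. snd q (m - 1) = 0 \<Longrightarrow> snd (\<Theta> q) (m - 1) = 0" by blast
  have \<Theta>_aut: "\<Theta> \<in> disc_ball_aut m" using \<Theta>(1) by (simp add: isometric_aut_def)
  have "\<exists>\<Phi>\<in>disc_ball_aut m. \<forall>p\<in>disc_ball m. \<Phi> (\<Theta> p) = p"
    by (rule disc_ball_autE [OF \<Theta>_aut]) blast
  then obtain \<Phi> where \<Phi>: "\<Phi> \<in> disc_ball_aut m" "\<And>p. p \<in> disc_ball m \<Longrightarrow> \<Phi> (\<Theta> p) = p" by blast
  have aut: "(\<lambda>p. \<Psi> (\<Phi> p)) \<in> disc_ball_aut m" by (rule disc_ball_aut_compose [OF \<Psi> \<Phi>(1)])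
  have fix0: "\<Psi> (\<Phi> (0, \<lambda>_. 0)) = (0, \<lambda>_. 0)"
    using \<Phi>(2) [OF g0(1)] fg [of 0] f0 \<Theta>(2) by simp
  have "\<exists>\<alpha> \<beta>. \<forall>p\<in>disc_ball m. \<alpha> * fst (\<Psi> (\<Phi> p)) + (\<Sum>j<m. \<beta> j * snd (\<Psi> (\<Phi> p)) j) = snd p (m - 1)"
    by (rule disc_ball_aut_linear [OF aut fix0, of "m - 1"]) (use m in simp, blast)
  then obtain \<alpha> \<beta> where lin: "\<And>p. p \<in> disc_ball m \<Longrightarrow>
      \<alpha> * fst (\<Psi> (\<Phi> p)) + (\<Sum>j<m. \<beta> j * snd (\<Psi> (\<Phi> p)) j) = snd p (m - 1)" by blast
  have rel: "\<alpha> * fst (f w) + (\<Sum>j<m. \<beta> j * snd (f w) j) = 0" if w: "w \<in> \<Delta>" for w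
    using lin [OF disc_ball_aut_maps [OF \<Theta>_aut g(1) [OF w]]] \<Phi>(2) [OF g(1) [OF w]] fg [OF w] \<Theta>(3) [OF g(2) [OF w]]
    by simp
  have "\<alpha> = 0" "\<And>j. j < m \<Longrightarrow> \<beta> j = 0" using components_independent [OF nm rel] by blast+
  \<comment> \<open>With all coefficients zero, \<open>lin\<close> would make the last coordinate
    vanish on the whole domain; a point with last coordinate 1/2 refutes this.\<close>
  define e where "e = (\<lambda>j. if j = m - 1 then 1/2 else 0 :: complex)"
  have "(\<Sum>j<m. (cmod (e j))\<^sup>2) = (\<Sum>j<m. if j = m - 1 then 1/4 else 0)"
    by (intro sum.cong) (auto simp: e_def power2_eq_square)
  also have "\<dots> = 1/4" using m by simp
  finally have "(0, e) \<in> disc_ball m" using m by (auto simp: in_disc_ball_iff complex_ball_iff cvec_def e_def)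
  from lin [OF this] show False
    using \<open>\<alpha> = 0\<close> \<open>\<And>j. j < m \<Longrightarrow> \<beta> j = 0\<close> by (simp add: e_def)
qed

lemma (in normalized_isometry) reduce_dimension:
  assumes "m \<le> n"
  obtains U where "isometric_aut n (\<lambda>p. (fst p, U (snd p)))"
    "\<And>w. w \<in> \<Delta> \<Longrightarrow> U (snd (f w)) \<in> cvec m" "U (\<lambda>_. 0) = (\<lambda>_. 0)"
proof -
  obtain v p where "displacement n m v p Q" and
    rep: "\<forall>w\<in>\<Delta>. \<forall>j<n. snd (f w) j * poly Q (fst (f w)) = fst (f w) * (\<Sum>a<m. v a j * fst (f w) ^ a)"
    by (rule displacement_coefficients)
  \<comment> \<open>Only the entries of \<open>v a\<close> below \<open>n\<close> are determined;
    cutting off the others places the vectors in \<open>cvec n\<close>, as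
    \<open>triangularize\<close> requires.\<close>
  define u where "u a = (\<lambda>j. if j < n then v a j else 0)" for a
  have u: "u a \<in> cvec n" for a by (simp add: u_def cvec_def)
  have "\<exists>U. isometric_aut n (\<lambda>p. (fst p, U (snd p))) \<and>
      (\<forall>c x. U (\<lambda>j. \<Sum>a<m. c a * x a j) = (\<lambda>j. \<Sum>a<m. c a * U (x a) j)) \<and>
      (\<forall>a<m. \<forall>j\<ge>m. U (u a) j = 0)"
    by (rule triangularize [of m u n]) (use u \<open>m \<le> n\<close> in auto)
  then obtain U where "isometric_aut n (\<lambda>p. (fst p, U (snd p)))"
    "\<forall>c x. U (\<lambda>j. \<Sum>a<m. c a * x a j) = (\<lambda>j. \<Sum>a<m. c a * U (x a) j)"
    "\<forall>a<m. \<forall>j\<ge>m. U (u a) j = 0" by blast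
  note U = this [rule_format]
  show ?thesis
  proof (rule that [OF U(1)])
    fix w assume w: "w \<in> \<Delta>"
    let ?z = "fst (f w)"
    have "snd (f w) j = (\<Sum>a<m. ?z / poly Q ?z * ?z ^ a * u a j)" for j
    proof (cases "j < n")
      case True
      have "snd (f w) j = ?z * (\<Sum>a<m. v a j * ?z ^ a) / poly Q ?z"
        using rep w True Q_nz [OF w] by (simp add: eq_divide_eq)
      also have "\<dots> = (\<Sum>a<m. ?z / poly Q ?z * ?z ^ a * u a j)"
        using True by (simp add: u_def sum_distrib_left sum_divide_distrib mult_ac)
      finally show ?thesis .
    next
      case False
      then show ?thesis
        using holo_isometryD(3) [OF iso w] by (simp add: u_def in_disc_ball_iff complex_ball_iff cvec_def)
    qed
    then have "snd (f w) = (\<lambda>j. \<Sum>a<m. ?z / poly Q ?z * ?z ^ a * u a j)" by blast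
    then have "U (snd (f w)) = (\<lambda>j. \<Sum>a<m. ?z / poly Q ?z * ?z ^ a * U (u a) j)" by (simp only: U(2))
    then show "U (snd (f w)) \<in> cvec m" using U(3) by (simp add: cvec_def)
  next
    show "U (\<lambda>_. 0) = (\<lambda>_. 0)" using U(2) [of "\<lambda>_. 0" "\<lambda>_ _. 0"] by simp
  qed
qed

theorem theorem8:
  fixes n :: nat
    and f :: "complex \<Rightarrow> complex \<times> (nat \<Rightarrow> complex)"
    and R :: "complex poly fract"
  assumes "n \<ge> 2"
    and "holo_isometry n f"
    and "\<not> (\<lambda>w. fst (f w)) constant_on \<Delta>"
    and "\<forall>w\<in>\<Delta>. rational_value R (fst (f w)) w"
  shows "(\<forall>m\<ge>1. rational_degree R = m + 1 \<and> m + 1 \<le> n \<longrightarrow>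
           (\<exists>F. holo_isometry m F \<and>
                holo_isometry n (\<lambda>w. (fst (F w), pad_zeros m (snd (F w)))) \<and>
                congruent_maps n f (\<lambda>w. (fst (F w), pad_zeros m (snd (F w)))) \<and>
                (m \<ge> 2 \<longrightarrow>
                   \<not> (\<exists>m' G. 1 \<le> m' \<and> m' \<le> m - 1 \<and> holo_isometry m' G \<and>
                        congruent_maps m F (\<lambda>w. (fst (G w), pad_zeros m' (snd (G w)))))) \<and>
                (m = 1 \<longrightarrow>
                   \<not> (\<exists>G. disc_isometry G \<and> congruent_maps 1 F (\<lambda>w. (G w, \<lambda>_. 0))))))
         \<and>
         (rational_degree R = 1 \<longrightarrow>
           (\<exists>F. disc_isometry F \<and>
                holo_isometry n (\<lambda>w. (F w, \<lambda>_. 0)) \<and>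
                congruent_maps n f (\<lambda>w. (F w, \<lambda>_. 0))))"
proof (intro conjI allI impI)
  have n: "n \<ge> 1" using assms(1) by simp
  note f = assms(2)
  note fD = holo_isometryD [OF f]
  fix m assume "1 \<le> m" and "rational_degree R = m + 1 \<and> m + 1 \<le> n"
  then have m: "1 \<le> m" "m \<le> n" and deg: "rational_degree R = Suc m" by auto
  obtain \<Theta> P Q where \<Theta>: "isometric_aut n \<Theta>" and N: "normalized_isometry n m (\<lambda>w. \<Theta> (f w)) P Q"
    by (rule normalize_isometry [OF f n assms(4) deg])
  interpret N: normalized_isometry n m "\<lambda>w. \<Theta> (f w)" P Q by (rule N)
  have "\<exists>U. isometric_aut n (\<lambda>p. (fst p, U (snd p))) \<and>
      (\<forall>w\<in>\<Delta>. U (snd (\<Theta> (f w))) \<in> cvec m) \<and> U (\<lambda>_. 0) = (\<lambda>_. 0)"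
    by (rule N.reduce_dimension [OF m(2)]) blast
  then obtain U where U: "isometric_aut n (\<lambda>p. (fst p, U (snd p)))"
    "\<And>w. w \<in> \<Delta> \<Longrightarrow> U (snd (\<Theta> (f w))) \<in> cvec m" "U (\<lambda>_. 0) = (\<lambda>_. 0)"
    by blast
  define \<Psi> where "\<Psi> p = (fst (\<Theta> p), U (snd (\<Theta> p)))" for p
  have \<Psi>: "isometric_aut n \<Psi>" unfolding \<Psi>_def [abs_def] by (rule isometric_aut_compose [OF U(1) \<Theta>])
  define F where "F w = \<Psi> (f w)" for w
  have Fn: "holo_isometry n F" using \<Psi> f by (simp add: isometric_aut_def F_def [abs_def])
  have Fcv: "snd (F w) \<in> cvec m" if "w \<in> \<Delta>" for w using U(2) [OF that] by (simp add: F_def \<Psi>_def)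
  have Fm: "holo_isometry m F" by (rule holo_isometry_restrict [OF Fn m(2) Fcv])
  have pad: "(fst (F w), pad_zeros m (snd (F w))) = F w" if "w \<in> \<Delta>" for w
    using Fcv [OF that] by (intro prod_eqI) (auto simp: pad_zeros_def cvec_def)
  \<comment> \<open>\<open>U\<close> does not touch the first component, so \<open>P\<close>,
    \<open>Q\<close> and \<open>m\<close> stay the same while the ball dimension falls from
    \<open>n\<close> to \<open>m\<close>. The two parameters now agree, as independence of the
    components requires.\<close>
  have norm_F: "normalized_isometry m m F P Q"
  proof
    show "F 0 = (0, \<lambda>_. 0)" using N.f0 U(3) by (simp add: F_def \<Psi>_def)
    fix w :: complex assume w: "w \<in> \<Delta>"
    have "fst (F w) = fst (\<Theta> (f w))" by (simp add: F_def \<Psi>_def)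
    then show "poly P (fst (F w)) = w * poly Q (fst (F w))" "poly Q (fst (F w)) \<noteq> 0"
      using N.inverse_eq [OF w] N.Q_nz [OF w] by simp_all
  qed (use Fm N.cop N.deg in auto)
  note no_hyperplane = normalized_isometry.not_in_hyperplane_image [OF norm_F refl m(1)]
  show "\<exists>F. holo_isometry m F \<and>
                holo_isometry n (\<lambda>w. (fst (F w), pad_zeros m (snd (F w)))) \<and>
                congruent_maps n f (\<lambda>w. (fst (F w), pad_zeros m (snd (F w)))) \<and>
                (m \<ge> 2 \<longrightarrow>
                   \<not> (\<exists>m' G. 1 \<le> m' \<and> m' \<le> m - 1 \<and> holo_isometry m' G \<and>
                        congruent_maps m F (\<lambda>w. (fst (G w), pad_zeros m' (snd (G w)))))) \<and>
                (m = 1 \<longrightarrow>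
                   \<not> (\<exists>G. disc_isometry G \<and> congruent_maps 1 F (\<lambda>w. (G w, \<lambda>_. 0))))"
  proof (intro exI [of _ F] conjI impI notI)
    show "holo_isometry m F" by (rule Fm)
    show "holo_isometry n (\<lambda>w. (fst (F w), pad_zeros m (snd (F w))))"
      by (rule holo_isometry_cong [OF Fn pad])
    show "congruent_maps n f (\<lambda>w. (fst (F w), pad_zeros m (snd (F w))))"
    proof (rule congruent_by_aut)
      show "\<Psi> \<in> disc_ball_aut n" using \<Psi> by (simp add: isometric_aut_def)
      show "(fst (F w), pad_zeros m (snd (F w))) = \<Psi> (f w)" if "w \<in> \<Delta>" for w
        using pad [OF that] by (simp add: F_def)
    qed (rule fD(3))
  next
    assume "\<exists>m' G. 1 \<le> m' \<and> m' \<le> m - 1 \<and> holo_isometry m' G \<and>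
        congruent_maps m F (\<lambda>w. (fst (G w), pad_zeros m' (snd (G w))))"
    then obtain m' G where m': "m' \<le> m - 1" and G: "holo_isometry m' G"
      and "congruent_maps m F (\<lambda>w. (fst (G w), pad_zeros m' (snd (G w))))" by blast
    then obtain \<phi> X where \<phi>: "\<phi> \<in> disc_aut" and X: "X \<in> disc_ball_aut m"
      and FX: "\<And>w. w \<in> \<Delta> \<Longrightarrow> F w = X (fst (G (\<phi> w)), pad_zeros m' (snd (G (\<phi> w))))"
      unfolding congruent_maps_def by blast
    \<comment> \<open>Since \<open>m' \<le> m - 1\<close>, padding leaves coordinate
      \<open>m - 1\<close> equal to zero; precomposition with \<open>\<phi>\<close> does not affect
      this.\<close>
    show False
    proof (rule no_hyperplane [OF X _ _ FX])
      fix w :: complex assume w: "w \<in> \<Delta>"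
      have "\<phi> w \<in> \<Delta>" using \<phi> w unfolding disc_aut_def bij_betw_def by blast
      then have "G (\<phi> w) \<in> disc_ball m'" by (rule holo_isometryD(3) [OF G])
      then have "cmod (fst (G (\<phi> w))) < 1" "(\<Sum>j<m'. (cmod (snd (G (\<phi> w)) j))\<^sup>2) < 1"
        by (simp_all add: in_disc_ball_iff complex_ball_iff)
      moreover have "(\<Sum>j<m. (cmod (pad_zeros m' (snd (G (\<phi> w))) j))\<^sup>2) = (\<Sum>j<m'. (cmod (snd (G (\<phi> w)) j))\<^sup>2)"
        using m' by (intro sum.mono_neutral_cong_right) (auto simp: pad_zeros_def)
      ultimately show "(fst (G (\<phi> w)), pad_zeros m' (snd (G (\<phi> w)))) \<in> disc_ball m"
        using m' by (simp add: in_disc_ball_iff complex_ball_iff) (auto simp: cvec_def pad_zeros_def)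
      show "snd (fst (G (\<phi> w)), pad_zeros m' (snd (G (\<phi> w)))) (m - 1) = 0"
        using m' by (simp add: pad_zeros_def)
    qed
  next
    assume "m = 1" and "\<exists>G. disc_isometry G \<and> congruent_maps 1 F (\<lambda>w. (G w, \<lambda>_. 0))"
    then obtain G \<phi> X where G: "disc_isometry G" and \<phi>: "\<phi> \<in> disc_aut" and X: "X \<in> disc_ball_aut m"
      and FX: "\<And>w. w \<in> \<Delta> \<Longrightarrow> F w = X (G (\<phi> w), \<lambda>_. 0)"
      unfolding congruent_maps_def by blast
    \<comment> \<open>The single ball coordinate is zero. \<open>X\<close> may exchange the two
      discs here, which the hyperplane argument permits.\<close>
    show False
    proof (rule no_hyperplane [OF X _ _ FX])
      fix w :: complex assume w: "w \<in> \<Delta>"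
      have "\<phi> w \<in> \<Delta>" using \<phi> w unfolding disc_aut_def bij_betw_def by blast
      then have "G (\<phi> w) \<in> \<Delta>" using G unfolding disc_isometry_def by blast
      then show "(G (\<phi> w), \<lambda>_. 0) \<in> disc_ball m" by (simp add: in_disc_ball_iff complex_ball_iff cvec_def)
    qed simp
  qed
next
  have n: "n \<ge> 1" using assms(1) by simp
  note f = assms(2)
  assume "rational_degree R = 1"
  then have deg: "rational_degree R = Suc 0" by simp
  obtain \<Theta> P Q where \<Theta>: "isometric_aut n \<Theta>" and N: "normalized_isometry n 0 (\<lambda>w. \<Theta> (f w)) P Q"
    by (rule normalize_isometry [OF f n assms(4) deg])
  interpret N: normalized_isometry n 0 "\<lambda>w. \<Theta> (f w)" P Q by (rule N)
  note D = holo_isometryD [OF N.iso]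
  define F where "F w = fst (\<Theta> (f w))" for w
  \<comment> \<open>For \<open>m = 0\<close> the sum representing the ball components is
    empty.\<close>
  have zero: "snd (\<Theta> (f w)) = (\<lambda>_. 0)" if w: "w \<in> \<Delta>" for w
  proof
    fix j
    obtain v p where "\<forall>w\<in>\<Delta>. \<forall>j<n. snd (\<Theta> (f w)) j * poly Q (fst (\<Theta> (f w))) =
        fst (\<Theta> (f w)) * (\<Sum>a<0. v a j * fst (\<Theta> (f w)) ^ a)"
      by (rule N.displacement_coefficients)
    then show "snd (\<Theta> (f w)) j = 0"
      using w N.Q_nz [OF w] D(3) [OF w]
      by (cases "j < n") (auto simp: in_disc_ball_iff complex_ball_iff cvec_def)
  qed
  have eq: "(F w, \<lambda>_. 0) = \<Theta> (f w)" if "w \<in> \<Delta>" for w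
    using zero [OF that] by (simp add: F_def prod_eq_iff)
  have "disc_isometry F"
    unfolding disc_isometry_iff
  proof (intro conjI ballI)
    show "F holomorphic_on \<Delta>" using D(1) by (simp add: F_def [abs_def])
    show "F ` \<Delta> \<subseteq> \<Delta>" using D(3) by (auto simp: F_def in_disc_ball_iff)
    fix w assume w: "w \<in> \<Delta>"
    have d: "deriv (\<lambda>w. snd (\<Theta> (f w)) j) w = 0" for j
      by (rule deriv_zero_coordinate [OF _ w]) (simp add: zero)
    have "ball_sq n (snd (\<Theta> (f w))) (\<lambda>j. deriv (\<lambda>w. snd (\<Theta> (f w)) j) w) = 0"
      by (simp add: ball_sq_def d cip_def)
    then show "disc_sq w 1 = disc_sq (F w) (deriv F w)"
      using N.iso w unfolding holo_isometry_iff F_def [abs_def] by simp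
  qed
  moreover have "holo_isometry n (\<lambda>w. (F w, \<lambda>_. 0))" by (rule holo_isometry_cong [OF N.iso eq])
  moreover have "congruent_maps n f (\<lambda>w. (F w, \<lambda>_. 0))"
  proof (rule congruent_by_aut)
    show "\<Theta> \<in> disc_ball_aut n" using \<Theta> by (simp add: isometric_aut_def)
    show "(F w, \<lambda>_. 0) = \<Theta> (f w)" if "w \<in> \<Delta>" for w by (rule eq [OF that])
  qed (rule holo_isometryD(3) [OF f])
  ultimately show "\<exists>F. disc_isometry F \<and> holo_isometry n (\<lambda>w. (F w, \<lambda>_. 0)) \<and>
      congruent_maps n f (\<lambda>w. (F w, \<lambda>_. 0))" by blast
qed

end
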